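(* Consider the truncated Rademacher sparse 3-tensor PCA model with truncated prior $P$, sparsity $k=n^{\beta+o(1)}$, $\beta\in(0,1/2)$ (defined in the context). Fix $C>0$ and suppose $n^{-C}\le\lambda\le n^C$. There exist $\lambda_1,\lambda_2=\widetilde\Theta(1)$ with $\lambda_1<\lambda_2$ such that the following holds. If $\lambda\le\lambda_1$, then: (1) the annealed Franz–Parisi potential $\mathcal F^{P}_{\mathrm{ann},\lambda}(q)$ of the truncated model is monotone increasing on the interval $q=s^3\in[0,\Theta((\log n)^3)]$; (2) the low-degree MMSE for any $D=\Theta(\log n)$ is asymptotically trivial, namely $\mathrm{MMSE}^{\le D}_P(\lambda)=(1-o(1))\,\mathrm{MMSE}^{\mathrm{trivial}}_P$. If $\lambda\ge\lambda_2$, then: (1) the annealed Franz–Parisi potential $\mathcal F^{P}_{\mathrm{ann},\lambda}(q)$ of the truncated model is monotone decreasing on the interval $q=s^3\in[0,n^{o(1)}]$; (2) the low-degree MMSE for $D=\Theta(\log n)$ is asymptotically of lower order than the trivial one, namely $\mathrm{MMSE}^{\le D}_P(\lambda)=o(\mathrm{MMSE}^{\mathrm{trivial}}_P)$.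
   Context: Model. Let $u\in\mathbb R^n$ have i.i.d. entries with $\mathbb P(u_i=1)=\mathbb P(u_i=-1)=k/(2n)$ and $u_i=0$ otherwise. Set $v=u$ if $\|u\|_0\in[k/2,2k]$ and $v=1_{[k]}$ (indicator vector of the first $k$ coordinates) otherwise. The truncated prior $P$ is the law of $X=\mathrm{vec}(v^{\otimes3})\in\mathbb R^{N}$, $N=n^3$, and one observes $Y=\sqrt\lambda X+Z$ with $Z\sim N(0,I_N)$ independent of $X$. Annealed Franz–Parisi potential. For i.i.d. $X,X'\sim P$, $\mathcal F^P_{\mathrm{ann},\lambda}(q)=-\log\mathbb E[1_{\langle X,X'\rangle=q}e^{\lambda\langle X,X'\rangle}]=-\lambda q-\log\mathbb P(\langle X,X'\rangle=q)$, considered at overlap values $q=s^3$, $s\ge0$ an integer; monotonicity is understood in the sense of the sign of the discrete derivative $\dfrac{\mathcal F^P_{\mathrm{ann},\lambda}((s+2)^3)-\mathcal F^P_{\mathrm{ann},\lambda}(s^3)}{(s+2)^3-s^3}$. Low-degree MMSE. With $\mathbb R[Y]_{\le D}$ the polynomials in $Y$ of total degree at most $D$, $\mathrm{MMSE}^{\le D}_P(\lambda):=\inf_{f_j\in\mathbb R[Y]_{\le D}}\mathbb E\big[\sum_{j=1}^N(f_j(Y)-X_j)^2\big]$. $\mathrm{MMSE}^{\mathrm{trivial}}_P:=\mathbb E\|X\|^2-\|\mathbb E X\|^2$ is the mean squared error of the best constant estimator. Asymptotics are as $n\to\infty$; $\widetilde\Theta$ hides polylogarithmic factors in $n$. *)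

theory Defs
  imports "HOL-Probability.Probability" "HOL-Library.Landau_Symbols"
begin

text \<open>
  Vectors in \<open>\<real>\<^sup>n\<close> are functions on \<open>nat\<close> read on \<open>{..<n}\<close>, and the \<open>N = n\<^sup>3\<close> tensor coordinates are
  indexed by triples, so that no enumeration of the entries of \<open>vec(v\<^sup>\<otimes>\<^sup>3)\<close> has to be chosen.
\<close>

type_synonym idx = "nat \<times> nat \<times> nat"

definition tensor_idx :: "nat \<Rightarrow> idx set" where
  "tensor_idx n = {..<n} \<times> {..<n} \<times> {..<n}"

definition tensor_cube :: "(nat \<Rightarrow> real) \<Rightarrow> idx \<Rightarrow> real" where
  "tensor_cube v = (\<lambda>(a, b, c). v a * v b * v c)"

definition tensor_inner :: "nat \<Rightarrow> (idx \<Rightarrow> real) \<Rightarrow> (idx \<Rightarrow> real) \<Rightarrow> real" where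
  "tensor_inner n x y = (\<Sum>j\<in>tensor_idx n. x j * y j)"

text \<open>
  \<open>bernoulli_pmf\<close> clamps its parameter to \<open>[0, 1]\<close>; for \<open>k \<le> n\<close> the values \<open>1\<close> and \<open>- 1\<close> have probability
  \<open>k / (2 n)\<close> each.
\<close>

definition entry_pmf :: "nat \<Rightarrow> nat \<Rightarrow> real pmf" where
  "entry_pmf n k = bernoulli_pmf (real k / real n) \<bind>
     (\<lambda>b. if b then pmf_of_set {- 1, 1} else return_pmf 0)"

definition l0_norm :: "nat \<Rightarrow> (nat \<Rightarrow> real) \<Rightarrow> nat" where
  "l0_norm n u = card {i \<in> {..<n}. u i \<noteq> 0}"

definition truncate_vec :: "nat \<Rightarrow> nat \<Rightarrow> (nat \<Rightarrow> real) \<Rightarrow> nat \<Rightarrow> real" where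
  "truncate_vec n k u =
     (if real (l0_norm n u) \<in> {real k / 2 .. 2 * real k} then u else indicat_real {..<k})"

definition truncated_prior :: "nat \<Rightarrow> nat \<Rightarrow> (idx \<Rightarrow> real) pmf" where
  "truncated_prior n k =
     map_pmf (\<lambda>u. tensor_cube (truncate_vec n k u)) (Pi_pmf {..<n} 0 (\<lambda>_. entry_pmf n k))"

text \<open>Extended-real valued, since \<open>- log 0 = \<infinity>\<close> whereas \<open>ln 0 = 0\<close> in HOL.\<close>

definition fp_potential :: "nat \<Rightarrow> nat \<Rightarrow> real \<Rightarrow> real \<Rightarrow> ereal" where
  "fp_potential n k lam q =
     (let w = measure_pmf.expectation (pair_pmf (truncated_prior n k) (truncated_prior n k))
                (\<lambda>(x, x'). indicat_real {q} (tensor_inner n x x') * exp (lam * tensor_inner n x x'))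
      in if w = 0 then \<infinity> else ereal (- ln w))"

definition fp_discrete_deriv :: "nat \<Rightarrow> nat \<Rightarrow> real \<Rightarrow> nat \<Rightarrow> ereal" where
  "fp_discrete_deriv n k lam s =
     (fp_potential n k lam (real ((s + 2) ^ 3)) - fp_potential n k lam (real (s ^ 3)))
       / ereal (real ((s + 2) ^ 3) - real (s ^ 3))"

text \<open>
  Finiteness is required because \<open>\<infinity> - \<infinity> = \<infinity>\<close> on \<open>ereal\<close>: two forbidden overlap values must not
  count as an increase.
\<close>

definition fp_increasing_upto :: "nat \<Rightarrow> nat \<Rightarrow> real \<Rightarrow> real \<Rightarrow> bool" where
  "fp_increasing_upto n k lam q_max \<longleftrightarrow>
     (\<forall>s. real ((s + 2) ^ 3) \<le> q_max \<longrightarrow>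
        fp_potential n k lam (real (s ^ 3)) < \<infinity> \<and> 0 < fp_discrete_deriv n k lam s)"

definition fp_decreasing_upto :: "nat \<Rightarrow> nat \<Rightarrow> real \<Rightarrow> real \<Rightarrow> bool" where
  "fp_decreasing_upto n k lam q_max \<longleftrightarrow>
     (\<forall>s. real ((s + 2) ^ 3) \<le> q_max \<longrightarrow>
        fp_potential n k lam (real (s ^ 3)) < \<infinity> \<and> fp_discrete_deriv n k lam s < 0)"

definition exponents_upto :: "'i set \<Rightarrow> nat \<Rightarrow> ('i \<Rightarrow> nat) set" where
  "exponents_upto J D = {\<alpha> \<in> J \<rightarrow>\<^sub>E {..D}. (\<Sum>j\<in>J. \<alpha> j) \<le> D}"

definition polys_upto :: "'i set \<Rightarrow> nat \<Rightarrow> (('i \<Rightarrow> real) \<Rightarrow> real) set" where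
  "polys_upto J D =
     range (\<lambda>c y. \<Sum>\<alpha>\<in>exponents_upto J D. c \<alpha> * (\<Prod>j\<in>J. y j ^ \<alpha> j))"

definition signal_noise :: "nat \<Rightarrow> nat \<Rightarrow> ((idx \<Rightarrow> real) \<times> (idx \<Rightarrow> real)) measure" where
  "signal_noise n k =
     measure_pmf (truncated_prior n k) \<Otimes>\<^sub>M (\<Pi>\<^sub>M j\<in>tensor_idx n. std_normal_distribution)"

definition observation :: "real \<Rightarrow> (idx \<Rightarrow> real) \<Rightarrow> (idx \<Rightarrow> real) \<Rightarrow> idx \<Rightarrow> real" where
  "observation lam x z = (\<lambda>j. sqrt lam * x j + z j)"

text \<open>
  The integrand is always integrable (a polynomial in Gaussians and finitely supported variables),
  so no estimator receives the default value of the Bochner integral.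
\<close>

definition low_deg_mmse :: "nat \<Rightarrow> nat \<Rightarrow> nat \<Rightarrow> real \<Rightarrow> real" where
  "low_deg_mmse D n k lam =
     (INF f \<in> tensor_idx n \<rightarrow> polys_upto (tensor_idx n) D.
        \<integral>(x, z). (\<Sum>j\<in>tensor_idx n. (f j (observation lam x z) - x j)\<^sup>2) \<partial>signal_noise n k)"

definition trivial_mmse :: "nat \<Rightarrow> nat \<Rightarrow> real" where
  "trivial_mmse n k =
     measure_pmf.expectation (truncated_prior n k) (\<lambda>x. \<Sum>j\<in>tensor_idx n. (x j)\<^sup>2)
     - (\<Sum>j\<in>tensor_idx n. (measure_pmf.expectation (truncated_prior n k) (\<lambda>x. x j))\<^sup>2)"

text \<open>\<open>f(n) = n\<^bsup>b + o(1)\<^esup>\<close>\<close>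

definition power_n_o1 :: "real \<Rightarrow> (nat \<Rightarrow> real) \<Rightarrow> bool" where
  "power_n_o1 b f \<longleftrightarrow>
     (\<exists>\<epsilon>. \<epsilon> \<longlonglongrightarrow> 0 \<and> (\<forall>\<^sub>F n in sequentially. f n = real n powr (b + \<epsilon> n)))"

text \<open>\<open>f\<close> is of order one up to polylogarithmic factors; multiplicative constants are absorbed by \<open>a\<close>.\<close>

definition polylog_order_one :: "(nat \<Rightarrow> real) \<Rightarrow> bool" where
  "polylog_order_one f \<longleftrightarrow>
     (\<exists>a>0. \<forall>\<^sub>F n in sequentially. ln (real n) powr (- a) \<le> f n \<and> f n \<le> ln (real n) powr a)"

unbundle asymp_equiv_syntax

end

theory Submission
  imports Defs "HOL-Real_Asymp.Real_Asymp"
begin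

text \<open>
  Write \<open>S = \<langle>v, v'\<rangle>\<close>, so that \<open>\<langle>X, X'\<rangle> = S\<^sup>3\<close>. Since \<open>k\<^sup>2 / n\<close> tends to zero polynomially fast,
  \<open>P(S = s)\<close> is comparable to \<open>(n choose s) r\<^sup>s\<close> with \<open>r = k\<^sup>2 / (2 n\<^sup>2)\<close>; the truncation event has probability
  exponentially small in \<open>k\<close> and is negligible for \<open>s = n\<^bsup>o(1)\<^esup>\<close>. Passing from \<open>s\<close> to \<open>s + 2\<close> costs a power
  of \<open>n\<close> and gains \<open>exp (\<lambda> ((s + 2)\<^sup>3 - s\<^sup>3))\<close>, which gives both statements on the potential.

  For large \<open>\<lambda>\<close> the entrywise estimators \<open>(Y\<^sub>j / sqrt \<lambda>)\<^sup>d\<close> with \<open>d\<close> odd of order \<open>ln n\<close> suffice: they shrink pure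
  noise by the factor \<open>(d / \<lambda>)\<^sup>d\<close>, which beats every power of \<open>n\<close>, and distort the signal entries only by \<open>d\<^sup>2 / \<lambda>\<close>.

  For small \<open>\<lambda>\<close> the lower bound is by duality. If \<open>W = W(Z)\<close> satisfies \<open>E f(Y) W = E f(Y) h(X)\<close> for all polynomials
  of degree at most \<open>D\<close>, then \<open>E (f(Y) - h(X))\<^sup>2 \<ge> E h(X)\<^sup>2 - E W\<^sup>2\<close>. Such a \<open>W\<close> is a combination of Gaussian
  tilts in the directions \<open>X\<^sub>0 + \<dots> + X\<^sub>i\<close> of independent copies of the signal: a tilt by \<open>m\<close> moves \<open>Y\<close> to \<open>Y + m\<close>, and
  as the mixed moments of \<open>X\<^sub>0 + \<dots> + X\<^sub>i\<close> are polynomial in \<open>i\<close>, one can extrapolate to \<open>i = - 1\<close> and thereby cancel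
  the signal contained in \<open>Y\<close>. In the limit of infinitesimal tilts \<open>E W\<^sup>2\<close> involves only the overlap moments
  \<open>E \<bar>S\<bar>\<^bsup>3 (d + 1)\<^esup>\<close> with \<open>d \<le> D\<close>, which are \<open>k\<^sup>2 / n\<close> up to factors polynomial in \<open>ln n\<close> for each degree.
\<close>

section \<open>Low-degree duality\<close>

lemma expectation_finite_support:
  fixes f :: "'a \<Rightarrow> real"
  assumes "finite (set_pmf p)"
  shows "measure_pmf.expectation p f = (\<Sum>x\<in>set_pmf p. pmf p x * f x)"
  using integral_measure_pmf[of "set_pmf p" p f] assms by auto

lemma expectation_bind_finite:
  fixes f :: "'b \<Rightarrow> real"
  assumes "finite (set_pmf p)" and "\<And>x. x \<in> set_pmf p \<Longrightarrow> finite (set_pmf (q x))"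
  shows "measure_pmf.expectation (p \<bind> q) f =
    measure_pmf.expectation p (\<lambda>x. measure_pmf.expectation (q x) f)"
  using pmf_expectation_bind[of "set_pmf p" q p f] assms
  by (simp add: expectation_finite_support)

lemma expectation_pair_finite:
  fixes f :: "'a \<times> 'b \<Rightarrow> real"
  assumes "finite (set_pmf p)" and "finite (set_pmf q)"
  shows "measure_pmf.expectation (pair_pmf p q) f =
    measure_pmf.expectation p (\<lambda>x. measure_pmf.expectation q (\<lambda>y. f (x, y)))"
  unfolding pair_pmf_def using assms
  by (simp add: expectation_bind_finite)

lemma finite_set_replicate_pmf:
  assumes "finite (set_pmf p)"
  shows "finite (set_pmf (replicate_pmf n p))"
proof -
  have "set_pmf (replicate_pmf n p) = {xs. set xs \<subseteq> set_pmf p \<and> length xs = n}"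
    by (auto simp: set_replicate_pmf)
  then show ?thesis using finite_lists_length_eq[OF assms, of n] by simp
qed

lemma expectation_replicate_Suc:
  fixes F :: "'a list \<Rightarrow> real"
  assumes "finite (set_pmf p)"
  shows "measure_pmf.expectation (replicate_pmf (Suc n) p) F =
    measure_pmf.expectation p (\<lambda>x. measure_pmf.expectation (replicate_pmf n p) (\<lambda>xs. F (x # xs)))"
  using assms finite_set_replicate_pmf[OF assms, of n]
  by (simp add: expectation_bind_finite)

lemma expectation_sum_finite:
  fixes f :: "'b \<Rightarrow> 'a \<Rightarrow> real"
  assumes "finite (set_pmf p)"
  shows "measure_pmf.expectation p (\<lambda>x. \<Sum>a\<in>A. f a x) = (\<Sum>a\<in>A. measure_pmf.expectation p (f a))"
  by (intro Bochner_Integration.integral_sum integrable_measure_pmf_finite assms)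

lemma expectation_mono_finite:
  fixes f g :: "'a \<Rightarrow> real"
  assumes "finite (set_pmf p)" and "\<And>x. x \<in> set_pmf p \<Longrightarrow> f x \<le> g x"
  shows "measure_pmf.expectation p f \<le> measure_pmf.expectation p g"
  using assms by (simp add: expectation_finite_support sum_mono mult_left_mono)

text \<open>Keeps \<open>replicate_pmf (Suc i) P\<close> folded from here on; the first draw is
  split off only through \<open>expectation_replicate_Suc\<close>.\<close>

declare replicate_pmf.simps(2) [simp del]

section \<open>Finite differences and Newton extrapolation\<close>

definition fdiff :: "(nat \<Rightarrow> real) \<Rightarrow> nat \<Rightarrow> real" where
  "fdiff g = (\<lambda>i. g (Suc i) - g i)"

lemma fdiff_pow_Suc: "(fdiff ^^ Suc k) g = (fdiff ^^ k) (fdiff g)"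
  by (simp add: funpow_swap1)

lemma fdiff_pow_linear:
  "(fdiff ^^ k) (\<lambda>i. \<Sum>a\<in>A. g a i * c a) = (\<lambda>i. \<Sum>a\<in>A. (fdiff ^^ k) (g a) i * c a)"
  by (induction k) (auto simp: fdiff_def sum_subtractf left_diff_distrib)

lemma fdiff_pow_shift: "(fdiff ^^ k) (\<lambda>i. g (Suc i)) = (\<lambda>i. (fdiff ^^ k) g (Suc i))"
  by (induction k) (auto simp: fdiff_def)

text \<open>Binomial expansion of a power of shift minus identity, with Pascal's rule in the
  induction step. The sign exponent \<open>k + i\<close> has the parity of k - i and avoids
  truncated subtraction.\<close>

lemma fdiff_pow_explicit:
  "(fdiff ^^ k) g m = (\<Sum>i\<le>k. (- 1) ^ (k + i) * real (k choose i) * g (m + i))"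
proof (induction k arbitrary: m)
  case (Suc k)
  have "(fdiff ^^ Suc k) g m = (fdiff ^^ k) g (Suc m) - (fdiff ^^ k) g m"
    by (simp add: fdiff_def)
  \<comment> \<open>The index \<open>Suc k\<close> adds nothing to the second sum since
    \<open>k choose Suc k\<close> is 0; it is included so that an index shift aligns the two
    sums.\<close>
  also have "\<dots> = (\<Sum>i\<le>k. (- 1) ^ (k + i) * real (k choose i) * g (m + Suc i))
      - (\<Sum>i\<le>Suc k. (- 1) ^ (k + i) * real (k choose i) * g (m + i))"
    using Suc by simp
  also have "\<dots> = - ((- 1) ^ k * g m) + (\<Sum>i\<le>k. (- 1) ^ (k + i) * real (k choose i) * g (m + Suc i)
      + (- 1) ^ (k + i) * real (k choose Suc i) * g (m + Suc i))"
    by (subst sum.atMost_Suc_shift) (simp add: sum.distrib sum_negf)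
  also have "\<dots> = (\<Sum>i\<le>Suc k. (- 1) ^ (Suc k + i) * real (Suc k choose i) * g (m + i))"
    by (subst sum.atMost_Suc_shift) (simp add: algebra_simps)
  finally show ?case .
qed simp

text \<open>
  Newton extrapolation: if \<open>g\<close> is a polynomial of degree at most \<open>d\<close>, then \<open>\<Sum>i\<le>d. extrap_coeff d i * g i\<close> is \<open>g (- 1)\<close>.
\<close>

definition extrap_coeff :: "nat \<Rightarrow> nat \<Rightarrow> real" where
  "extrap_coeff d i = (\<Sum>k\<le>d. (- 1) ^ i * real (k choose i))"

text \<open>After exchanging the sums, binomials with \<open>i > k\<close> vanish and each inner sum
  is a difference at 0. The right side is Newton's forward series at -1 cut off after order
  \<open>d\<close>, because the generalised binomial (-1 choose k) equals (-1)^k.\<close>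

lemma extrap_coeff_sum:
  "(\<Sum>i\<le>d. extrap_coeff d i * g i) = (\<Sum>k\<le>d. (- 1) ^ k * (fdiff ^^ k) g 0)"
proof -
  have "(\<Sum>i\<le>d. extrap_coeff d i * g i) = (\<Sum>i\<le>d. \<Sum>k\<le>d. (- 1) ^ i * real (k choose i) * g i)"
    unfolding extrap_coeff_def by (simp add: sum_distrib_right)
  also have "\<dots> = (\<Sum>k\<le>d. \<Sum>i\<le>d. (- 1) ^ i * real (k choose i) * g i)"
    by (rule sum.swap)
  also have "\<dots> = (\<Sum>k\<le>d. \<Sum>i\<le>k. (- 1) ^ i * real (k choose i) * g i)"
    by (intro sum.cong sum.mono_neutral_right) (auto simp: binomial_eq_0)
  also have "\<dots> = (\<Sum>k\<le>d. (- 1) ^ k * (fdiff ^^ k) g 0)"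
    by (simp add: fdiff_pow_explicit sum_distrib_left power_add flip: mult.assoc power_mult_distrib)
  finally show ?thesis .
qed

text \<open>Triangle inequality and the row sums 2^k of Pascal's triangle. This is the price of the
  extrapolation in the energy bound.\<close>

lemma extrap_coeff_abs_sum: "(\<Sum>i\<le>d. \<bar>extrap_coeff d i\<bar>) \<le> 2 ^ (d + 1)"
proof -
  have "(\<Sum>i\<le>d. \<bar>extrap_coeff d i\<bar>) \<le> (\<Sum>i\<le>d. \<Sum>k\<le>d. real (k choose i))"
    unfolding extrap_coeff_def
    by (intro sum_mono order.trans[OF sum_abs]) (auto simp: abs_mult intro!: sum_mono)
  also have "\<dots> = (\<Sum>k\<le>d. \<Sum>i\<le>d. real (k choose i))"
    by (rule sum.swap)
  also have "\<dots> = (\<Sum>k\<le>d. \<Sum>i\<le>k. real (k choose i))"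
    by (intro sum.cong sum.mono_neutral_right) (auto simp: binomial_eq_0)
  also have "\<dots> = (\<Sum>k\<le>d. 2 ^ k)"
    by (metis (no_types) choose_row_sum of_nat_numeral of_nat_power of_nat_sum)
  also have "\<dots> = 2 ^ (d + 1) - 1"
    by (induction d) auto
  finally show ?thesis by simp
qed

text \<open>The shift is the identity plus \<open>fdiff\<close>, so the alternating sum telescopes
  up to one difference of order \<open>D + 1\<close>. Whenever that difference vanishes,
  extrapolating the shifted sequence to -1 returns \<open>g 0\<close>.\<close>

lemma extrap_shift:
  "(\<Sum>k\<le>D. (- 1) ^ k * (fdiff ^^ k) (\<lambda>i. g (Suc i)) 0) = g 0 + (- 1) ^ D * (fdiff ^^ Suc D) g 0"
proof (induction D)
  case (Suc D)
  have "(fdiff ^^ Suc (Suc D)) g 0 = (fdiff ^^ Suc D) g (Suc 0) - (fdiff ^^ Suc D) g 0"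
    by (simp only: funpow.simps o_def fdiff_def)
  then show ?case unfolding sum.atMost_Suc Suc by (simp only: fdiff_pow_shift) (simp add: algebra_simps)
qed (simp add: fdiff_def)

section \<open>Moments of sums of independent copies, and the dual identity\<close>

definition vsum :: "('x \<Rightarrow> 'i \<Rightarrow> real) \<Rightarrow> 'x list \<Rightarrow> 'i \<Rightarrow> real" where
  "vsum e xs j = (\<Sum>x\<leftarrow>xs. e x j)"

text \<open>
  The weight \<open>h\<close> sits on the last copy because further copies are consed in front.
\<close>

definition copies_moment ::
  "'x pmf \<Rightarrow> ('x \<Rightarrow> 'i \<Rightarrow> real) \<Rightarrow> ('x \<Rightarrow> real) \<Rightarrow> ('b \<Rightarrow> 'i) \<Rightarrow> ('b \<Rightarrow> real) \<Rightarrow> 'b set \<Rightarrow> nat \<Rightarrow> real" where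
  "copies_moment P e h \<tau> \<zeta> B i = measure_pmf.expectation (replicate_pmf (Suc i) P)
     (\<lambda>xs. h (last xs) * (\<Prod>b\<in>B. vsum e xs (\<tau> b) + \<zeta> b))"

lemma copies_moment_0:
  assumes "finite (set_pmf P)"
  shows "copies_moment P e h \<tau> \<zeta> B 0 =
    measure_pmf.expectation P (\<lambda>x. h x * (\<Prod>b\<in>B. e x (\<tau> b) + \<zeta> b))"
  unfolding copies_moment_def expectation_replicate_Suc[OF assms]
  by (simp add: vsum_def)

text \<open>The new copy \<open>y\<close> is split off and the product expanded: factors in
  \<open>A\<close> take their summand from the old copies, factors in \<open>B - A\<close> from
  \<open>y\<close>, and independence separates them. The constant is split in two so that it can be
  put on either side: on the old copies in the difference recursion, on the new one in the dual
  identity.\<close>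

lemma copies_moment_Suc:
  assumes P: "finite (set_pmf P)" and B: "finite B"
  shows "copies_moment P e h \<tau> (\<lambda>b. \<zeta> b + \<zeta>' b) B (Suc i) =
    (\<Sum>A\<in>Pow B. copies_moment P e h \<tau> \<zeta> A i *
       measure_pmf.expectation P (\<lambda>y. \<Prod>b\<in>B - A. e y (\<tau> b) + \<zeta>' b))"
proof -
  note R = finite_set_replicate_pmf[OF P, of "Suc i"]
  have last: "h (last (x # xs)) = h (last xs)" if "xs \<in> set_pmf (replicate_pmf (Suc i) P)" for x xs
    using that unfolding set_replicate_pmf by auto
  have "copies_moment P e h \<tau> (\<lambda>b. \<zeta> b + \<zeta>' b) B (Suc i) =
    measure_pmf.expectation P (\<lambda>y. measure_pmf.expectation (replicate_pmf (Suc i) P)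
      (\<lambda>xs. h (last xs) * (\<Prod>b\<in>B. (vsum e xs (\<tau> b) + \<zeta> b) + (e y (\<tau> b) + \<zeta>' b))))"
    unfolding copies_moment_def expectation_replicate_Suc[OF P, of "Suc i"]
      expectation_finite_support[OF R]
    by (intro arg_cong[where f = "measure_pmf.expectation P"] ext sum.cong refl)
       (simp only: last, simp add: vsum_def algebra_simps)
  also have "\<dots> = measure_pmf.expectation P (\<lambda>y. measure_pmf.expectation (replicate_pmf (Suc i) P)
      (\<lambda>xs. \<Sum>A\<in>Pow B. h (last xs) * (\<Prod>b\<in>A. vsum e xs (\<tau> b) + \<zeta> b) *
         (\<Prod>b\<in>B - A. e y (\<tau> b) + \<zeta>' b)))"
    by (subst prod_add[OF B]) (simp add: sum_distrib_left mult.assoc)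
  also have "\<dots> = (\<Sum>A\<in>Pow B. copies_moment P e h \<tau> \<zeta> A i *
       measure_pmf.expectation P (\<lambda>y. \<Prod>b\<in>B - A. e y (\<tau> b) + \<zeta>' b))"
    unfolding expectation_sum_finite[OF R] expectation_sum_finite[OF P] copies_moment_def
    by (simp add: R P)
  finally show ?thesis .
qed

text \<open>As a function of the number of copies the moment is a polynomial of degree at most
  \<open>card B\<close>. In \<open>copies_moment_Suc\<close> the term \<open>A = B\<close> is the
  moment at \<open>i\<close> itself, so a difference involves proper subsets only, and induction on
  \<open>card B\<close> applies.\<close>

lemma fdiff_copies_moment:
  assumes P: "finite (set_pmf P)"
  shows "finite B \<Longrightarrow> card B < N \<Longrightarrow> (fdiff ^^ N) (copies_moment P e h \<tau> \<zeta> B) = (\<lambda>_. 0)"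
proof (induction "card B" arbitrary: B N rule: less_induct)
  case less
  obtain N' where N: "N = Suc N'" using less.prems by (cases N) auto
  let ?\<xi> = "\<lambda>A. measure_pmf.expectation P (\<lambda>y. \<Prod>b\<in>B - A. e y (\<tau> b))"
  have "fdiff (copies_moment P e h \<tau> \<zeta> B) =
    (\<lambda>i. \<Sum>A\<in>Pow B - {B}. copies_moment P e h \<tau> \<zeta> A i * ?\<xi> A)"
  proof
    fix i
    have "copies_moment P e h \<tau> \<zeta> B (Suc i) = (\<Sum>A\<in>Pow B. copies_moment P e h \<tau> \<zeta> A i * ?\<xi> A)"
      using copies_moment_Suc[OF P less.prems(1), of e h \<tau> \<zeta> "\<lambda>_. 0" i] by simp
    also have "\<dots> = copies_moment P e h \<tau> \<zeta> B i +
        (\<Sum>A\<in>Pow B - {B}. copies_moment P e h \<tau> \<zeta> A i * ?\<xi> A)"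
      using less.prems by (subst sum.remove[of _ B]) auto
    finally show "fdiff (copies_moment P e h \<tau> \<zeta> B) i =
      (\<Sum>A\<in>Pow B - {B}. copies_moment P e h \<tau> \<zeta> A i * ?\<xi> A)"
      by (simp add: fdiff_def)
  qed
  moreover have "(fdiff ^^ N') (copies_moment P e h \<tau> \<zeta> A) = (\<lambda>_. 0)" if "A \<in> Pow B - {B}" for A
  proof -
    have "A \<subset> B" using that by auto
    then have "card A < card B" using less.prems by (simp add: psubset_card_mono)
    then show ?thesis using less.prems N \<open>A \<subset> B\<close>
      by (intro less.hyps) (auto intro: finite_subset)
  qed
  ultimately show ?case
    unfolding N fdiff_pow_Suc by (simp add: fdiff_pow_linear)
qed

text \<open>\<open>\<Sum>l\<le>D. c d l * q l\<close> is the coefficient of order \<open>d\<close> of a polynomial \<open>q\<close> of degree at most \<open>D\<close>.\<close>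

lemma lagrange_coeffs:
  fixes D :: nat
  obtains c :: "nat \<Rightarrow> nat \<Rightarrow> real" where
    "\<And>d e. e \<le> D \<Longrightarrow> (\<Sum>l\<le>D. c d l * real l ^ e) = (if e = d then 1 else 0)"
proof -
  \<comment> \<open>The Lagrange basis at the nodes 0, ..., \<open>D\<close>; its coefficients will
    be the weights.\<close>
  define L :: "nat \<Rightarrow> real poly" where
    "L l = (\<Prod>k\<in>{..D} - {l}. smult (1 / (real l - real k)) [:- real k, 1:])" for l
  have degL: "degree (L l) \<le> D" if "l \<le> D" for l
  proof -
    have "degree (L l) \<le> (\<Sum>k\<in>{..D} - {l}. degree (smult (1 / (real l - real k)) [:- real k, 1:]))"
      unfolding L_def by (rule order.trans[OF degree_prod_sum_le]) (auto simp: o_def)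
    also have "\<dots> \<le> (\<Sum>k\<in>{..D} - {l}. 1)"
      by (intro sum_mono) simp
    also have "\<dots> = D" using that by simp
    finally show ?thesis .
  qed
  have evL: "poly (L l) (real m) = (if m = l then 1 else 0)" if "l \<le> D" "m \<le> D" for l m
  proof (cases "m = l")
    case True
    have "poly (L l) (real m) = (\<Prod>k\<in>{..D} - {l}. 1)"
      unfolding L_def poly_prod using True
      by (intro prod.cong) (auto simp: diff_divide_distrib[symmetric])
    then show ?thesis using True by simp
  next
    case False
    then show ?thesis using that by (auto simp: L_def poly_prod)
  qed
  \<comment> \<open>Otherwise the difference would be a nonzero polynomial of degree at most
    \<open>D\<close> with \<open>D + 1\<close> roots.\<close>
  have key: "(\<Sum>l\<le>D. smult (real l ^ e) (L l)) = monom 1 e" if "e \<le> D" for e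
  proof (rule ccontr)
    define q where "q = (\<Sum>l\<le>D. smult (real l ^ e) (L l)) - monom 1 e"
    assume "(\<Sum>l\<le>D. smult (real l ^ e) (L l)) \<noteq> monom 1 e"
    then have q0: "q \<noteq> 0" by (simp add: q_def)
    have "degree q \<le> D" unfolding q_def
      using that degL by (intro degree_diff_le degree_sum_le) (auto simp: degree_monom_eq)
    moreover have "real ` {..D} \<subseteq> {x. poly q x = 0}"
    proof
      fix x assume "x \<in> real ` {..D}"
      then obtain m where m: "m \<le> D" "x = real m" by auto
      have "poly q x = (\<Sum>l\<le>D. real l ^ e * (if m = l then 1 else 0)) - real m ^ e"
        using m by (auto simp: q_def poly_sum evL poly_monom intro!: sum.cong)
      also have "(\<Sum>l\<le>D. real l ^ e * (if m = l then 1 else 0)) = (\<Sum>l\<le>D. if m = l then real l ^ e else 0)"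
        by (intro sum.cong) auto
      also have "\<dots> - real m ^ e = 0" using m by (subst sum.delta') auto
      finally show "x \<in> {x. poly q x = 0}" by simp
    qed
    then have "card (real ` {..D}) \<le> card {x. poly q x = 0}"
      by (intro card_mono poly_roots_finite q0)
    then have "D + 1 \<le> card {x. poly q x = 0}"
      by (simp add: card_image inj_on_def)
    ultimately show False using card_poly_roots_bound[OF q0] by linarith
  qed
  show ?thesis
  proof (rule that[of "\<lambda>d l. coeff (L l) d"])
    fix d e assume "e \<le> D"
    have "(\<Sum>l\<le>D. coeff (L l) d * real l ^ e) = coeff (\<Sum>l\<le>D. smult (real l ^ e) (L l)) d"
      by (simp add: coeff_sum mult.commute)
    also have "\<dots> = (if e = d then 1 else 0)" using key[OF \<open>e \<le> D\<close>] by simp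
    finally show "(\<Sum>l\<le>D. coeff (L l) d * real l ^ e) = (if e = d then 1 else 0)" .
  qed
qed

lemma expectation_cmult:
  fixes f :: "'a \<Rightarrow> real"
  shows "measure_pmf.expectation p (\<lambda>x. c * f x) = c * measure_pmf.expectation p f"
  by simp

text \<open>The weights \<open>c d l\<close> isolate the part of order \<open>d\<close> in the tilt.
  It is a combination of moments of \<open>i + 1\<close> copies over sets of \<open>d\<close>
  factors, polynomial in \<open>i\<close> of degree at most \<open>d\<close>, so
  \<open>extrap_coeff d\<close> extrapolates it to -1. All orders together form the moment of the
  tilt copies plus the signal copy, and at -1 only the copy carrying \<open>h\<close> is
  left.\<close>

lemma dual_identity_prod:
  fixes \<eta> :: real
  assumes P: "finite (set_pmf P)" and B: "finite B" "card B \<le> D" and "\<eta> \<noteq> 0"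
    and lag: "\<And>d e. e \<le> D \<Longrightarrow> (\<Sum>l\<le>D. c d l * real l ^ e) = (if e = d then 1 else 0)"
  shows "(\<Sum>d\<le>D. \<Sum>i\<le>d. extrap_coeff d i * measure_pmf.expectation (replicate_pmf (Suc i) P)
      (\<lambda>xs. h (last xs) * (\<Sum>l\<le>D. c d l / \<eta> ^ d * measure_pmf.expectation P
         (\<lambda>y. \<Prod>b\<in>B. e y (\<tau> b) + \<zeta> b + \<eta> * real l * vsum e xs (\<tau> b))))) =
    measure_pmf.expectation P (\<lambda>x. h x * (\<Prod>b\<in>B. e x (\<tau> b) + \<zeta> b))"
proof -
  define \<Xi> where "\<Xi> A = measure_pmf.expectation P (\<lambda>y. \<Prod>b\<in>B - A. e y (\<tau> b) + \<zeta> b)" for A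
  define M where "M = copies_moment P e h \<tau> (\<lambda>_. 0)"
  have cardA: "card A \<le> D" if "A \<in> Pow B" for A
    using that B by (meson PowD card_mono le_trans)
  \<comment> \<open>Expanding in the tilt produces \<open>(\<eta> * real l) ^ card A\<close>. The
    weights select \<open>card A = d\<close>, where the division by \<open>\<eta> ^ d\<close>
    cancels; the result does not depend on \<open>\<eta>\<close>.\<close>
  have step1: "(\<Sum>l\<le>D. c d l / \<eta> ^ d * measure_pmf.expectation P
         (\<lambda>y. \<Prod>b\<in>B. e y (\<tau> b) + \<zeta> b + \<eta> * real l * m b)) =
       (\<Sum>A\<in>Pow B. if card A = d then (\<Prod>b\<in>A. m b) * \<Xi> A else 0)" for d m
  proof -
    have "measure_pmf.expectation P (\<lambda>y. \<Prod>b\<in>B. e y (\<tau> b) + \<zeta> b + \<eta> * real l * m b) =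
        (\<Sum>A\<in>Pow B. (\<eta> * real l) ^ card A * (\<Prod>b\<in>A. m b) * \<Xi> A)" for l
    proof -
      have "measure_pmf.expectation P (\<lambda>y. \<Prod>b\<in>B. e y (\<tau> b) + \<zeta> b + \<eta> * real l * m b) =
          measure_pmf.expectation P (\<lambda>y. \<Prod>b\<in>B. \<eta> * real l * m b + (e y (\<tau> b) + \<zeta> b))"
        by (simp add: add.commute)
      also have "\<dots> = measure_pmf.expectation P (\<lambda>y. \<Sum>A\<in>Pow B.
          (\<eta> * real l) ^ card A * (\<Prod>b\<in>A. m b) * (\<Prod>b\<in>B - A. e y (\<tau> b) + \<zeta> b))"
        by (subst prod_add[OF B(1)]) (simp add: prod.distrib mult.assoc power_mult_distrib)
      also have "\<dots> = (\<Sum>A\<in>Pow B. (\<eta> * real l) ^ card A * (\<Prod>b\<in>A. m b) * \<Xi> A)"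
        unfolding expectation_sum_finite[OF P] \<Xi>_def by simp
      finally show ?thesis .
    qed
    then have "(\<Sum>l\<le>D. c d l / \<eta> ^ d * measure_pmf.expectation P
         (\<lambda>y. \<Prod>b\<in>B. e y (\<tau> b) + \<zeta> b + \<eta> * real l * m b)) =
      (\<Sum>l\<le>D. \<Sum>A\<in>Pow B. c d l * real l ^ card A * (\<eta> ^ card A / \<eta> ^ d * (\<Prod>b\<in>A. m b) * \<Xi> A))"
      by (simp add: sum_distrib_left power_mult_distrib mult_ac)
    also have "\<dots> = (\<Sum>A\<in>Pow B. (\<Sum>l\<le>D. c d l * real l ^ card A) * (\<eta> ^ card A / \<eta> ^ d * (\<Prod>b\<in>A. m b) * \<Xi> A))"
      by (subst sum.swap) (simp only: sum_distrib_right)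
    also have "\<dots> = (\<Sum>A\<in>Pow B. if card A = d then (\<Prod>b\<in>A. m b) * \<Xi> A else 0)"
      using \<open>\<eta> \<noteq> 0\<close> by (intro sum.cong refl) (auto simp: lag[OF cardA])
    finally show ?thesis .
  qed
  have step2: "measure_pmf.expectation (replicate_pmf (Suc i) P)
      (\<lambda>xs. h (last xs) * (\<Sum>A\<in>Pow B. if card A = d then (\<Prod>b\<in>A. vsum e xs (\<tau> b)) * \<Xi> A else 0)) =
      (\<Sum>A\<in>Pow B. if card A = d then M A i * \<Xi> A else 0)" for d i
  proof -
    have "measure_pmf.expectation (replicate_pmf (Suc i) P)
      (\<lambda>xs. h (last xs) * (\<Sum>A\<in>Pow B. if card A = d then (\<Prod>b\<in>A. vsum e xs (\<tau> b)) * \<Xi> A else 0)) =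
      measure_pmf.expectation (replicate_pmf (Suc i) P)
      (\<lambda>xs. (\<Sum>A\<in>Pow B. (if card A = d then \<Xi> A else 0) * (h (last xs) * (\<Prod>b\<in>A. vsum e xs (\<tau> b)))))"
      by (intro arg_cong[where f = "measure_pmf.expectation _"] ext)
         (auto simp: sum_distrib_left intro!: sum.cong)
    also have "\<dots> = (\<Sum>A\<in>Pow B. (if card A = d then \<Xi> A else 0) * M A i)"
      unfolding expectation_sum_finite[OF finite_set_replicate_pmf[OF P]] expectation_cmult
        M_def copies_moment_def by simp
    also have "\<dots> = (\<Sum>A\<in>Pow B. if card A = d then M A i * \<Xi> A else 0)"
      by (intro sum.cong) auto
    finally show ?thesis .
  qed
  have "(\<Sum>d\<le>D. \<Sum>i\<le>d. extrap_coeff d i * measure_pmf.expectation (replicate_pmf (Suc i) P)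
      (\<lambda>xs. h (last xs) * (\<Sum>l\<le>D. c d l / \<eta> ^ d * measure_pmf.expectation P
         (\<lambda>y. \<Prod>b\<in>B. e y (\<tau> b) + \<zeta> b + \<eta> * real l * vsum e xs (\<tau> b))))) =
    (\<Sum>d\<le>D. \<Sum>i\<le>d. extrap_coeff d i * (\<Sum>A\<in>Pow B. if card A = d then M A i * \<Xi> A else 0))"
    unfolding step1 step2 ..
  also have "\<dots> = (\<Sum>d\<le>D. \<Sum>i\<le>d. \<Sum>A\<in>Pow B. if card A = d then extrap_coeff d i * M A i * \<Xi> A else 0)"
    unfolding sum_distrib_left by (intro sum.cong refl) auto
  also have "\<dots> = (\<Sum>d\<le>D. \<Sum>A\<in>Pow B. \<Sum>i\<le>d. if card A = d then extrap_coeff d i * M A i * \<Xi> A else 0)"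
    by (intro sum.cong refl sum.swap)
  also have "\<dots> = (\<Sum>A\<in>Pow B. \<Sum>d\<le>D. \<Sum>i\<le>d. if card A = d then extrap_coeff d i * M A i * \<Xi> A else 0)"
    by (rule sum.swap)
  also have "\<dots> = (\<Sum>A\<in>Pow B. \<Sum>d\<le>D. if card A = d then (\<Sum>i\<le>d. extrap_coeff d i * M A i) * \<Xi> A else 0)"
    by (intro sum.cong refl) (auto simp: sum_distrib_right)
  also have "\<dots> = (\<Sum>A\<in>Pow B. (\<Sum>k\<le>card A. (- 1) ^ k * (fdiff ^^ k) (M A) 0) * \<Xi> A)"
    by (intro sum.cong refl) (simp add: sum.delta' cardA extrap_coeff_sum)
  \<comment> \<open>Differences of order above \<open>card A\<close> vanish. Summing up to
    \<open>D\<close> for every \<open>A\<close> makes the weights independent of \<open>A\<close>,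
    so that the sum over \<open>A\<close> can move inside the differences.\<close>
  also have "\<dots> = (\<Sum>A\<in>Pow B. (\<Sum>k\<le>D. (- 1) ^ k * (fdiff ^^ k) (M A) 0) * \<Xi> A)"
  proof (rule sum.cong[OF refl])
    fix A assume A: "A \<in> Pow B"
    have "(- 1) ^ k * (fdiff ^^ k) (M A) 0 = 0" if "k \<in> {..D} - {..card A}" for k
    proof -
      have "(fdiff ^^ k) (M A) = (\<lambda>_. 0)"
        unfolding M_def using A that B(1) by (intro fdiff_copies_moment P) (auto intro: finite_subset)
      then show ?thesis by simp
    qed
    then have "(\<Sum>k\<le>card A. (- 1) ^ k * (fdiff ^^ k) (M A) 0) = (\<Sum>k\<le>D. (- 1) ^ k * (fdiff ^^ k) (M A) 0)"
      using cardA[OF A] by (intro sum.mono_neutral_left) auto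
    then show "(\<Sum>k\<le>card A. (- 1) ^ k * (fdiff ^^ k) (M A) 0) * \<Xi> A =
      (\<Sum>k\<le>D. (- 1) ^ k * (fdiff ^^ k) (M A) 0) * \<Xi> A" by simp
  qed
  also have "\<dots> = (\<Sum>k\<le>D. (- 1) ^ k * (fdiff ^^ k) (\<lambda>i. \<Sum>A\<in>Pow B. M A i * \<Xi> A) 0)"
    unfolding fdiff_pow_linear sum_distrib_left sum_distrib_right
    by (subst sum.swap) (simp add: mult.assoc)
  \<comment> \<open>The factors in \<open>\<Xi> A\<close> stem from the signal copy inside the
    observation; together with the \<open>i + 1\<close> tilt copies there are \<open>i + 2\<close>,
    that is index \<open>Suc i\<close>.\<close>
  also have "(\<lambda>i. \<Sum>A\<in>Pow B. M A i * \<Xi> A) = (\<lambda>i. copies_moment P e h \<tau> \<zeta> B (Suc i))"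
    unfolding M_def \<Xi>_def
    using copies_moment_Suc[OF P B(1), of e h \<tau> "\<lambda>_. 0" \<zeta>] by simp
  also have "(\<Sum>k\<le>D. (- 1) ^ k * (fdiff ^^ k) (\<lambda>i. copies_moment P e h \<tau> \<zeta> B (Suc i)) 0) =
      copies_moment P e h \<tau> \<zeta> B 0"
    unfolding extrap_shift using B by (subst fdiff_copies_moment[OF P]) auto
  also have "\<dots> = measure_pmf.expectation P (\<lambda>x. h x * (\<Prod>b\<in>B. e x (\<tau> b) + \<zeta> b))"
    by (rule copies_moment_0[OF P])
  finally show ?thesis .
qed

lemma finite_exponents_upto: "finite J \<Longrightarrow> finite (exponents_upto J D)"
  unfolding exponents_upto_def by (rule finite_subset[of _ "J \<rightarrow>\<^sub>E {..D}"]) (auto intro: finite_PiE)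

text \<open>Repeated variables become distinct slots, so that the expansion over subsets of slots
  covers every monomial.\<close>

lemma prod_power_eq_prod_Sigma:
  fixes y :: "'i \<Rightarrow> real"
  assumes "finite J"
  shows "(\<Prod>j\<in>J. y j ^ \<alpha> j) = (\<Prod>b\<in>Sigma J (\<lambda>j. {..<\<alpha> j}). y (fst b))"
  using assms by (subst prod.Sigma[symmetric, where g = "\<lambda>j _. y j", simplified split_beta']) auto

text \<open>Both sides are linear in \<open>f\<close>, so it suffices to treat monomials, where
  \<open>dual_identity_prod\<close> applies with \<open>fst\<close> mapping slots to
  variables.\<close>

lemma dual_identity:
  fixes \<eta> :: real
  assumes P: "finite (set_pmf P)" and J: "finite J" and f: "f \<in> polys_upto J D" and \<eta>: "\<eta> \<noteq> 0"
    and lag: "\<And>d e. e \<le> D \<Longrightarrow> (\<Sum>l\<le>D. c d l * real l ^ e) = (if e = d then 1 else 0)"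
  shows "(\<Sum>d\<le>D. \<Sum>i\<le>d. extrap_coeff d i * measure_pmf.expectation (replicate_pmf (Suc i) P)
      (\<lambda>xs. h (last xs) * (\<Sum>l\<le>D. c d l / \<eta> ^ d * measure_pmf.expectation P
         (\<lambda>y. f (\<lambda>j. e y j + \<zeta> j + \<eta> * real l * vsum e xs j))))) =
    measure_pmf.expectation P (\<lambda>x. h x * f (\<lambda>j. e x j + \<zeta> j))"
proof -
  obtain C where f_def: "f = (\<lambda>y. \<Sum>\<alpha>\<in>exponents_upto J D. C \<alpha> * (\<Prod>j\<in>J. y j ^ \<alpha> j))"
    using f unfolding polys_upto_def by auto
  define T where "T g = (\<Sum>d\<le>D. \<Sum>i\<le>d. extrap_coeff d i * measure_pmf.expectation (replicate_pmf (Suc i) P)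
      (\<lambda>xs. h (last xs) * (\<Sum>l\<le>D. c d l / \<eta> ^ d * measure_pmf.expectation P
         (\<lambda>y. g (\<lambda>j. e y j + \<zeta> j + \<eta> * real l * vsum e xs j)))))" for g :: "('b \<Rightarrow> real) \<Rightarrow> real"
  have "T f = (\<Sum>\<alpha>\<in>exponents_upto J D. C \<alpha> * T (\<lambda>y. \<Prod>j\<in>J. y j ^ \<alpha> j))"
  proof -
    let ?A = "exponents_upto J D"
    let ?G = "\<lambda>\<alpha> y. \<Prod>j\<in>J. y j ^ \<alpha> j :: real"
    have 1: "measure_pmf.expectation P (\<lambda>y. f (\<lambda>j. e y j + \<zeta> j + \<eta> * real l * m j)) =
       (\<Sum>\<alpha>\<in>?A. C \<alpha> * measure_pmf.expectation P (\<lambda>y. ?G \<alpha> (\<lambda>j. e y j + \<zeta> j + \<eta> * real l * m j)))" for l m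
      unfolding f_def expectation_sum_finite[OF P] by simp
    have 2: "h a * (\<Sum>l\<le>D. c d l / \<eta> ^ d * (\<Sum>\<alpha>\<in>?A. C \<alpha> * F \<alpha> l)) =
       (\<Sum>\<alpha>\<in>?A. C \<alpha> * (h a * (\<Sum>l\<le>D. c d l / \<eta> ^ d * F \<alpha> l)))" for a d F
      unfolding sum_distrib_left by (subst sum.swap) (simp add: mult_ac)
    have 3: "(\<Sum>d\<le>D. \<Sum>i\<le>d. extrap_coeff d i * (\<Sum>\<alpha>\<in>?A. C \<alpha> * F \<alpha> d i)) =
       (\<Sum>\<alpha>\<in>?A. C \<alpha> * (\<Sum>d\<le>D. \<Sum>i\<le>d. extrap_coeff d i * F \<alpha> d i))" for F
    proof -
      have "(\<Sum>d\<le>D. \<Sum>i\<le>d. extrap_coeff d i * (\<Sum>\<alpha>\<in>?A. C \<alpha> * F \<alpha> d i)) =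
          (\<Sum>d\<le>D. \<Sum>i\<le>d. \<Sum>\<alpha>\<in>?A. C \<alpha> * (extrap_coeff d i * F \<alpha> d i))"
        by (simp add: sum_distrib_left mult_ac)
      also have "\<dots> = (\<Sum>d\<le>D. \<Sum>\<alpha>\<in>?A. \<Sum>i\<le>d. C \<alpha> * (extrap_coeff d i * F \<alpha> d i))"
        by (intro sum.cong refl sum.swap)
      also have "\<dots> = (\<Sum>\<alpha>\<in>?A. \<Sum>d\<le>D. \<Sum>i\<le>d. C \<alpha> * (extrap_coeff d i * F \<alpha> d i))"
        by (rule sum.swap)
      finally show ?thesis by (simp add: sum_distrib_left)
    qed
    show ?thesis
      unfolding T_def 1 2 expectation_sum_finite[OF finite_set_replicate_pmf[OF P]] expectation_cmult 3 ..
  qed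
  also have "\<dots> = (\<Sum>\<alpha>\<in>exponents_upto J D. C \<alpha> *
      measure_pmf.expectation P (\<lambda>x. h x * (\<Prod>j\<in>J. (e x j + \<zeta> j) ^ \<alpha> j)))"
  proof (intro sum.cong refl arg_cong2[where f = "(*)"])
    fix \<alpha> assume \<alpha>: "\<alpha> \<in> exponents_upto J D"
    have "finite (Sigma J (\<lambda>j. {..<\<alpha> j}))" "card (Sigma J (\<lambda>j. {..<\<alpha> j})) \<le> D"
      using J \<alpha> by (auto simp: exponents_upto_def)
    from dual_identity_prod[OF P this \<eta> lag, of h e fst "\<lambda>b. \<zeta> (fst b)"]
    show "T (\<lambda>y. \<Prod>j\<in>J. y j ^ \<alpha> j) =
      measure_pmf.expectation P (\<lambda>x. h x * (\<Prod>j\<in>J. (e x j + \<zeta> j) ^ \<alpha> j))"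
      unfolding T_def prod_power_eq_prod_Sigma[OF J] by simp
  qed
  also have "\<dots> = measure_pmf.expectation P (\<lambda>x. \<Sum>\<alpha>\<in>exponents_upto J D.
      C \<alpha> * (h x * (\<Prod>j\<in>J. (e x j + \<zeta> j) ^ \<alpha> j)))"
    unfolding expectation_sum_finite[OF P] by simp
  also have "\<dots> = measure_pmf.expectation P (\<lambda>x. h x * f (\<lambda>j. e x j + \<zeta> j))"
    unfolding f_def by (simp add: sum_distrib_left mult_ac)
  finally show ?thesis unfolding T_def .
qed

section \<open>Gaussian tilts\<close>

lemma integral_std_normal:
  fixes g :: "real \<Rightarrow> real"
  assumes [measurable]: "g \<in> borel_measurable borel"
  shows "has_bochner_integral std_normal_distribution g c \<longleftrightarrow>
    has_bochner_integral lborel (\<lambda>x. std_normal_density x * g x) c"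
proof -
  have "integrable std_normal_distribution g \<longleftrightarrow> integrable lborel (\<lambda>x. std_normal_density x * g x)"
    by (subst integrable_density) auto
  moreover have "integral\<^sup>L std_normal_distribution g = integral\<^sup>L lborel (\<lambda>x. std_normal_density x * g x)"
    by (subst integral_density) auto
  ultimately show ?thesis by (auto simp: has_bochner_integral_iff)
qed

lemma std_normal_prob_space: "prob_space std_normal_distribution"
  by (rule prob_space_normal_density) simp

text \<open>Cameron-Martin formula in dimension one: completing the square turns density times
  exponential into the density translated by \<open>m\<close>, and Lebesgue measure is translation
  invariant.\<close>

lemma std_normal_shift:
  fixes g :: "real \<Rightarrow> real"
  assumes [measurable]: "g \<in> borel_measurable borel"
    and g: "has_bochner_integral std_normal_distribution (\<lambda>z. g (m + z)) c"
  shows "has_bochner_integral std_normal_distribution (\<lambda>z. g z * exp (m * z - m\<^sup>2 / 2)) c"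
proof -
  have eq: "std_normal_density x * (g x * exp (m * x - m\<^sup>2 / 2)) =
      std_normal_density (x - m) * g (m + (x - m))" for x
  proof -
    have "- x\<^sup>2 / 2 + (m * x - m\<^sup>2 / 2) = - (x - m)\<^sup>2 / 2"
      by (simp add: power2_eq_square field_simps)
    then have "exp (- x\<^sup>2 / 2) * exp (m * x - m\<^sup>2 / 2) = exp (- (x - m)\<^sup>2 / 2)"
      by (simp only: exp_add[symmetric])
    then show ?thesis by (simp add: std_normal_density_def mult_ac)
  qed
  have "has_bochner_integral lborel (\<lambda>z. std_normal_density z * g (m + z)) c"
    using g by (subst (asm) integral_std_normal) auto
  then have "has_bochner_integral lborel (\<lambda>x. std_normal_density (x - m) * g (m + (x - m))) c"
    using lborel_has_bochner_integral_real_affine_iff[of 1 "\<lambda>x. std_normal_density (x - m) * g (m + (x - m))" c m]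
    by simp
  then show ?thesis
    by (subst integral_std_normal) (auto simp: eq)
qed

lemma integrable_std_normal_power: "integrable std_normal_distribution (\<lambda>z. (y + z) ^ a)"
proof -
  have "integrable std_normal_distribution (\<lambda>z. z ^ k)" for k
    using integrable_std_normal_moment[of k] by (subst integrable_density) auto
  then show ?thesis
    unfolding add.commute[of y] binomial_ring by (intro Bochner_Integration.integrable_sum) auto
qed

lemma std_normal_exp:
  "has_bochner_integral std_normal_distribution (\<lambda>z. exp (m * z - m\<^sup>2 / 2)) 1"
proof -
  interpret prob_space std_normal_distribution by (rule std_normal_prob_space)
  have "has_bochner_integral std_normal_distribution (\<lambda>z. 1::real) 1"
    by (simp add: has_bochner_integral_iff prob_space del: space_density)
  from std_normal_shift[of "\<lambda>_. 1", OF _ this] show ?thesis by simp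
qed

text \<open>\<open>std_normal_shift\<close> with one exponential as test function; the shifted
  exponential is \<open>exp (m' * m)\<close> times a factor of expectation 1.\<close>

lemma std_normal_exp_exp:
  "has_bochner_integral std_normal_distribution
     (\<lambda>z. exp (m' * z - m'\<^sup>2 / 2) * exp (m * z - m\<^sup>2 / 2)) (exp (m' * m))"
proof (rule std_normal_shift)
  have "has_bochner_integral std_normal_distribution (\<lambda>z. exp (m' * m) * exp (m' * z - m'\<^sup>2 / 2)) (exp (m' * m) * 1)"
    by (rule has_bochner_integral_mult_right[OF std_normal_exp])
  then show "has_bochner_integral std_normal_distribution (\<lambda>z. exp (m' * (m + z) - m'\<^sup>2 / 2)) (exp (m' * m))"
    by (simp add: exp_add[symmetric] algebra_simps)
qed measurable

abbreviation gauss :: "'i set \<Rightarrow> ('i \<Rightarrow> real) measure" where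
  "gauss J \<equiv> \<Pi>\<^sub>M j\<in>J. std_normal_distribution"

lemma prob_space_gauss: "prob_space (gauss J)"
  by (intro prob_space_PiM std_normal_prob_space)

lemma gauss_prod:
  fixes g :: "'i \<Rightarrow> real \<Rightarrow> real"
  assumes "finite J" and "\<And>j. j \<in> J \<Longrightarrow> has_bochner_integral std_normal_distribution (g j) (c j)"
  shows "has_bochner_integral (gauss J) (\<lambda>z. \<Prod>j\<in>J. g j (z j)) (\<Prod>j\<in>J. c j)"
proof -
  interpret prob_space std_normal_distribution by (rule std_normal_prob_space)
  interpret product_sigma_finite "\<lambda>_::'i. std_normal_distribution"
    by (simp add: product_sigma_finite_def sigma_finite_measure_axioms)
  have "integrable (gauss J) (\<lambda>z. \<Prod>j\<in>J. g j (z j))"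
    using assms by (intro product_integrable_prod) (auto simp: has_bochner_integral_iff)
  moreover have "integral\<^sup>L (gauss J) (\<lambda>z. \<Prod>j\<in>J. g j (z j)) = (\<Prod>j\<in>J. c j)"
    using assms by (subst product_integral_prod) (auto simp: has_bochner_integral_iff)
  ultimately show ?thesis by (simp add: has_bochner_integral_iff)
qed

text \<open>The density of \<open>N(m, I)\<close> with respect to \<open>N(0, I)\<close>.\<close>

definition tilt :: "'i set \<Rightarrow> ('i \<Rightarrow> real) \<Rightarrow> ('i \<Rightarrow> real) \<Rightarrow> real" where
  "tilt J m z = (\<Prod>j\<in>J. exp (m j * z j - (m j)\<^sup>2 / 2))"

text \<open>Hence the second moment of a combination of tilts sees the directions only through their
  inner products, which later become overlaps.\<close>

lemma gauss_tilt_tilt: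
  assumes "finite J"
  shows "has_bochner_integral (gauss J) (\<lambda>z. tilt J m' z * tilt J m z) (exp (\<Sum>j\<in>J. m' j * m j))"
  unfolding tilt_def exp_sum[OF assms] prod.distrib[symmetric]
  by (intro gauss_prod assms std_normal_exp_exp)

lemma gauss_monomial:
  assumes "finite J"
  shows "has_bochner_integral (gauss J) (\<lambda>z. \<Prod>j\<in>J. (y j + z j) ^ \<alpha> j)
    (\<Prod>j\<in>J. integral\<^sup>L std_normal_distribution (\<lambda>z. (y j + z) ^ \<alpha> j))"
  by (intro gauss_prod assms has_bochner_integral_integrable integrable_std_normal_power)

lemma gauss_monomial_tilt:
  assumes "finite J"
  shows "has_bochner_integral (gauss J) (\<lambda>z. (\<Prod>j\<in>J. (y j + z j) ^ \<alpha> j) * tilt J m z)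
    (integral\<^sup>L (gauss J) (\<lambda>z. \<Prod>j\<in>J. (y j + m j + z j) ^ \<alpha> j))"
proof -
  have "has_bochner_integral (gauss J) (\<lambda>z. \<Prod>j\<in>J. (y j + z j) ^ \<alpha> j * exp (m j * z j - (m j)\<^sup>2 / 2))
     (\<Prod>j\<in>J. integral\<^sup>L std_normal_distribution (\<lambda>z. (y j + m j + z) ^ \<alpha> j))"
    by (intro gauss_prod assms std_normal_shift[where g = "\<lambda>z. (_ + z) ^ _"])
       (auto simp: add.assoc[symmetric] intro!: has_bochner_integral_integrable integrable_std_normal_power)
  then show ?thesis
    using gauss_monomial[OF assms, of "\<lambda>j. y j + m j" \<alpha>]
    by (simp add: tilt_def prod.distrib has_bochner_integral_iff)
qed

lemma polys_upto_cases:
  assumes "f \<in> polys_upto J D"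
  obtains C where "f = (\<lambda>y. \<Sum>\<alpha>\<in>exponents_upto J D. C \<alpha> * (\<Prod>j\<in>J. y j ^ \<alpha> j))"
  using assms unfolding polys_upto_def by auto

text \<open>Weighting the noise by a tilt amounts to adding \<open>m\<close> to the
  observation.\<close>

lemma gauss_poly_tilt:
  assumes J: "finite J" and f: "f \<in> polys_upto J D"
  shows "has_bochner_integral (gauss J) (\<lambda>z. f (\<lambda>j. y j + z j) * tilt J m z)
    (integral\<^sup>L (gauss J) (\<lambda>z. f (\<lambda>j. y j + m j + z j)))"
proof -
  obtain C where f_def: "f = (\<lambda>y. \<Sum>\<alpha>\<in>exponents_upto J D. C \<alpha> * (\<Prod>j\<in>J. y j ^ \<alpha> j))"
    by (rule polys_upto_cases[OF f])
  have "has_bochner_integral (gauss J)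
      (\<lambda>z. \<Sum>\<alpha>\<in>exponents_upto J D. C \<alpha> * ((\<Prod>j\<in>J. (y j + z j) ^ \<alpha> j) * tilt J m z))
      (\<Sum>\<alpha>\<in>exponents_upto J D. C \<alpha> * integral\<^sup>L (gauss J) (\<lambda>z. \<Prod>j\<in>J. (y j + m j + z j) ^ \<alpha> j))"
    by (intro has_bochner_integral_sum has_bochner_integral_mult_right gauss_monomial_tilt J)
  moreover have "(\<Sum>\<alpha>\<in>exponents_upto J D. C \<alpha> * integral\<^sup>L (gauss J) (\<lambda>z. \<Prod>j\<in>J. (y j + m j + z j) ^ \<alpha> j))
      = integral\<^sup>L (gauss J) (\<lambda>z. f (\<lambda>j. y j + m j + z j))"
    unfolding f_def using gauss_monomial[OF J, of "\<lambda>j. y j + m j"]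
    by (subst Bochner_Integration.integral_sum) (auto simp: has_bochner_integral_iff)
  ultimately show ?thesis by (simp add: f_def sum_distrib_right mult.assoc)
qed

lemma integrable_gauss_poly:
  assumes J: "finite J" and f: "f \<in> polys_upto J D"
  shows "integrable (gauss J) (\<lambda>z. f (\<lambda>j. y j + z j))"
proof -
  obtain C where f_def: "f = (\<lambda>y. \<Sum>\<alpha>\<in>exponents_upto J D. C \<alpha> * (\<Prod>j\<in>J. y j ^ \<alpha> j))"
    by (rule polys_upto_cases[OF f])
  show ?thesis unfolding f_def using gauss_monomial[OF J, of y]
    by (auto simp: has_bochner_integral_iff)
qed

lemma integrable_gauss_poly_square:
  assumes J: "finite J" and f: "f \<in> polys_upto J D"
  shows "integrable (gauss J) (\<lambda>z. (f (\<lambda>j. y j + z j))\<^sup>2)"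
proof -
  obtain C where f_def: "f = (\<lambda>y. \<Sum>\<alpha>\<in>exponents_upto J D. C \<alpha> * (\<Prod>j\<in>J. y j ^ \<alpha> j))"
    by (rule polys_upto_cases[OF f])
  have "(f (\<lambda>j. y j + z j))\<^sup>2 = (\<Sum>\<alpha>\<in>exponents_upto J D. \<Sum>\<alpha>'\<in>exponents_upto J D.
      C \<alpha> * C \<alpha>' * (\<Prod>j\<in>J. (y j + z j) ^ (\<alpha> j + \<alpha>' j)))" for z
    unfolding f_def power2_eq_square sum_product by (simp add: power_add prod.distrib mult_ac)
  then show ?thesis using gauss_monomial[OF J, of y "\<lambda>j. _ j + _ j"]
    by (auto simp: has_bochner_integral_iff)
qed

section \<open>The second-moment lower bound and its limit for infinitesimal tilts\<close>

text \<open>With \<open>W\<close> the combination of tilts with weights \<open>w\<close>,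
  integrating \<open>dual\<close> over the noise says that \<open>f\<close> has the same correlation
  with \<open>W\<close> as with \<open>h\<close>. Integrating (f - W)^2 \<ge> 0 bounds E f^2 from
  below by 2 E f W - E W^2; in E (f - h)^2 the two cross terms then cancel.\<close>

lemma mse_lower_bound_dual:
  fixes w :: "'r \<Rightarrow> real" and h :: "'x \<Rightarrow> real"
  assumes P: "finite (set_pmf P)" and J: "finite J" and f: "f \<in> polys_upto J D" and R: "finite R"
    and dual: "\<And>\<zeta>. (\<Sum>r\<in>R. w r * measure_pmf.expectation P (\<lambda>x. f (\<lambda>j. e x j + m r j + \<zeta> j))) =
      measure_pmf.expectation P (\<lambda>x. h x * f (\<lambda>j. e x j + \<zeta> j))"
  shows "measure_pmf.expectation P (\<lambda>x. (h x)\<^sup>2) -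
      (\<Sum>r\<in>R. \<Sum>r'\<in>R. w r * w r' * exp (\<Sum>j\<in>J. m r j * m r' j)) \<le>
    measure_pmf.expectation P (\<lambda>x. \<integral>z. (f (\<lambda>j. e x j + z j) - h x)\<^sup>2 \<partial>gauss J)"
proof -
  interpret prob_space "gauss J" by (rule prob_space_gauss)
  define W where "W z = (\<Sum>r\<in>R. w r * tilt J (m r) z)" for z
  define V where "V = (\<Sum>r\<in>R. \<Sum>r'\<in>R. w r * w r' * exp (\<Sum>j\<in>J. m r j * m r' j))"
  define F where "F x = (\<integral>z. f (\<lambda>j. e x j + z j) \<partial>gauss J)" for x
  define FW where "FW x = (\<Sum>r\<in>R. w r * (\<integral>z. f (\<lambda>j. e x j + m r j + z j) \<partial>gauss J))" for x
  note int_f = integrable_gauss_poly[OF J f] and int_f2 = integrable_gauss_poly_square[OF J f]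
  have W2: "has_bochner_integral (gauss J) (\<lambda>z. (W z)\<^sup>2) V"
  proof -
    have "has_bochner_integral (gauss J)
        (\<lambda>z. \<Sum>r\<in>R. \<Sum>r'\<in>R. w r * w r' * (tilt J (m r) z * tilt J (m r') z)) V"
      unfolding V_def by (intro has_bochner_integral_sum has_bochner_integral_mult_right gauss_tilt_tilt J)
    then show ?thesis unfolding W_def power2_eq_square sum_product by (simp add: mult_ac)
  qed
  have fW: "has_bochner_integral (gauss J) (\<lambda>z. f (\<lambda>j. e x j + z j) * W z) (FW x)" for x
  proof -
    have "has_bochner_integral (gauss J)
        (\<lambda>z. \<Sum>r\<in>R. w r * (f (\<lambda>j. e x j + z j) * tilt J (m r) z)) (FW x)"
      unfolding FW_def
      by (intro has_bochner_integral_sum has_bochner_integral_mult_right gauss_poly_tilt[OF J f])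
    then show ?thesis unfolding W_def by (simp add: sum_distrib_left mult_ac)
  qed
  have pointwise: "2 * FW x - V - 2 * h x * F x + (h x)\<^sup>2 \<le> (\<integral>z. (f (\<lambda>j. e x j + z j) - h x)\<^sup>2 \<partial>gauss J)" for x
  proof -
    let ?f = "\<lambda>z. f (\<lambda>j. e x j + z j)"
    have int: "integrable (gauss J) ?f" "integrable (gauss J) (\<lambda>z. (?f z)\<^sup>2)"
       "integrable (gauss J) (\<lambda>z. ?f z * W z)" "integrable (gauss J) (\<lambda>z. (W z)\<^sup>2)"
      using int_f int_f2 fW W2 by (auto simp: has_bochner_integral_iff)
    have "2 * FW x - V - 2 * h x * F x + (h x)\<^sup>2 =
        (\<integral>z. 2 * (?f z * W z) - (W z)\<^sup>2 - 2 * h x * ?f z + (h x)\<^sup>2 \<partial>gauss J)"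
      using int fW[of x] W2 by (simp add: has_bochner_integral_iff F_def prob_space)
    also have "\<dots> \<le> (\<integral>z. (?f z)\<^sup>2 - 2 * h x * ?f z + (h x)\<^sup>2 \<partial>gauss J)"
    proof (intro integral_mono)
      fix z
      have "0 \<le> (?f z - W z)\<^sup>2" by simp
      then show "2 * (?f z * W z) - (W z)\<^sup>2 - 2 * h x * ?f z + (h x)\<^sup>2 \<le> (?f z)\<^sup>2 - 2 * h x * ?f z + (h x)\<^sup>2"
        by (simp add: power2_diff)
    qed (use int in auto)
    also have "(\<lambda>z. (?f z)\<^sup>2 - 2 * h x * ?f z + (h x)\<^sup>2) = (\<lambda>z. (?f z - h x)\<^sup>2)"
      by (auto simp: power2_diff fun_eq_iff algebra_simps)
    finally show ?thesis .
  qed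
  have "measure_pmf.expectation P FW =
      (\<integral>z. (\<Sum>r\<in>R. w r * measure_pmf.expectation P (\<lambda>x. f (\<lambda>j. e x j + m r j + z j))) \<partial>gauss J)"
  proof -
    have "measure_pmf.expectation P FW = (\<Sum>x\<in>set_pmf P. \<Sum>r\<in>R. pmf P x * (w r * (\<integral>z. f (\<lambda>j. e x j + m r j + z j) \<partial>gauss J)))"
      unfolding expectation_finite_support[OF P] FW_def by (simp add: sum_distrib_left)
    also have "\<dots> = (\<integral>z. (\<Sum>x\<in>set_pmf P. \<Sum>r\<in>R. pmf P x * (w r * f (\<lambda>j. e x j + m r j + z j))) \<partial>gauss J)"
      using int_f[of "\<lambda>j. e _ j + m _ j"] by simp
    also have "\<dots> = (\<integral>z. (\<Sum>r\<in>R. w r * measure_pmf.expectation P (\<lambda>x. f (\<lambda>j. e x j + m r j + z j))) \<partial>gauss J)"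
      unfolding expectation_finite_support[OF P] sum_distrib_left
      by (subst sum.swap) (simp add: mult_ac)
    finally show ?thesis .
  qed
  also have "\<dots> = measure_pmf.expectation P (\<lambda>x. h x * F x)"
    unfolding dual F_def unfolding expectation_finite_support[OF P] using int_f[of "e _"] by simp
  finally have FW: "measure_pmf.expectation P FW = measure_pmf.expectation P (\<lambda>x. h x * F x)" .
  have "measure_pmf.expectation P (\<lambda>x. (h x)\<^sup>2) - V =
      measure_pmf.expectation P (\<lambda>x. 2 * FW x - V - 2 * (h x * F x) + (h x)\<^sup>2)"
    by (simp add: FW integrable_measure_pmf_finite[OF P])
  also have "\<dots> \<le> measure_pmf.expectation P (\<lambda>x. \<integral>z. (f (\<lambda>j. e x j + z j) - h x)\<^sup>2 \<partial>gauss J)"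
    using pointwise by (intro expectation_mono_finite P) (auto simp: mult.assoc)
  finally show ?thesis unfolding V_def .
qed

text \<open>Lagrange form of the Taylor remainder, with the factorial dropped.\<close>

lemma exp_truncation_error:
  fixes t :: real
  shows "\<bar>exp t - (\<Sum>e\<le>D. t ^ e / fact e)\<bar> \<le> exp \<bar>t\<bar> * \<bar>t\<bar> ^ Suc D"
proof -
  obtain s where s: "\<bar>s\<bar> \<le> \<bar>t\<bar>" "exp t = (\<Sum>e<Suc D. t ^ e / fact e) + exp s / fact (Suc D) * t ^ Suc D"
    using Maclaurin_exp_le[of t "Suc D"] by blast
  have "\<bar>exp t - (\<Sum>e\<le>D. t ^ e / fact e)\<bar> = exp s / fact (Suc D) * \<bar>t\<bar> ^ Suc D"
    using s(2) by (simp add: lessThan_Suc_atMost abs_mult power_abs)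
  also have "\<dots> \<le> exp \<bar>t\<bar> / 1 * \<bar>t\<bar> ^ Suc D"
    using s(1) by (intro mult_right_mono frac_le) (auto simp: fact_ge_1 simp del: fact_Suc)
  finally show ?thesis by simp
qed

text \<open>In the exponential series the term of order \<open>e\<close> contains
  \<open>real l ^ e\<close> and \<open>real l' ^ e\<close>, so the weights keep only
  \<open>e = d = d'\<close>, where the powers of \<open>\<eta>\<close> cancel exactly. The remainder
  after order \<open>D\<close> still vanishes when divided by
  \<open>\<eta> ^ d * \<eta> ^ d'\<close>.\<close>

lemma tilt_pairing_limit:
  fixes \<theta> :: real
  assumes lag: "\<And>d e. e \<le> D \<Longrightarrow> (\<Sum>l\<le>D. c d l * real l ^ e) = (if e = d then 1 else 0)"
    and d: "d \<le> D" "d' \<le> D"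
  shows "((\<lambda>\<eta>. \<Sum>l\<le>D. \<Sum>l'\<le>D. c d l / \<eta> ^ d * (c d' l' / \<eta> ^ d') *
      exp (\<eta> * real l * (\<eta> * real l') * \<theta>)) \<longlongrightarrow> (if d = d' then \<theta> ^ d / fact d else 0)) (at_right 0)"
proof -
  define a where "a l l' = real l * real l' * \<theta>" for l l'
  define rem where "rem \<eta> l l' = exp (\<eta>\<^sup>2 * a l l') - (\<Sum>e\<le>D. (\<eta>\<^sup>2 * a l l') ^ e / fact e)" for \<eta> l l'
  define K where "K = (\<Sum>l\<le>D. \<Sum>l'\<le>D. \<bar>c d l\<bar> * \<bar>c d' l'\<bar> * (exp \<bar>a l l'\<bar> * \<bar>a l l'\<bar> ^ Suc D))"
  have main: "(\<Sum>l\<le>D. \<Sum>l'\<le>D. c d l / \<eta> ^ d * (c d' l' / \<eta> ^ d') *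
      exp (\<eta> * real l * (\<eta> * real l') * \<theta>)) - (if d = d' then \<theta> ^ d / fact d else 0) =
      (\<Sum>l\<le>D. \<Sum>l'\<le>D. c d l / \<eta> ^ d * (c d' l' / \<eta> ^ d') * rem \<eta> l l')" if "\<eta> > 0" for \<eta>
  proof -
    have "(\<Sum>l\<le>D. \<Sum>l'\<le>D. c d l / \<eta> ^ d * (c d' l' / \<eta> ^ d') * (\<Sum>e\<le>D. (\<eta>\<^sup>2 * a l l') ^ e / fact e)) =
        (\<Sum>l\<le>D. \<Sum>l'\<le>D. \<Sum>e\<le>D. (\<eta>\<^sup>2) ^ e * \<theta> ^ e / fact e / \<eta> ^ d / \<eta> ^ d' *
          (c d l * real l ^ e) * (c d' l' * real l' ^ e))"
      unfolding sum_distrib_left a_def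
      by (intro sum.cong refl) (simp add: power_mult_distrib mult_ac)
    also have "\<dots> = (\<Sum>l\<le>D. \<Sum>e\<le>D. \<Sum>l'\<le>D. (\<eta>\<^sup>2) ^ e * \<theta> ^ e / fact e / \<eta> ^ d / \<eta> ^ d' *
          (c d l * real l ^ e) * (c d' l' * real l' ^ e))"
      by (intro sum.cong refl sum.swap)
    also have "\<dots> = (\<Sum>e\<le>D. \<Sum>l\<le>D. \<Sum>l'\<le>D. (\<eta>\<^sup>2) ^ e * \<theta> ^ e / fact e / \<eta> ^ d / \<eta> ^ d' *
          (c d l * real l ^ e) * (c d' l' * real l' ^ e))"
      by (rule sum.swap)
    also have "\<dots> = (\<Sum>e\<le>D. (\<eta>\<^sup>2) ^ e * \<theta> ^ e / fact e / \<eta> ^ d / \<eta> ^ d' *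
          (\<Sum>l\<le>D. c d l * real l ^ e) * (\<Sum>l'\<le>D. c d' l' * real l' ^ e))"
      unfolding mult.assoc sum_product by (simp only: sum_distrib_left mult.assoc)
    also have "\<dots> = (\<Sum>e\<le>D. if e = d then (if d = d' then \<theta> ^ d / fact d else 0) else 0)"
      using that by (intro sum.cong refl) (auto simp: lag power2_eq_square power_mult_distrib)
    also have "\<dots> = (if d = d' then \<theta> ^ d / fact d else 0)"
      using d by (subst sum.delta) auto
    finally have poly: "(\<Sum>l\<le>D. \<Sum>l'\<le>D. c d l / \<eta> ^ d * (c d' l' / \<eta> ^ d') *
      (\<Sum>e\<le>D. (\<eta>\<^sup>2 * a l l') ^ e / fact e)) = (if d = d' then \<theta> ^ d / fact d else 0)" .
    have "exp (\<eta> * real l * (\<eta> * real l') * \<theta>) = (\<Sum>e\<le>D. (\<eta>\<^sup>2 * a l l') ^ e / fact e) + rem \<eta> l l'" for l l'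
      unfolding rem_def a_def by (simp add: power2_eq_square mult_ac)
    then show ?thesis unfolding poly[symmetric]
      by (simp only: distrib_left sum.distrib add_diff_cancel_left')
  qed
  have bound: "\<bar>(\<Sum>l\<le>D. \<Sum>l'\<le>D. c d l / \<eta> ^ d * (c d' l' / \<eta> ^ d') * rem \<eta> l l')\<bar> \<le> \<eta> * K"
    if \<eta>: "0 < \<eta>" "\<eta> < 1" for \<eta>
  proof -
    have "\<bar>c d l / \<eta> ^ d * (c d' l' / \<eta> ^ d') * rem \<eta> l l'\<bar> \<le>
        \<eta> * (\<bar>c d l\<bar> * \<bar>c d' l'\<bar> * (exp \<bar>a l l'\<bar> * \<bar>a l l'\<bar> ^ Suc D))" for l l'
    proof -
      have \<eta>2: "\<eta>\<^sup>2 \<le> 1" using \<eta> by (simp add: power_le_one)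
      have "\<bar>rem \<eta> l l'\<bar> \<le> exp \<bar>\<eta>\<^sup>2 * a l l'\<bar> * \<bar>\<eta>\<^sup>2 * a l l'\<bar> ^ Suc D"
        unfolding rem_def by (rule exp_truncation_error)
      also have "\<dots> = exp (\<eta>\<^sup>2 * \<bar>a l l'\<bar>) * ((\<eta>\<^sup>2) ^ Suc D * \<bar>a l l'\<bar> ^ Suc D)"
        by (simp only: abs_mult power_mult_distrib) simp
      also have "\<dots> \<le> exp (1 * \<bar>a l l'\<bar>) * ((\<eta> ^ d * \<eta> ^ d' * \<eta>) * \<bar>a l l'\<bar> ^ Suc D)"
      proof (intro mult_mono)
        show "exp (\<eta>\<^sup>2 * \<bar>a l l'\<bar>) \<le> exp (1 * \<bar>a l l'\<bar>)"
          using mult_right_mono[OF \<eta>2, of "\<bar>a l l'\<bar>"] by simp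
        have "(\<eta>\<^sup>2) ^ Suc D = \<eta> ^ (2 * Suc D)" by (rule power_mult[symmetric])
        \<comment> \<open>Since \<open>d\<close> and \<open>d'\<close> are at most \<open>D\<close>
          and \<open>\<eta> < 1\<close>, one factor \<open>\<eta>\<close> is left after the
          normalisation.\<close>
        also have "\<dots> \<le> \<eta> ^ (d + d' + 1)" using \<eta> d by (intro power_decreasing) auto
        finally show "(\<eta>\<^sup>2) ^ Suc D \<le> \<eta> ^ d * \<eta> ^ d' * \<eta>" by (simp add: power_add mult_ac)
      qed (use \<eta> in auto)
      finally have rem: "\<bar>rem \<eta> l l'\<bar> \<le> exp \<bar>a l l'\<bar> * ((\<eta> ^ d * \<eta> ^ d' * \<eta>) * \<bar>a l l'\<bar> ^ Suc D)" by simp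
      have "\<bar>c d l / \<eta> ^ d * (c d' l' / \<eta> ^ d') * rem \<eta> l l'\<bar> =
          \<bar>c d l\<bar> / \<eta> ^ d * (\<bar>c d' l'\<bar> / \<eta> ^ d') * \<bar>rem \<eta> l l'\<bar>"
        using \<eta> by (simp add: abs_mult)
      also have "\<dots> \<le> \<bar>c d l\<bar> / \<eta> ^ d * (\<bar>c d' l'\<bar> / \<eta> ^ d') *
          (exp \<bar>a l l'\<bar> * ((\<eta> ^ d * \<eta> ^ d' * \<eta>) * \<bar>a l l'\<bar> ^ Suc D))"
        using rem \<eta> by (intro mult_left_mono) auto
      also have "\<dots> = \<eta> * (\<bar>c d l\<bar> * \<bar>c d' l'\<bar> * (exp \<bar>a l l'\<bar> * \<bar>a l l'\<bar> ^ Suc D))"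
        using \<eta> by (simp add: field_simps)
      finally show ?thesis .
    qed
    then show ?thesis unfolding K_def sum_distrib_left
      by (intro order.trans[OF sum_abs] sum_mono) 
  qed
  have "((\<lambda>\<eta>. (\<Sum>l\<le>D. \<Sum>l'\<le>D. c d l / \<eta> ^ d * (c d' l' / \<eta> ^ d') *
      exp (\<eta> * real l * (\<eta> * real l') * \<theta>)) - (if d = d' then \<theta> ^ d / fact d else 0)) \<longlongrightarrow> 0) (at_right 0)"
  proof (rule Lim_null_comparison)
    show "((\<lambda>\<eta>. \<eta> * K) \<longlongrightarrow> 0) (at_right (0::real))"
      by (rule tendsto_eq_intros refl)+ simp
    have "\<forall>\<^sub>F \<eta> in at_right (0::real). 0 < \<eta> \<and> \<eta> < 1"
      by (simp add: eventually_at_right_field) (rule exI[of _ 1], simp)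
    then show "\<forall>\<^sub>F \<eta> in at_right 0. norm ((\<Sum>l\<le>D. \<Sum>l'\<le>D. c d l / \<eta> ^ d * (c d' l' / \<eta> ^ d') *
      exp (\<eta> * real l * (\<eta> * real l') * \<theta>)) - (if d = d' then \<theta> ^ d / fact d else 0)) \<le> \<eta> * K"
      by eventually_elim (simp only: main real_norm_def bound)
  qed
  then show ?thesis by (simp add: LIM_zero_iff)
qed

text \<open>The limit, for infinitesimal tilts, of the second moment of the dual variable.\<close>

definition dual_energy :: "'x pmf \<Rightarrow> ('x \<Rightarrow> 'i \<Rightarrow> real) \<Rightarrow> ('x \<Rightarrow> real) \<Rightarrow> 'i set \<Rightarrow> nat \<Rightarrow> real" where
  "dual_energy P e h J D = (\<Sum>d\<le>D. \<Sum>i\<le>d. \<Sum>i'\<le>d. extrap_coeff d i * extrap_coeff d i' / fact d *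
     measure_pmf.expectation (replicate_pmf (Suc i) P) (\<lambda>xs.
       measure_pmf.expectation (replicate_pmf (Suc i') P) (\<lambda>xs'.
         h (last xs) * h (last xs') * (\<Sum>j\<in>J. vsum e xs j * vsum e xs' j) ^ d)))"

text \<open>For each \<open>\<eta> > 0\<close> the weights of \<open>dual_identity\<close> satisfy
  the hypothesis of \<open>mse_lower_bound_dual\<close>. The left side does not depend on
  \<open>\<eta>\<close>, so \<open>\<eta>\<close> may tend to 0.\<close>

lemma mse_lower_bound:
  fixes h :: "'x \<Rightarrow> real"
  assumes P: "finite (set_pmf P)" and J: "finite J" and f: "f \<in> polys_upto J D"
  shows "measure_pmf.expectation P (\<lambda>x. (h x)\<^sup>2) - dual_energy P e h J D \<le>
    measure_pmf.expectation P (\<lambda>x. \<integral>z. (f (\<lambda>j. e x j + z j) - h x)\<^sup>2 \<partial>gauss J)"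
proof -
  obtain c where lag: "\<And>d e. e \<le> D \<Longrightarrow> (\<Sum>l\<le>D. c d l * real l ^ e) = (if e = d then 1 else 0)"
    using lagrange_coeffs[of D] by metis
  \<comment> \<open>Everything that labels a tilt except its node \<open>l\<close>: the order, the
    number of copies, and a realisation of the copies.\<close>
  define T where "T = (SIGMA d:{..D}. SIGMA i:{..d}. set_pmf (replicate_pmf (Suc i) P))"
  define u where "u = (\<lambda>(d, i, xs). extrap_coeff d i * (pmf (replicate_pmf (Suc i) P) xs * h (last xs)))"
  define v where "v = (\<lambda>(d::nat, i::nat, xs). vsum e xs)"
  define w where "w \<eta> = (\<lambda>(s, l). u s * (c (fst s) l / \<eta> ^ fst s))" for \<eta> :: real
  define m where "m \<eta> = (\<lambda>(s, l::nat) j. \<eta> * real l * v s j)" for \<eta> :: real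
  define \<theta> where "\<theta> s s' = (\<Sum>j\<in>J. v s j * v s' j)" for s s'
  note R = finite_set_replicate_pmf[OF P]
  have finT: "finite T" unfolding T_def using R by (intro finite_SigmaI) auto
  have sumT: "(\<Sum>s\<in>T. u s * F s) = (\<Sum>d\<le>D. \<Sum>i\<le>d. extrap_coeff d i *
      measure_pmf.expectation (replicate_pmf (Suc i) P) (\<lambda>xs. h (last xs) * F (d, i, xs)))" for F
  proof -
    have "(\<Sum>s\<in>T. u s * F s) = (\<Sum>d\<le>D. \<Sum>i\<le>d. \<Sum>xs\<in>set_pmf (replicate_pmf (Suc i) P). u (d, i, xs) * F (d, i, xs))"
      unfolding T_def using R by (simp add: sum.Sigma split_beta')
    then show ?thesis unfolding expectation_finite_support[OF R] u_def
      by (simp add: sum_distrib_left mult_ac)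
  qed
  have dual: "(\<Sum>r\<in>T \<times> {..D}. w \<eta> r * measure_pmf.expectation P (\<lambda>x. f (\<lambda>j. e x j + m \<eta> r j + \<zeta> j))) =
      measure_pmf.expectation P (\<lambda>x. h x * f (\<lambda>j. e x j + \<zeta> j))" if "\<eta> > 0" for \<eta> \<zeta>
  proof -
    have "(\<Sum>r\<in>T \<times> {..D}. w \<eta> r * measure_pmf.expectation P (\<lambda>x. f (\<lambda>j. e x j + m \<eta> r j + \<zeta> j))) =
       (\<Sum>s\<in>T. u s * (\<Sum>l\<le>D. c (fst s) l / \<eta> ^ fst s *
          measure_pmf.expectation P (\<lambda>x. f (\<lambda>j. e x j + \<zeta> j + \<eta> * real l * v s j))))"
      unfolding w_def m_def sum.cartesian_product'
      by (simp add: sum_distrib_left mult.assoc add_ac)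
    also have "\<dots> = measure_pmf.expectation P (\<lambda>x. h x * f (\<lambda>j. e x j + \<zeta> j))"
      unfolding sumT v_def using dual_identity[OF P J f _ lag, of \<eta> h e \<zeta>] that by simp
    finally show ?thesis .
  qed
  define Q where "Q \<eta> = (\<Sum>s\<in>T. \<Sum>s'\<in>T. u s * u s' * (\<Sum>l\<le>D. \<Sum>l'\<le>D. c (fst s) l / \<eta> ^ fst s * (c (fst s') l' / \<eta> ^ fst s') *
      exp (\<eta> * real l * (\<eta> * real l') * \<theta> s s')))" for \<eta>
  have quad: "(\<Sum>r\<in>T \<times> {..D}. \<Sum>r'\<in>T \<times> {..D}. w \<eta> r * w \<eta> r' * exp (\<Sum>j\<in>J. m \<eta> r j * m \<eta> r' j)) = Q \<eta>" for \<eta>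
  proof -
    have "(\<Sum>r\<in>T \<times> {..D}. \<Sum>r'\<in>T \<times> {..D}. w \<eta> r * w \<eta> r' * exp (\<Sum>j\<in>J. m \<eta> r j * m \<eta> r' j)) =
       (\<Sum>s\<in>T. \<Sum>l\<le>D. \<Sum>s'\<in>T. \<Sum>l'\<le>D. u s * u s' * (c (fst s) l / \<eta> ^ fst s * (c (fst s') l' / \<eta> ^ fst s') *
          exp (\<eta> * real l * (\<eta> * real l') * \<theta> s s')))"
      unfolding w_def m_def \<theta>_def
      by (simp add: sum.cartesian_product' sum_distrib_left mult_ac)
    also have "\<dots> = (\<Sum>s\<in>T. \<Sum>s'\<in>T. \<Sum>l\<le>D. \<Sum>l'\<le>D. u s * u s' * (c (fst s) l / \<eta> ^ fst s * (c (fst s') l' / \<eta> ^ fst s') *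
          exp (\<eta> * real l * (\<eta> * real l') * \<theta> s s')))"
      by (intro sum.cong refl sum.swap)
    finally show ?thesis unfolding Q_def by (simp only: sum_distrib_left)
  qed
  \<comment> \<open>Pairs of different orders disappear in the limit, which leaves the single sum
    over \<open>d\<close> in \<open>dual_energy\<close>.\<close>
  have "(Q \<longlongrightarrow> (\<Sum>s\<in>T. \<Sum>s'\<in>T. u s * u s' * (if fst s = fst s' then \<theta> s s' ^ fst s / fact (fst s) else 0))) (at_right 0)"
    unfolding Q_def
    by (intro tendsto_sum tendsto_mult tendsto_const tilt_pairing_limit lag) (auto simp: T_def)
  also have "(\<Sum>s\<in>T. \<Sum>s'\<in>T. u s * u s' * (if fst s = fst s' then \<theta> s s' ^ fst s / fact (fst s) else 0)) =
      (\<Sum>s\<in>T. u s * (\<Sum>s'\<in>T. u s' * (if fst s = fst s' then \<theta> s s' ^ fst s / fact (fst s) else 0)))"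
    by (simp add: sum_distrib_left mult.assoc)
  also have "\<dots> = (\<Sum>s\<in>T. u s * (\<Sum>i'\<le>fst s. extrap_coeff (fst s) i' / fact (fst s) *
      measure_pmf.expectation (replicate_pmf (Suc i') P) (\<lambda>xs'. h (last xs') * (\<Sum>j\<in>J. v s j * vsum e xs' j) ^ fst s)))"
  proof (intro sum.cong refl arg_cong2[where f = "(*)"])
    fix s assume "s \<in> T"
    then have s: "fst s \<le> D" by (auto simp: T_def)
    have "(\<Sum>s'\<in>T. u s' * (if fst s = fst s' then \<theta> s s' ^ fst s / fact (fst s) else 0)) =
      (\<Sum>d\<le>D. if fst s = d then (\<Sum>i'\<le>d. extrap_coeff d i' * measure_pmf.expectation (replicate_pmf (Suc i') P)
         (\<lambda>xs'. h (last xs') * (\<theta> s (d, i', xs') ^ fst s / fact (fst s)))) else 0)"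
      unfolding sumT by (intro sum.cong refl) auto
    also have "\<dots> = (\<Sum>i'\<le>fst s. extrap_coeff (fst s) i' * measure_pmf.expectation (replicate_pmf (Suc i') P)
         (\<lambda>xs'. h (last xs') * (\<theta> s (fst s, i', xs') ^ fst s / fact (fst s))))"
      using s by (subst sum.delta') auto
    finally show "(\<Sum>s'\<in>T. u s' * (if fst s = fst s' then \<theta> s s' ^ fst s / fact (fst s) else 0)) =
      (\<Sum>i'\<le>fst s. extrap_coeff (fst s) i' / fact (fst s) *
      measure_pmf.expectation (replicate_pmf (Suc i') P) (\<lambda>xs'. h (last xs') * (\<Sum>j\<in>J. v s j * vsum e xs' j) ^ fst s))"
      by (simp add: \<theta>_def v_def mult_ac)
  qed
  also have "\<dots> = dual_energy P e h J D"
    unfolding sumT unfolding dual_energy_def sum_distrib_left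
  proof (intro sum.cong refl)
    fix d i
    have inner: "measure_pmf.expectation (replicate_pmf (Suc i') P) (\<lambda>xs'. h (last xs) * h (last xs') * F xs') =
        h (last xs) * measure_pmf.expectation (replicate_pmf (Suc i') P) (\<lambda>xs'. h (last xs') * F xs')"
      for i' xs F by (simp add: mult.assoc)
    have outer: "measure_pmf.expectation (replicate_pmf (Suc i) P) (\<lambda>xs. h (last xs) * (b * G xs)) =
        b * measure_pmf.expectation (replicate_pmf (Suc i) P) (\<lambda>xs. h (last xs) * G xs)" for b G
      by (simp add: mult.left_commute[of _ b])
    show "extrap_coeff d i * measure_pmf.expectation (replicate_pmf (Suc i) P) (\<lambda>xs. \<Sum>i'\<le>fst (d, i, xs). h (last xs) *
        (extrap_coeff (fst (d, i, xs)) i' / fact (fst (d, i, xs)) * measure_pmf.expectation (replicate_pmf (Suc i') P)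
          (\<lambda>xs'. h (last xs') * (\<Sum>j\<in>J. v (d, i, xs) j * vsum e xs' j) ^ fst (d, i, xs)))) =
      (\<Sum>i'\<le>d. extrap_coeff d i * extrap_coeff d i' / fact d *
     measure_pmf.expectation (replicate_pmf (Suc i) P) (\<lambda>xs.
       measure_pmf.expectation (replicate_pmf (Suc i') P) (\<lambda>xs'.
         h (last xs) * h (last xs') * (\<Sum>j\<in>J. vsum e xs j * vsum e xs' j) ^ d)))"
      unfolding v_def fst_conv prod.case expectation_sum_finite[OF R] outer inner sum_distrib_left
      by (intro sum.cong refl) simp
  qed
  finally have lim: "(Q \<longlongrightarrow> dual_energy P e h J D) (at_right 0)" .
  have "measure_pmf.expectation P (\<lambda>x. (h x)\<^sup>2) -
      measure_pmf.expectation P (\<lambda>x. \<integral>z. (f (\<lambda>j. e x j + z j) - h x)\<^sup>2 \<partial>gauss J) \<le> dual_energy P e h J D"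
  proof (rule tendsto_lowerbound[OF lim])
    have "measure_pmf.expectation P (\<lambda>x. (h x)\<^sup>2) -
      measure_pmf.expectation P (\<lambda>x. \<integral>z. (f (\<lambda>j. e x j + z j) - h x)\<^sup>2 \<partial>gauss J) \<le> Q \<eta>" if "\<eta> > 0" for \<eta>
      using mse_lower_bound_dual[OF P J f _ dual[OF that]] finT unfolding quad by fastforce
    then show "\<forall>\<^sub>F \<eta> in at_right 0. measure_pmf.expectation P (\<lambda>x. (h x)\<^sup>2) -
      measure_pmf.expectation P (\<lambda>x. \<integral>z. (f (\<lambda>j. e x j + z j) - h x)\<^sup>2 \<partial>gauss J) \<le> Q \<eta>"
      by (simp add: eventually_at_filter)
  qed simp
  then show ?thesis by simp
qed

section \<open>From the dual energy to overlap moments\<close>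

text \<open>The sum is at most its length times the largest entry, and the power of the largest
  entry is one of the summands on the right.\<close>

lemma sum_list_power_bound:
  fixes ys :: "real list"
  assumes "\<And>y. y \<in> set ys \<Longrightarrow> 0 \<le> y" and "p > 0"
  shows "sum_list ys ^ p \<le> real (length ys) ^ p * (\<Sum>y\<leftarrow>ys. y ^ p)"
proof (cases "ys = []")
  case False
  define m where "m = Max (set ys)"
  have m: "m \<in> set ys" using False by (simp add: m_def)
  have "sum_list zs \<le> real (length zs) * m" if "set zs \<subseteq> set ys" for zs
    using that by (induction zs) (auto simp: m_def algebra_simps intro!: add_mono)
  then have "sum_list ys ^ p \<le> (real (length ys) * m) ^ p"
    using assms(1) by (intro power_mono sum_list_nonneg) auto
  also have "\<dots> = real (length ys) ^ p * m ^ p" by (simp add: power_mult_distrib)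
  also have "m ^ p \<le> (\<Sum>y\<leftarrow>ys. y ^ p)"
    using m assms(1) by (intro member_le_sum_list) auto
  finally show ?thesis by (simp add: mult_left_mono)
qed (use \<open>p > 0\<close> in \<open>simp add: zero_power\<close>)

lemma expectation_replicate_sum_list:
  fixes \<phi> :: "'x \<Rightarrow> real"
  assumes P: "finite (set_pmf P)"
  shows "measure_pmf.expectation (replicate_pmf n P) (\<lambda>xs. \<Sum>x\<leftarrow>xs. \<phi> x) =
    real n * measure_pmf.expectation P \<phi>"
proof (induction n)
  case (Suc n)
  then show ?case
    unfolding expectation_replicate_Suc[OF P]
    by (simp add: integrable_measure_pmf_finite[OF P]
        integrable_measure_pmf_finite[OF finite_set_replicate_pmf[OF P]] algebra_simps)
qed simp

lemma sum_list_product: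
  "(\<Sum>p\<leftarrow>List.product xs ys. f p) = (\<Sum>x\<leftarrow>xs. \<Sum>y\<leftarrow>ys. f (x, y) :: real)"
  by (induction xs) (auto simp: o_def)

lemma vsum_inner:
  assumes "0 \<le> lam"
  shows "(\<Sum>j\<in>J. vsum (\<lambda>x j. sqrt lam * x j) xs j * vsum (\<lambda>x j. sqrt lam * x j) ys j) =
    lam * (\<Sum>x\<leftarrow>xs. \<Sum>y\<leftarrow>ys. \<Sum>j\<in>J. x j * y j)"
proof -
  have 1: "(\<Sum>j\<in>J. vsum (\<lambda>x j. sqrt lam * x j) xs j * b j) =
      sqrt lam * (\<Sum>x\<leftarrow>xs. \<Sum>j\<in>J. x j * b j)" for b
    by (induction xs) (auto simp: vsum_def algebra_simps sum.distrib sum_distrib_left)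
  have 2: "(\<Sum>j\<in>J. x j * vsum (\<lambda>x j. sqrt lam * x j) ys j) =
      sqrt lam * (\<Sum>y\<leftarrow>ys. \<Sum>j\<in>J. x j * y j)" for x
    by (induction ys) (auto simp: vsum_def algebra_simps sum.distrib sum_distrib_left)
  show ?thesis unfolding 1 2 using assms
    by (simp add: sum_list_const_mult mult.assoc[symmetric])
qed

text \<open>Both the overlap of the last copies and the total overlap are dominated by the sum of
  absolute overlaps over all pairs, so \<open>sum_list_power_bound\<close> applies with exponent
  \<open>d + 1\<close>. Every pair has the same expectation; counting the pairs raises the exponent
  to \<open>d + 2\<close>.\<close>

lemma overlap_moment_copies:
  fixes \<phi> :: "'x \<Rightarrow> 'x \<Rightarrow> real"
  assumes P: "finite (set_pmf P)" and "lam \<ge> 0"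
  shows "\<bar>measure_pmf.expectation (replicate_pmf (Suc i) P) (\<lambda>xs.
      measure_pmf.expectation (replicate_pmf (Suc i') P) (\<lambda>xs'.
        \<phi> (last xs) (last xs') * (lam * (\<Sum>x\<leftarrow>xs. \<Sum>x'\<leftarrow>xs'. \<phi> x x')) ^ d))\<bar> \<le>
    lam ^ d * (real (Suc i) * real (Suc i')) ^ (d + 2) *
      measure_pmf.expectation P (\<lambda>x. measure_pmf.expectation P (\<lambda>x'. \<bar>\<phi> x x'\<bar> ^ (d + 1)))"
proof -
  note R = finite_set_replicate_pmf[OF P]
  define c where "c = lam ^ d * (real (Suc i) * real (Suc i')) ^ (d + 1)"
  have pointwise: "\<bar>\<phi> (last xs) (last xs') * (lam * (\<Sum>x\<leftarrow>xs. \<Sum>x'\<leftarrow>xs'. \<phi> x x')) ^ d\<bar> \<le>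
      c * (\<Sum>x\<leftarrow>xs. \<Sum>x'\<leftarrow>xs'. \<bar>\<phi> x x'\<bar> ^ (d + 1))"
    if xs: "xs \<in> set_pmf (replicate_pmf (Suc i) P)" and xs': "xs' \<in> set_pmf (replicate_pmf (Suc i') P)" for xs xs'
  proof -
    define ys where "ys = map (\<lambda>(x, x'). \<bar>\<phi> x x'\<bar>) (List.product xs xs')"
    have len: "length xs = Suc i" "length xs' = Suc i'" using xs xs' by (auto simp: set_replicate_pmf)
    then have ne: "xs \<noteq> []" "xs' \<noteq> []" by auto
    have sumys: "sum_list ys = (\<Sum>x\<leftarrow>xs. \<Sum>x'\<leftarrow>xs'. \<bar>\<phi> x x'\<bar>)"
      unfolding ys_def by (subst sum_list_product) simp
    have "\<bar>\<phi> (last xs) (last xs')\<bar> \<le> sum_list ys"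
      using ne unfolding ys_def by (intro member_le_sum_list) (auto intro!: image_eqI[of _ _ "(last xs, last xs')"])
    moreover have "\<bar>\<Sum>x\<leftarrow>xs. \<Sum>x'\<leftarrow>xs'. \<phi> x x'\<bar> \<le> sum_list ys"
    proof -
      have "\<bar>\<Sum>p\<leftarrow>zs. \<phi> (fst p) (snd p)\<bar> \<le> (\<Sum>p\<leftarrow>zs. \<bar>\<phi> (fst p) (snd p)\<bar>)" for zs
        by (induction zs) auto
      from this[of "List.product xs xs'"] show ?thesis
        unfolding sumys by (simp add: sum_list_product)
    qed
    ultimately have "\<bar>\<phi> (last xs) (last xs') * (lam * (\<Sum>x\<leftarrow>xs. \<Sum>x'\<leftarrow>xs'. \<phi> x x')) ^ d\<bar> \<le>
        sum_list ys * (lam * sum_list ys) ^ d"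
      unfolding abs_mult power_abs using \<open>lam \<ge> 0\<close>
      by (intro mult_mono power_mono) (auto simp: abs_mult mult_left_mono)
    also have "\<dots> = lam ^ d * sum_list ys ^ (d + 1)" by (simp add: power_mult_distrib)
    also have "\<dots> \<le> lam ^ d * (real (length ys) ^ (d + 1) * (\<Sum>y\<leftarrow>ys. y ^ (d + 1)))"
      using \<open>lam \<ge> 0\<close> by (intro mult_left_mono sum_list_power_bound) (auto simp: ys_def)
    also have "\<dots> = c * (\<Sum>x\<leftarrow>xs. \<Sum>x'\<leftarrow>xs'. \<bar>\<phi> x x'\<bar> ^ (d + 1))"
      by (simp add: c_def ys_def len o_def split_beta' sum_list_product del: power_Suc of_nat_Suc mult_Suc mult_Suc_right)
    finally show ?thesis .
  qed
  have abs_exp: "\<bar>measure_pmf.expectation q f\<bar> \<le> measure_pmf.expectation q g"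
    if "finite (set_pmf q)" "\<And>x. x \<in> set_pmf q \<Longrightarrow> \<bar>f x\<bar> \<le> g x" for q :: "'x list pmf" and f g :: "'x list \<Rightarrow> real"
  proof -
    have "\<bar>measure_pmf.expectation q f\<bar> \<le> measure_pmf.expectation q (\<lambda>x. \<bar>f x\<bar>)"
      by (rule integral_abs_bound)
    also have "\<dots> \<le> measure_pmf.expectation q g" by (intro expectation_mono_finite that)
    finally show ?thesis .
  qed
  have "\<bar>measure_pmf.expectation (replicate_pmf (Suc i) P) (\<lambda>xs.
      measure_pmf.expectation (replicate_pmf (Suc i') P) (\<lambda>xs'.
        \<phi> (last xs) (last xs') * (lam * (\<Sum>x\<leftarrow>xs. \<Sum>x'\<leftarrow>xs'. \<phi> x x')) ^ d))\<bar> \<le>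
      measure_pmf.expectation (replicate_pmf (Suc i) P) (\<lambda>xs.
      measure_pmf.expectation (replicate_pmf (Suc i') P) (\<lambda>xs'. c * (\<Sum>x\<leftarrow>xs. \<Sum>x'\<leftarrow>xs'. \<bar>\<phi> x x'\<bar> ^ (d + 1))))"
    by (intro abs_exp R pointwise)
  also have "\<dots> = c * measure_pmf.expectation (replicate_pmf (Suc i) P) (\<lambda>xs.
      measure_pmf.expectation (replicate_pmf (Suc i') P) (\<lambda>xs'. \<Sum>x\<leftarrow>xs. \<Sum>x'\<leftarrow>xs'. \<bar>\<phi> x x'\<bar> ^ (d + 1)))"
    by simp
  also have "(\<lambda>xs. measure_pmf.expectation (replicate_pmf (Suc i') P) (\<lambda>xs'. \<Sum>x\<leftarrow>xs. \<Sum>x'\<leftarrow>xs'. \<bar>\<phi> x x'\<bar> ^ (d + 1))) =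
      (\<lambda>xs. \<Sum>x\<leftarrow>xs. measure_pmf.expectation (replicate_pmf (Suc i') P) (\<lambda>xs'. \<Sum>x'\<leftarrow>xs'. \<bar>\<phi> x x'\<bar> ^ (d + 1)))"
  proof
    fix xs show "measure_pmf.expectation (replicate_pmf (Suc i') P) (\<lambda>xs'. \<Sum>x\<leftarrow>xs. \<Sum>x'\<leftarrow>xs'. \<bar>\<phi> x x'\<bar> ^ (d + 1)) =
      (\<Sum>x\<leftarrow>xs. measure_pmf.expectation (replicate_pmf (Suc i') P) (\<lambda>xs'. \<Sum>x'\<leftarrow>xs'. \<bar>\<phi> x x'\<bar> ^ (d + 1)))"
      by (induction xs) (simp_all add: integrable_measure_pmf_finite[OF R])
  qed
  also have "c * measure_pmf.expectation (replicate_pmf (Suc i) P) \<dots> =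
      c * (real (Suc i) * real (Suc i')) *
      measure_pmf.expectation P (\<lambda>x. measure_pmf.expectation P (\<lambda>x'. \<bar>\<phi> x x'\<bar> ^ (d + 1)))"
    unfolding expectation_replicate_sum_list[OF P] expectation_cmult by (simp only: mult_ac)
  also have "c * (real (Suc i) * real (Suc i')) = lam ^ d * (real (Suc i) * real (Suc i')) ^ (d + 2)"
    by (simp add: c_def del: of_nat_Suc)
  finally show ?thesis .
qed

text \<open>\<open>p\<close> counts powers of the tensor overlap, hence \<open>3 * p\<close> powers
  of the overlap of the underlying vectors.\<close>

definition overlap_moment :: "nat \<Rightarrow> nat \<Rightarrow> nat \<Rightarrow> real" where
  "overlap_moment n k p = measure_pmf.expectation (truncated_prior n k) (\<lambda>x.
     measure_pmf.expectation (truncated_prior n k) (\<lambda>x'. \<bar>tensor_inner n x x'\<bar> ^ p))"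

text \<open>Summing the weights \<open>h = x j\<close> over all coordinates yields one more overlap,
  which explains the exponent \<open>d + 1\<close>. The factor \<open>4 ^ (d + 1)\<close> is the
  square of the extrapolation price, the power of \<open>d + 1\<close> counts pairs of copies, and
  \<open>fact d\<close> in the denominator is bounded by 1.\<close>

lemma sum_dual_energy_bound:
  fixes P :: "('i \<Rightarrow> real) pmf"
  assumes P: "finite (set_pmf P)" and J: "finite J" and lam: "lam \<ge> 0"
  shows "(\<Sum>j\<in>J. dual_energy P (\<lambda>x j. sqrt lam * x j) (\<lambda>x. x j) J D) \<le>
    (\<Sum>d\<le>D. 4 ^ (d + 1) * lam ^ d * real (d + 1) ^ (2 * d + 4) *
      measure_pmf.expectation P (\<lambda>x. measure_pmf.expectation P (\<lambda>x'. \<bar>\<Sum>j\<in>J. x j * x' j\<bar> ^ (d + 1))))"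
proof -
  note R = finite_set_replicate_pmf[OF P]
  define \<phi> where "\<phi> x x' = (\<Sum>j\<in>J. x j * x' j)" for x x' :: "'i \<Rightarrow> real"
  define \<mu> where "\<mu> d = measure_pmf.expectation P (\<lambda>x. measure_pmf.expectation P (\<lambda>x'. \<bar>\<phi> x x'\<bar> ^ (d + 1)))" for d
  define E where "E d i i' = measure_pmf.expectation (replicate_pmf (Suc i) P) (\<lambda>xs.
      measure_pmf.expectation (replicate_pmf (Suc i') P) (\<lambda>xs'.
        \<phi> (last xs) (last xs') * (lam * (\<Sum>x\<leftarrow>xs. \<Sum>x'\<leftarrow>xs'. \<phi> x x')) ^ d))" for d i i'
  have \<mu>0: "\<mu> d \<ge> 0" for d unfolding \<mu>_def by (intro integral_nonneg_AE AE_I2) auto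
  have E_eq: "(\<Sum>j\<in>J. measure_pmf.expectation (replicate_pmf (Suc i) P) (\<lambda>xs.
       measure_pmf.expectation (replicate_pmf (Suc i') P) (\<lambda>xs'. last xs j * last xs' j *
         (\<Sum>j\<in>J. vsum (\<lambda>x j. sqrt lam * x j) xs j * vsum (\<lambda>x j. sqrt lam * x j) xs' j) ^ d))) = E d i i'" for d i i'
    unfolding vsum_inner[OF lam] E_def \<phi>_def sum_distrib_right
    by (simp add: expectation_sum_finite[OF R])
  have swap3: "(\<Sum>j\<in>J. \<Sum>d\<le>D. \<Sum>i\<le>d. \<Sum>i'\<le>d. b d i i' * G j d i i') =
      (\<Sum>d\<le>D. \<Sum>i\<le>d. \<Sum>i'\<le>d. b d i i' * (\<Sum>j\<in>J. G j d i i'))"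
    for b :: "nat \<Rightarrow> nat \<Rightarrow> nat \<Rightarrow> real" and G
    unfolding sum_distrib_left sum.swap[of _ J] ..
  have "(\<Sum>j\<in>J. dual_energy P (\<lambda>x j. sqrt lam * x j) (\<lambda>x. x j) J D) =
     (\<Sum>d\<le>D. \<Sum>i\<le>d. \<Sum>i'\<le>d. extrap_coeff d i * extrap_coeff d i' / fact d * E d i i')"
    unfolding dual_energy_def swap3 E_eq ..
  also have "\<dots> \<le> (\<Sum>d\<le>D. 4 ^ (d + 1) * lam ^ d * real (d + 1) ^ (2 * d + 4) * \<mu> d)"
  proof (rule sum_mono)
    fix d
    define B where "B = lam ^ d * real (d + 1) ^ (2 * d + 4) * \<mu> d"
    have B0: "B \<ge> 0" using lam \<mu>0 by (simp add: B_def)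
    have "(\<Sum>i\<le>d. \<Sum>i'\<le>d. extrap_coeff d i * extrap_coeff d i' / fact d * E d i i') \<le>
        (\<Sum>i\<le>d. \<Sum>i'\<le>d. \<bar>extrap_coeff d i\<bar> * \<bar>extrap_coeff d i'\<bar> * B)"
    proof (intro sum_mono)
      fix i i' assume ii: "i \<in> {..d}" "i' \<in> {..d}"
      have "(real (Suc i) * real (Suc i')) ^ (d + 2) \<le> (real (d + 1) * real (d + 1)) ^ (d + 2)"
        using ii by (intro power_mono mult_mono) auto
      also have "\<dots> = real (d + 1) ^ (2 * (d + 2))"
        by (simp only: power_mult power2_eq_square)
      also have "2 * (d + 2) = 2 * d + 4" by simp
      finally have "lam ^ d * (real (Suc i) * real (Suc i')) ^ (d + 2) * \<mu> d \<le> B"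
        unfolding B_def using lam \<mu>0 by (intro mult_right_mono mult_left_mono) auto
      then have E: "\<bar>E d i i'\<bar> \<le> B"
        unfolding E_def \<mu>_def by (rule order.trans[OF overlap_moment_copies[OF P lam]])
      have "extrap_coeff d i * extrap_coeff d i' / fact d * E d i i' \<le>
          \<bar>extrap_coeff d i * extrap_coeff d i' / fact d * E d i i'\<bar>" by (rule abs_ge_self)
      also have "\<dots> = \<bar>extrap_coeff d i\<bar> * \<bar>extrap_coeff d i'\<bar> / fact d * \<bar>E d i i'\<bar>"
        by (simp add: abs_mult)
      also have "\<dots> \<le> \<bar>extrap_coeff d i\<bar> * \<bar>extrap_coeff d i'\<bar> / 1 * B"
        using E by (intro mult_mono frac_le) (auto simp: fact_ge_1)
      finally show "extrap_coeff d i * extrap_coeff d i' / fact d * E d i i' \<le>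
        \<bar>extrap_coeff d i\<bar> * \<bar>extrap_coeff d i'\<bar> * B" by simp
    qed
    also have "\<dots> = (\<Sum>i\<le>d. \<bar>extrap_coeff d i\<bar>) * (\<Sum>i\<le>d. \<bar>extrap_coeff d i\<bar>) * B"
      unfolding sum_product by (simp only: sum_distrib_right)
    also have "\<dots> \<le> 2 ^ (d + 1) * 2 ^ (d + 1) * B"
      using B0 extrap_coeff_abs_sum[of d] by (intro mult_right_mono mult_mono) (auto intro: sum_nonneg)
    also have "(2::real) ^ (d + 1) * 2 ^ (d + 1) = 4 ^ (d + 1)"
      by (simp only: power_mult_distrib[symmetric]) simp
    finally show "(\<Sum>i\<le>d. \<Sum>i'\<le>d. extrap_coeff d i * extrap_coeff d i' / fact d * E d i i') \<le>
      4 ^ (d + 1) * lam ^ d * real (d + 1) ^ (2 * d + 4) * \<mu> d"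
      by (simp add: B_def mult_ac)
  qed
  finally show ?thesis unfolding \<mu>_def \<phi>_def .
qed

section \<open>The low-degree MMSE of the tensor model\<close>

lemma entry_pmf_support: "set_pmf (entry_pmf n k) \<subseteq> {- 1, 0, 1}"
  by (auto simp: entry_pmf_def split: if_splits)

lemma finite_support_entry_vec: "finite (set_pmf (Pi_pmf {..<n} 0 (\<lambda>_. entry_pmf n k)))"
proof (rule finite_subset)
  show "set_pmf (Pi_pmf {..<n} 0 (\<lambda>_. entry_pmf n k)) \<subseteq> PiE_dflt {..<n} 0 (\<lambda>_. {- 1, 0, 1})"
    using entry_pmf_support[of n k] by (auto simp: set_Pi_pmf PiE_dflt_def)
qed (auto intro: finite_PiE_dflt)

lemma finite_support_prior: "finite (set_pmf (truncated_prior n k))"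
  by (simp add: truncated_prior_def finite_support_entry_vec)

lemma finite_tensor_idx: "finite (tensor_idx n)"
  by (simp add: tensor_idx_def)

text \<open>Fubini. As the prior has finite support, joint integrability reduces to that of
  polynomials in the noise for fixed signal.\<close>

lemma signal_noise_mse:
  assumes f: "f \<in> tensor_idx n \<rightarrow> polys_upto (tensor_idx n) D"
  shows "(\<integral>(x, z). (\<Sum>j\<in>tensor_idx n. (f j (observation lam x z) - x j)\<^sup>2) \<partial>signal_noise n k) =
    (\<Sum>j\<in>tensor_idx n. measure_pmf.expectation (truncated_prior n k)
      (\<lambda>x. \<integral>z. (f j (\<lambda>i. sqrt lam * x i + z i) - x j)\<^sup>2 \<partial>gauss (tensor_idx n)))"
proof -
  let ?J = "tensor_idx n" and ?P = "truncated_prior n k"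
  interpret G: prob_space "gauss ?J" by (rule prob_space_gauss)
  interpret pair_sigma_finite "measure_pmf ?P" "gauss ?J" ..
  define F where "F = (\<lambda>p. \<Sum>j\<in>?J. (f j (observation lam (fst p) (snd p)) - fst p j)\<^sup>2)"
  have int: "integrable (gauss ?J) (\<lambda>z. (f j (observation lam x z) - x j)\<^sup>2)" if "j \<in> ?J" for x j
  proof -
    have fj: "f j \<in> polys_upto ?J D" using f that by auto
    show ?thesis
      unfolding power2_diff observation_def
      using integrable_gauss_poly[OF finite_tensor_idx fj] integrable_gauss_poly_square[OF finite_tensor_idx fj] by simp
  qed
  have meas_j: "(\<lambda>p. f j (observation lam (fst p) (snd p))) \<in> borel_measurable (measure_pmf ?P \<Otimes>\<^sub>M gauss ?J)" if "j \<in> ?J" for j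
  proof -
    have "f j \<in> polys_upto ?J D" using f that by auto
    then obtain C where fj: "f j = (\<lambda>y. \<Sum>\<alpha>\<in>exponents_upto ?J D. C \<alpha> * (\<Prod>j\<in>?J. y j ^ \<alpha> j))"
      by (rule polys_upto_cases)
    have [measurable]: "(\<lambda>p. fst p i) \<in> borel_measurable (measure_pmf ?P \<Otimes>\<^sub>M gauss ?J)" for i
      by (rule measurable_compose[OF measurable_fst]) simp
    have [measurable]: "(\<lambda>p. snd p i) \<in> borel_measurable (measure_pmf ?P \<Otimes>\<^sub>M gauss ?J)" if "i \<in> ?J" for i
      using measurable_compose[OF measurable_snd measurable_component_singleton[OF that, of "\<lambda>_. std_normal_distribution"]]
      by simp
    show ?thesis unfolding fj observation_def by measurable
  qed
  have [measurable]: "F \<in> borel_measurable (measure_pmf ?P \<Otimes>\<^sub>M gauss ?J)"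
    unfolding F_def
    by (intro borel_measurable_sum borel_measurable_power borel_measurable_diff meas_j
          measurable_compose[OF measurable_fst]) auto
  have intF: "integrable (gauss ?J) (\<lambda>z. F (x, z))" for x
    unfolding F_def using int by auto
  have "integrable (measure_pmf ?P \<Otimes>\<^sub>M gauss ?J) F"
    by (intro Fubini_integrable integrable_measure_pmf_finite finite_support_prior AE_I2 intF) measurable
  from integral_fst'[OF this]
  have "integral\<^sup>L (signal_noise n k) F = measure_pmf.expectation ?P (\<lambda>x. \<integral>z. F (x, z) \<partial>gauss ?J)"
    by (simp add: signal_noise_def)
  also have "\<dots> = measure_pmf.expectation ?P (\<lambda>x. \<Sum>j\<in>?J. \<integral>z. (f j (observation lam x z) - x j)\<^sup>2 \<partial>gauss ?J)"
    unfolding F_def using int by simp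
  also have "\<dots> = (\<Sum>j\<in>?J. measure_pmf.expectation ?P (\<lambda>x. \<integral>z. (f j (\<lambda>i. sqrt lam * x i + z i) - x j)\<^sup>2 \<partial>gauss ?J))"
    unfolding expectation_sum_finite[OF finite_support_prior] observation_def ..
  finally show ?thesis by (simp add: F_def split_beta')
qed

lemma monomial_in_polys_upto:
  assumes "finite J" and \<beta>: "\<beta> \<in> exponents_upto J D"
  shows "(\<lambda>y. a * (\<Prod>j\<in>J. y j ^ \<beta> j)) \<in> polys_upto J D"
  unfolding polys_upto_def
proof (rule range_eqI[of _ _ "\<lambda>\<alpha>. if \<alpha> = \<beta> then a else 0"], rule ext)
  fix y :: "'a \<Rightarrow> real"
  have "(\<Sum>\<alpha>\<in>exponents_upto J D. (if \<alpha> = \<beta> then a else 0) * (\<Prod>j\<in>J. y j ^ \<alpha> j)) =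
     (\<Sum>\<alpha>\<in>exponents_upto J D. if \<alpha> = \<beta> then a * (\<Prod>j\<in>J. y j ^ \<alpha> j) else 0)"
    by (intro sum.cong) auto
  also have "\<dots> = a * (\<Prod>j\<in>J. y j ^ \<beta> j)"
    using \<beta> finite_exponents_upto[OF assms(1)] by (subst sum.delta) auto
  finally show "a * (\<Prod>j\<in>J. y j ^ \<beta> j) =
    (\<Sum>\<alpha>\<in>exponents_upto J D. (if \<alpha> = \<beta> then a else 0) * (\<Prod>j\<in>J. y j ^ \<alpha> j))" ..
qed

lemma const_in_polys_upto:
  assumes "finite J"
  shows "(\<lambda>_. a) \<in> polys_upto J D"
  using monomial_in_polys_upto[OF assms, of "\<lambda>j\<in>J. 0" D a]
  by (auto simp: exponents_upto_def)

lemma power_in_polys_upto: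
  assumes "finite J" and "i \<in> J" and "d \<le> D"
  shows "(\<lambda>y. a * y i ^ d) \<in> polys_upto J D"
proof -
  let ?\<beta> = "\<lambda>j\<in>J. if j = i then d else 0"
  have "?\<beta> \<in> exponents_upto J D" using assms by (auto simp: exponents_upto_def)
  moreover have "(\<Prod>j\<in>J. y j ^ ?\<beta> j) = y i ^ d" for y :: "'a \<Rightarrow> real"
  proof -
    have "(\<Prod>j\<in>J. y j ^ ?\<beta> j) = (\<Prod>j\<in>J. if j = i then y j ^ d else 1)"
      by (intro prod.cong) auto
    then show ?thesis using assms by simp
  qed
  ultimately show ?thesis using monomial_in_polys_upto[OF assms(1), of ?\<beta> D a] by simp
qed

lemma low_deg_mmse_upper:
  assumes f: "f \<in> tensor_idx n \<rightarrow> polys_upto (tensor_idx n) D"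
  shows "low_deg_mmse D n k lam \<le> (\<Sum>j\<in>tensor_idx n. measure_pmf.expectation (truncated_prior n k)
      (\<lambda>x. \<integral>z. (f j (\<lambda>i. sqrt lam * x i + z i) - x j)\<^sup>2 \<partial>gauss (tensor_idx n)))"
  unfolding low_deg_mmse_def signal_noise_mse[OF f, symmetric]
proof (rule cINF_lower[OF _ f])
  \<comment> \<open>Boundedness below is what makes the infimum of reals a lower bound for its
    members.\<close>
  show "bdd_below ((\<lambda>f. \<integral>(x, z). (\<Sum>j\<in>tensor_idx n. (f j (observation lam x z) - x j)\<^sup>2) \<partial>signal_noise n k) `
    (tensor_idx n \<rightarrow> polys_upto (tensor_idx n) D))"
    by (rule bdd_belowI2[of _ 0], rule integral_nonneg_AE) (auto intro!: sum_nonneg AE_I2)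
qed

lemma low_deg_mmse_nonneg: "0 \<le> low_deg_mmse D n m l"
  unfolding low_deg_mmse_def
proof (rule cINF_greatest)
  show "tensor_idx n \<rightarrow> polys_upto (tensor_idx n) D \<noteq> {}"
    using const_in_polys_upto[OF finite_tensor_idx] by (auto intro!: exI[of _ "\<lambda>_ _. 0"])
qed (auto intro!: integral_nonneg_AE AE_I2 sum_nonneg)

text \<open>The constant estimator by the prior mean is a polynomial of degree 0.\<close>

lemma low_deg_mmse_le_trivial: "low_deg_mmse D n k lam \<le> trivial_mmse n k"
proof -
  let ?J = "tensor_idx n" and ?P = "truncated_prior n k"
  interpret G: prob_space "gauss ?J" by (rule prob_space_gauss)
  define \<mu> where "\<mu> j = measure_pmf.expectation ?P (\<lambda>x. x j)" for j
  note int = integrable_measure_pmf_finite[OF finite_support_prior]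
  have "low_deg_mmse D n k lam \<le> (\<Sum>j\<in>?J. measure_pmf.expectation ?P
      (\<lambda>x. \<integral>z. (\<mu> j - x j)\<^sup>2 \<partial>gauss ?J))"
    by (rule low_deg_mmse_upper[of "\<lambda>j _. \<mu> j"]) (auto simp: const_in_polys_upto finite_tensor_idx)
  also have "\<dots> = (\<Sum>j\<in>?J. measure_pmf.expectation ?P (\<lambda>x. (x j)\<^sup>2) - (\<mu> j)\<^sup>2)"
  proof (intro sum.cong refl)
    fix j
    have "measure_pmf.expectation ?P (\<lambda>x. \<integral>z. (\<mu> j - x j)\<^sup>2 \<partial>gauss ?J) =
        (\<mu> j)\<^sup>2 + measure_pmf.expectation ?P (\<lambda>x. (x j)\<^sup>2) - 2 * \<mu> j * measure_pmf.expectation ?P (\<lambda>x. x j)"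
      by (simp add: G.prob_space power2_diff int)
    then show "measure_pmf.expectation ?P (\<lambda>x. \<integral>z. (\<mu> j - x j)\<^sup>2 \<partial>gauss ?J) =
        measure_pmf.expectation ?P (\<lambda>x. (x j)\<^sup>2) - (\<mu> j)\<^sup>2"
      by (simp add: \<mu>_def power2_eq_square)
  qed
  also have "\<dots> = trivial_mmse n k"
    unfolding trivial_mmse_def expectation_sum_finite[OF finite_support_prior] \<mu>_def by (simp add: sum_subtractf)
  finally show ?thesis .
qed

text \<open>\<open>mse_lower_bound\<close> is applied to each coordinate with \<open>h\<close> the
  signal entry, and the results are summed. The second moment of the signal dominates
  \<open>trivial_mmse\<close>.\<close>

lemma low_deg_mmse_lower:
  assumes "lam \<ge> 0"
  shows "trivial_mmse n k - (\<Sum>d\<le>D. 4 ^ (d + 1) * lam ^ d * real (d + 1) ^ (2 * d + 4) * overlap_moment n k (d + 1))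
    \<le> low_deg_mmse D n k lam"
  unfolding low_deg_mmse_def
proof (rule cINF_greatest)
  let ?J = "tensor_idx n" and ?P = "truncated_prior n k"
  show "?J \<rightarrow> polys_upto ?J D \<noteq> {}"
    using const_in_polys_upto[OF finite_tensor_idx] by (auto intro!: exI[of _ "\<lambda>_ _. 0"])
  fix f assume f: "f \<in> ?J \<rightarrow> polys_upto ?J D"
  have "trivial_mmse n k \<le> (\<Sum>j\<in>?J. measure_pmf.expectation ?P (\<lambda>x. (x j)\<^sup>2))"
    unfolding trivial_mmse_def expectation_sum_finite[OF finite_support_prior] by (simp add: sum_nonneg)
  moreover have "(\<Sum>j\<in>?J. dual_energy ?P (\<lambda>x j. sqrt lam * x j) (\<lambda>x. x j) ?J D) \<le>
     (\<Sum>d\<le>D. 4 ^ (d + 1) * lam ^ d * real (d + 1) ^ (2 * d + 4) * overlap_moment n k (d + 1))"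
    unfolding overlap_moment_def tensor_inner_def
    by (rule sum_dual_energy_bound[OF finite_support_prior finite_tensor_idx assms])
  moreover have "(\<Sum>j\<in>?J. measure_pmf.expectation ?P (\<lambda>x. (x j)\<^sup>2) - dual_energy ?P (\<lambda>x j. sqrt lam * x j) (\<lambda>x. x j) ?J D) \<le>
      (\<Sum>j\<in>?J. measure_pmf.expectation ?P (\<lambda>x. \<integral>z. (f j (\<lambda>i. sqrt lam * x i + z i) - x j)\<^sup>2 \<partial>gauss ?J))"
    using f by (intro sum_mono mse_lower_bound finite_support_prior finite_tensor_idx) auto
  ultimately show "trivial_mmse n k - (\<Sum>d\<le>D. 4 ^ (d + 1) * lam ^ d * real (d + 1) ^ (2 * d + 4) * overlap_moment n k (d + 1))
    \<le> (\<integral>(x, z). (\<Sum>j\<in>?J. (f j (observation lam x z) - x j)\<^sup>2) \<partial>signal_noise n k)"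
    unfolding signal_noise_mse[OF f] sum_subtractf by linarith
qed

section \<open>Overlaps under the truncated prior\<close>

abbreviation entry_vec :: "nat \<Rightarrow> nat \<Rightarrow> (nat \<Rightarrow> real) pmf" where
  "entry_vec n k \<equiv> Pi_pmf {..<n} 0 (\<lambda>_. entry_pmf n k)"

text \<open>For \<open>k \<le> n\<close>, the probability that entries of two independent vectors
  multiply to 1, and equally that they multiply to -1.\<close>

definition agree_prob :: "nat \<Rightarrow> nat \<Rightarrow> real" where
  "agree_prob n k = (real k / real n)\<^sup>2 / 2"

definition overlap :: "nat \<Rightarrow> (nat \<Rightarrow> real) \<Rightarrow> (nat \<Rightarrow> real) \<Rightarrow> real" where
  "overlap n v w = (\<Sum>i<n. v i * w i)"

lemma entry_vec_values:
  assumes "u \<in> set_pmf (entry_vec n k)"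
  shows "u i \<in> {- 1, 0, 1}"
  using assms entry_pmf_support[of n k]
  by (cases "i < n") (auto simp: set_Pi_pmf PiE_dflt_def)

lemma truncate_vec_values:
  assumes "u \<in> set_pmf (entry_vec n k)"
  shows "truncate_vec n k u i \<in> {- 1, 0, 1}"
  using entry_vec_values[OF assms, of i] by (auto simp: truncate_vec_def indicator_def)

lemma expectation_entry_pmf:
  fixes g :: "real \<Rightarrow> real"
  assumes "k \<le> n"
  shows "measure_pmf.expectation (entry_pmf n k) g =
    (1 - real k / real n) * g 0 + real k / real n / 2 * (g 1 + g (- 1))"
proof -
  have 01: "0 \<le> real k / real n" "real k / real n \<le> 1" using assms by (auto simp: divide_le_eq_1)
  have "measure_pmf.expectation (entry_pmf n k) g = measure_pmf.expectation (bernoulli_pmf (real k / real n))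
      (\<lambda>b. measure_pmf.expectation (if b then pmf_of_set {- 1, 1} else return_pmf 0) g)"
    unfolding entry_pmf_def by (rule expectation_bind_finite) (auto intro: finite_subset[of _ UNIV])
  also have "\<dots> = (1 - real k / real n) * g 0 + real k / real n / 2 * (g 1 + g (- 1))"
    using 01 by (simp add: integral_pmf_of_set field_simps)
  finally show ?thesis .
qed

lemma expectation_entry_vec_prod:
  fixes f :: "nat \<Rightarrow> real \<Rightarrow> real"
  assumes "k \<le> n" and "\<And>i x. 0 \<le> f i x"
  shows "measure_pmf.expectation (entry_vec n k) (\<lambda>u. \<Prod>i<n. f i (u i)) =
    (\<Prod>i<n. (1 - real k / real n) * f i 0 + real k / real n / 2 * (f i 1 + f i (- 1)))"
  using assms entry_pmf_support[of n k]
  by (subst expectation_prod_Pi_pmf)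
     (auto simp: expectation_entry_pmf intro!: integrable_measure_pmf_finite intro: finite_subset)

text \<open>For fixed \<open>u\<close> the inner expectation is again a product over coordinates, so
  the formula for one vector applies twice.\<close>

lemma expectation_entry_vec_pair_prod:
  fixes f :: "nat \<Rightarrow> real \<Rightarrow> real"
  assumes "k \<le> n" and f: "\<And>i x. 0 \<le> f i x"
  shows "measure_pmf.expectation (entry_vec n k) (\<lambda>u. measure_pmf.expectation (entry_vec n k)
      (\<lambda>u'. \<Prod>i<n. f i (u i * u' i))) =
    (\<Prod>i<n. (1 - 2 * agree_prob n k) * f i 0 + agree_prob n k * (f i 1 + f i (- 1)))"
proof -
  define p where "p = real k / real n"
  have p: "0 \<le> p" "p \<le> 1" using assms by (auto simp: p_def divide_le_eq_1)
  have "measure_pmf.expectation (entry_vec n k) (\<lambda>u. measure_pmf.expectation (entry_vec n k)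
      (\<lambda>u'. \<Prod>i<n. f i (u i * u' i))) =
    measure_pmf.expectation (entry_vec n k) (\<lambda>u. \<Prod>i<n. (1 - p) * f i 0 + p / 2 * (f i (u i) + f i (- u i)))"
    by (subst expectation_entry_vec_prod[OF assms(1), where f = "\<lambda>i x. f i (_ i * x)"]) (auto simp: f p_def)
  also have "\<dots> = (\<Prod>i<n. (1 - p) * ((1 - p) * f i 0 + p / 2 * (f i 0 + f i (- 0))) +
      p / 2 * (((1 - p) * f i 0 + p / 2 * (f i 1 + f i (- 1))) + ((1 - p) * f i 0 + p / 2 * (f i (- 1) + f i (- (- 1))))))"
    unfolding p_def
    using f p by (intro expectation_entry_vec_prod[OF assms(1), where f = "\<lambda>i x. _ * f i 0 + _ / 2 * (f i x + f i (- x))"])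
      (auto intro!: add_nonneg_nonneg mult_nonneg_nonneg simp: p_def)
  also have "\<dots> = (\<Prod>i<n. (1 - 2 * agree_prob n k) * f i 0 + agree_prob n k * (f i 1 + f i (- 1)))"
    unfolding agree_prob_def p_def[symmetric] by (intro prod.cong refl) (simp add: field_simps power2_eq_square)
  finally show ?thesis .
qed

section \<open>The truncation event\<close>

definition truncated :: "nat \<Rightarrow> nat \<Rightarrow> (nat \<Rightarrow> real) \<Rightarrow> bool" where
  "truncated n k u \<longleftrightarrow> real (l0_norm n u) \<notin> {real k / 2 .. 2 * real k}"

definition truncation_prob :: "nat \<Rightarrow> nat \<Rightarrow> real" where
  "truncation_prob n k = measure_pmf.expectation (entry_vec n k) (\<lambda>u. of_bool (truncated n k u))"

lemma l0_norm_power: "c ^ l0_norm n u = (\<Prod>i<n. if u i = 0 then 1 else c :: real)"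
proof -
  have "(\<Prod>i<n. if u i = 0 then 1 else c) = (\<Prod>i\<in>{..<n}. if u i \<noteq> 0 then c else 1)"
    by (intro prod.cong) auto
  also have "\<dots> = (\<Prod>i\<in>{i\<in>{..<n}. u i \<noteq> 0}. c)" by (subst prod.inter_filter) auto
  finally show ?thesis by (simp add: l0_norm_def)
qed

text \<open>The generating function of a binomial variable, followed by 1 + x \<le> exp x.\<close>

lemma expectation_l0_power:
  assumes "0 < n" and "k \<le> n" and "0 \<le> c"
  shows "measure_pmf.expectation (entry_vec n k) (\<lambda>u. c ^ l0_norm n u) \<le> exp (real k * (c - 1))"
proof -
  have "measure_pmf.expectation (entry_vec n k) (\<lambda>u. c ^ l0_norm n u) = (1 + real k / real n * (c - 1)) ^ n"
    unfolding l0_norm_power using assms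
    by (subst expectation_entry_vec_prod[where f = "\<lambda>_ x. if x = 0 then 1 else c"]) (auto simp: algebra_simps diff_divide_distrib)
  also have "\<dots> \<le> exp (real k / real n * (c - 1)) ^ n"
  proof (intro power_mono exp_ge_add_one_self)
    have "real k / real n * (1 - c) \<le> real k / real n * 1"
      using assms by (intro mult_left_mono) auto
    also have "\<dots> \<le> 1" using assms by (simp add: divide_le_eq_1)
    finally have "real k / real n * (1 - c) \<le> 1" .
    then show "0 \<le> 1 + real k / real n * (c - 1)" by (simp add: algebra_simps diff_divide_distrib)
  qed
  also have "\<dots> = exp (real k * (c - 1))" using assms by (simp flip: exp_of_nat_mult)
  finally show ?thesis .
qed

text \<open>Chernoff bounds with base 2 for the upper tail and base 1/2 for the lower one. The
  exponents per unit of \<open>k\<close> are 1 - 2 ln 2 and (ln 2 - 1) / 2, both below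
  -1/10.\<close>

lemma truncation_prob_bound:
  assumes "0 < n" and "k \<le> n"
  shows "truncation_prob n k \<le> 2 * exp (- real k / 10)"
proof -
  note R = finite_support_entry_vec[of n k]
  have of_bool_le: "of_bool Q \<le> a + b" if "Q \<Longrightarrow> 1 \<le> a \<or> 1 \<le> b" "0 < a" "0 < b" for Q and a b :: real
    using that by (cases Q) auto
  have pointwise: "of_bool (truncated n k u) \<le>
      exp (- (2 * ln 2 * real k)) * 2 ^ l0_norm n u + exp (ln 2 * real k / 2) * (1 / 2) ^ l0_norm n u" for u
  proof -
    define l where "l = l0_norm n u"
    have two: "2 ^ l = exp (ln 2 * real l)"
      using exp_of_nat_mult[of l "ln 2 :: real"] by (simp add: mult.commute)
    then have half: "(1 / 2) ^ l = exp (- (ln 2 * real l))"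
      by (simp add: exp_minus power_one_over inverse_eq_divide)
    have "1 \<le> exp (ln 2 * (real l - 2 * real k)) \<or> 1 \<le> exp (ln 2 * (real k / 2 - real l))" if "truncated n k u"
      using that unfolding truncated_def l_def[symmetric] by auto
    moreover have "0 < exp (ln 2 * (real l - 2 * real k))" "0 < exp (ln 2 * (real k / 2 - real l))"
      by (rule exp_gt_zero)+
    ultimately have "of_bool (truncated n k u) \<le> exp (ln 2 * (real l - 2 * real k)) + exp (ln 2 * (real k / 2 - real l))"
      by (rule of_bool_le)
    also have "\<dots> = exp (- (2 * ln 2 * real k)) * 2 ^ l + exp (ln 2 * real k / 2) * (1 / 2) ^ l"
      unfolding two half exp_add[symmetric] by (simp add: algebra_simps)
    finally show ?thesis by (simp only: l_def)
  qed
  have "truncation_prob n k \<le> measure_pmf.expectation (entry_vec n k) (\<lambda>u.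
      exp (- (2 * ln 2 * real k)) * 2 ^ l0_norm n u + exp (ln 2 * real k / 2) * (1 / 2) ^ l0_norm n u)"
    unfolding truncation_prob_def by (intro expectation_mono_finite R pointwise)
  also have "\<dots> = exp (- (2 * ln 2 * real k)) * measure_pmf.expectation (entry_vec n k) (\<lambda>u. 2 ^ l0_norm n u) +
      exp (ln 2 * real k / 2) * measure_pmf.expectation (entry_vec n k) (\<lambda>u. (1 / 2) ^ l0_norm n u)"
    by (simp add: integrable_measure_pmf_finite[OF R])
  also have "\<dots> \<le> exp (- (2 * ln 2 * real k)) * exp (real k * (2 - 1)) +
      exp (ln 2 * real k / 2) * exp (real k * (1 / 2 - 1))"
    using assms by (intro add_mono mult_left_mono expectation_l0_power) auto
  also have "\<dots> = exp (real k * (1 - 2 * ln 2)) + exp (real k * ((ln 2 - 1) / 2))"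
    unfolding exp_add[symmetric] by (simp add: algebra_simps diff_divide_distrib)
  also have "\<dots> \<le> exp (real k * (- 1 / 10)) + exp (real k * (- 1 / 10))"
    using ln2_ge_two_thirds ln2_le_25_over_36
    by (intro add_mono iffD2[OF exp_le_cancel_iff] mult_left_mono) auto
  finally show ?thesis by simp
qed

lemma truncate_vec_eq: "\<not> truncated n k u \<Longrightarrow> truncate_vec n k u = u"
  by (simp add: truncated_def truncate_vec_def)

lemma truncation_prob_pair:
  "measure_pmf.expectation (entry_vec n k) (\<lambda>u. measure_pmf.expectation (entry_vec n k)
     (\<lambda>u'. of_bool (truncated n k u) + of_bool (truncated n k u') :: real)) = 2 * truncation_prob n k"
  by (simp add: integrable_measure_pmf_finite[OF finite_support_entry_vec] truncation_prob_def)

lemma expectation_truncated_prior: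
  fixes F :: "(idx \<Rightarrow> real) \<Rightarrow> real"
  shows "measure_pmf.expectation (truncated_prior n k) F =
    measure_pmf.expectation (entry_vec n k) (\<lambda>u. F (tensor_cube (truncate_vec n k u)))"
  by (simp add: truncated_prior_def)

lemma tensor_inner_cube: "tensor_inner n (tensor_cube v) (tensor_cube w) = overlap n v w ^ 3"
proof -
  have "tensor_inner n (tensor_cube v) (tensor_cube w) =
      (\<Sum>a<n. \<Sum>b<n. \<Sum>c<n. (v a * w a) * ((v b * w b) * (v c * w c)))"
    unfolding tensor_inner_def tensor_idx_def tensor_cube_def sum.cartesian_product'
    by (simp add: mult_ac)
  also have "\<dots> = overlap n v w * (overlap n v w * overlap n v w)"
    unfolding overlap_def by (simp only: sum_product) (simp add: sum_distrib_left sum_distrib_right)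
  finally show ?thesis by (simp add: power3_eq_cube mult.assoc)
qed

lemma abs_overlap_le:
  assumes "\<And>i. v i \<in> {- 1, 0, 1}" and "\<And>i. w i \<in> {- 1, 0, 1}"
  shows "\<bar>overlap n v w\<bar> \<le> real n"
proof -
  have "\<bar>v i * w i\<bar> \<le> 1" for i using assms(1)[of i] assms(2)[of i] by auto
  then have "\<bar>overlap n v w\<bar> \<le> (\<Sum>i<n. 1)"
    unfolding overlap_def by (intro order.trans[OF sum_abs] sum_mono) auto
  then show ?thesis by simp
qed

section \<open>Overlap moments and squared norms\<close>

text \<open>For \<open>0 < p\<close> the series of exp contains both 1 and
  \<open>x ^ p / fact p\<close>. Subtracting the 1 is essential: it makes the expected bound of
  order k^2 / n instead of order one.\<close>

lemma power_le_fact_exp: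
  fixes x :: real
  assumes "0 \<le> x" and "0 < p"
  shows "x ^ p \<le> fact p * (exp x - 1)"
proof -
  obtain t where "exp x = (\<Sum>m<Suc p. x ^ m / fact m) + exp t / fact (Suc p) * x ^ Suc p"
    using Maclaurin_exp_le[of x "Suc p"] by blast
  moreover have "0 \<le> exp t / fact (Suc p) * x ^ Suc p"
    using assms by (simp del: fact_Suc power_Suc)
  moreover have "1 + x ^ p / fact p \<le> (\<Sum>m<Suc p. x ^ m / fact m)"
  proof -
    have "(\<Sum>m\<in>{0, p}. x ^ m / fact m) \<le> (\<Sum>m<Suc p. x ^ m / fact m)"
      using assms by (intro sum_mono2) auto
    then show ?thesis using assms by simp
  qed
  ultimately have "x ^ p / fact p \<le> exp x - 1" by linarith
  then show ?thesis by (simp add: field_simps)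
qed

text \<open>The expectation is a power of 1 + 2 r (e - 1) with r n = k^2 / (2 n), hence at most exp
  x with x = 2 k^2 / n. The hypothesis gives x \<le> 1, and then exp x \<le> 1 + x + x^2 \<le> 1 + 2
  x.\<close>

lemma expectation_exp_overlap:
  assumes "0 < n" and "k \<le> n" and "2 * (real k)\<^sup>2 \<le> real n"
  shows "measure_pmf.expectation (entry_vec n k) (\<lambda>u. measure_pmf.expectation (entry_vec n k)
    (\<lambda>u'. exp (\<Sum>i<n. \<bar>u i * u' i\<bar>))) \<le> 1 + 4 * (real k)\<^sup>2 / real n"
proof -
  define r where "r = agree_prob n k"
  have r: "0 \<le> r" "r * real n = (real k)\<^sup>2 / real n / 2"
    using assms by (auto simp: r_def agree_prob_def power2_eq_square)
  have "measure_pmf.expectation (entry_vec n k) (\<lambda>u. measure_pmf.expectation (entry_vec n k)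
    (\<lambda>u'. exp (\<Sum>i<n. \<bar>u i * u' i\<bar>))) = (1 + 2 * r * (exp 1 - 1)) ^ n"
    unfolding exp_sum[OF finite_lessThan] r_def
    by (subst expectation_entry_vec_pair_prod[OF assms(2), where f = "\<lambda>_ x. exp \<bar>x\<bar>"]) (auto simp: algebra_simps)
  also have "\<dots> \<le> (1 + 2 * r * 2) ^ n"
    using exp_le r by (intro power_mono add_left_mono mult_left_mono) auto
  also have "\<dots> \<le> exp (4 * r) ^ n" using r by (intro power_mono exp_ge_add_one_self) (auto simp: mult.commute)
  also have "\<dots> = exp (2 * (real k)\<^sup>2 / real n)"
    using r(2) by (simp add: mult_ac flip: exp_of_nat_mult)
  also have "\<dots> \<le> 1 + 2 * (real k)\<^sup>2 / real n + (2 * (real k)\<^sup>2 / real n)\<^sup>2"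
    using assms by (intro exp_bound) (auto simp: divide_le_eq_1)
  also have "\<dots> \<le> 1 + 2 * (real k)\<^sup>2 / real n + (2 * (real k)\<^sup>2 / real n) * 1"
    unfolding power2_eq_square[of "2 * (real k)\<^sup>2 / real n"]
    using assms by (intro add_left_mono mult_left_mono) (auto simp: divide_le_eq_1)
  finally show ?thesis by simp
qed

text \<open>Off truncation \<open>power_le_fact_exp\<close> applies to the sum of the absolute entry
  products; on truncation the overlap is at most \<open>n\<close>.\<close>

lemma overlap_moment_bound:
  assumes n: "0 < n" "k \<le> n" "2 * (real k)\<^sup>2 \<le> real n" and p: "0 < p"
  shows "overlap_moment n k p \<le> fact (3 * p) * (4 * (real k)\<^sup>2 / real n) + 2 * real n ^ (3 * p) * truncation_prob n k"
proof -
  let ?R = "entry_vec n k"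
  note R = finite_support_entry_vec[of n k]
  note int = integrable_measure_pmf_finite[OF R]
  have pointwise: "\<bar>overlap n (truncate_vec n k u) (truncate_vec n k u')\<bar> ^ (3 * p) \<le>
      fact (3 * p) * (exp (\<Sum>i<n. \<bar>u i * u' i\<bar>) - 1) + real n ^ (3 * p) * (of_bool (truncated n k u) + of_bool (truncated n k u'))"
    if u: "u \<in> set_pmf ?R" "u' \<in> set_pmf ?R" for u u'
  proof (cases "truncated n k u \<or> truncated n k u'")
    case True
    have "\<bar>overlap n (truncate_vec n k u) (truncate_vec n k u')\<bar> ^ (3 * p) \<le> real n ^ (3 * p)"
      using u by (intro power_mono abs_overlap_le truncate_vec_values) auto
    moreover have "0 \<le> fact (3 * p) * (exp (\<Sum>i<n. \<bar>u i * u' i\<bar>) - 1)"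
      by (simp add: sum_nonneg)
    moreover have "real n ^ (3 * p) \<le> real n ^ (3 * p) * (of_bool (truncated n k u) + of_bool (truncated n k u'))"
      using True by auto
    ultimately show ?thesis by linarith
  next
    case False
    have "\<bar>overlap n u u'\<bar> ^ (3 * p) \<le> (\<Sum>i<n. \<bar>u i * u' i\<bar>) ^ (3 * p)"
      unfolding overlap_def by (intro power_mono sum_abs) auto
    also have "\<dots> \<le> fact (3 * p) * (exp (\<Sum>i<n. \<bar>u i * u' i\<bar>) - 1)"
      using p by (intro power_le_fact_exp sum_nonneg) auto
    finally show ?thesis using False by (simp add: truncate_vec_eq)
  qed
  have "overlap_moment n k p = measure_pmf.expectation ?R (\<lambda>u. measure_pmf.expectation ?R
      (\<lambda>u'. \<bar>overlap n (truncate_vec n k u) (truncate_vec n k u')\<bar> ^ (3 * p)))"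
    unfolding overlap_moment_def expectation_truncated_prior tensor_inner_cube by (simp add: power_abs power_mult)
  also have "\<dots> \<le> measure_pmf.expectation ?R (\<lambda>u. measure_pmf.expectation ?R (\<lambda>u'.
      fact (3 * p) * (exp (\<Sum>i<n. \<bar>u i * u' i\<bar>) - 1) + real n ^ (3 * p) * (of_bool (truncated n k u) + of_bool (truncated n k u'))))"
    by (intro expectation_mono_finite R pointwise)
  also have "\<dots> = fact (3 * p) * (measure_pmf.expectation ?R (\<lambda>u. measure_pmf.expectation ?R (\<lambda>u'. exp (\<Sum>i<n. \<bar>u i * u' i\<bar>))) - 1) +
      real n ^ (3 * p) * measure_pmf.expectation ?R (\<lambda>u. measure_pmf.expectation ?R (\<lambda>u'. of_bool (truncated n k u) + of_bool (truncated n k u')))"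
    by (simp add: int)
  also have "\<dots> \<le> fact (3 * p) * (1 + 4 * (real k)\<^sup>2 / real n - 1) + real n ^ (3 * p) * (2 * truncation_prob n k)"
    unfolding truncation_prob_pair using expectation_exp_overlap[OF n]
    by (intro add_mono mult_left_mono diff_right_mono) auto
  finally show ?thesis by simp
qed

text \<open>The replacement vector has exactly \<open>k\<close> nonzero entries and so lies in the
  window as well; the norm bounds hold surely.\<close>

lemma truncated_sq_norm:
  assumes "k \<le> n" and "truncate_vec n k u = v" and "\<And>i. u i \<in> {- 1, 0, 1}"
  shows "overlap n v v \<in> {real k / 2 .. 2 * real k}"
proof -
  have sq: "overlap n w w = real (l0_norm n w)" if "\<And>i. w i \<in> {- 1, 0, 1}" for w
  proof -
    have "overlap n w w = (\<Sum>i<n. if w i \<noteq> 0 then 1 else 0)"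
      unfolding overlap_def
    proof (intro sum.cong refl)
      fix i show "w i * w i = (if w i \<noteq> 0 then 1 else 0)" using that[of i] by auto
    qed
    also have "\<dots> = (\<Sum>i\<in>{i \<in> {..<n}. w i \<noteq> 0}. 1)"
      by (rule sum.inter_filter[symmetric]) simp
    also have "\<dots> = real (l0_norm n w)" by (simp add: l0_norm_def)
    finally show ?thesis .
  qed
  show ?thesis
  proof (cases "truncated n k u")
    case True
    then have v: "v = indicat_real {..<k}" using assms(2) by (auto simp: truncate_vec_def truncated_def)
    have "{i \<in> {..<n}. v i \<noteq> 0} = {..<k}" using assms(1) by (auto simp: v indicator_def)
    then have "l0_norm n v = k" by (simp add: l0_norm_def)
    moreover have "v i \<in> {- 1, 0, 1}" for i by (auto simp: v indicator_def)
    ultimately show ?thesis using sq[of v] by simp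
  next
    case False
    then have "v = u" using truncate_vec_eq assms(2) by auto
    then show ?thesis using sq[OF assms(3)] False by (simp add: truncated_def)
  qed
qed

lemma sq_norm_prior:
  assumes "k \<le> n" and "x \<in> set_pmf (truncated_prior n k)"
  shows "(\<Sum>j\<in>tensor_idx n. (x j)\<^sup>2) \<in> {(real k / 2) ^ 3 .. (2 * real k) ^ 3}" and "\<And>j. x j \<in> {- 1, 0, 1}"
proof -
  obtain u where u: "u \<in> set_pmf (entry_vec n k)" and x: "x = tensor_cube (truncate_vec n k u)"
    using assms(2) by (auto simp: truncated_prior_def)
  have eq: "(\<Sum>j\<in>tensor_idx n. (x j)\<^sup>2) = overlap n (truncate_vec n k u) (truncate_vec n k u) ^ 3"
    using tensor_inner_cube[of n "truncate_vec n k u" "truncate_vec n k u"]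
    by (simp add: x tensor_inner_def power2_eq_square)
  have "overlap n (truncate_vec n k u) (truncate_vec n k u) \<in> {real k / 2 .. 2 * real k}"
    by (rule truncated_sq_norm[OF assms(1) refl]) (rule entry_vec_values[OF u])
  then show "(\<Sum>j\<in>tensor_idx n. (x j)\<^sup>2) \<in> {(real k / 2) ^ 3 .. (2 * real k) ^ 3}"
    unfolding eq atLeastAtMost_iff by (intro conjI power_mono) auto
  have mult: "y * z \<in> {- 1, 0, 1}" if "y \<in> {- 1, 0, 1}" "z \<in> {- 1, 0, 1}" for y z :: real
    using that by auto
  fix j show "x j \<in> {- 1, 0, 1}"
    unfolding x tensor_cube_def prod.case_eq_if by (intro mult truncate_vec_values[OF u])
qed

text \<open>The squared norm of the mean is the expected overlap of two independent signals.\<close>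

lemma trivial_mmse_lower:
  assumes "k \<le> n"
  shows "(real k / 2) ^ 3 - overlap_moment n k 1 \<le> trivial_mmse n k"
proof -
  let ?P = "truncated_prior n k"
  note P = finite_support_prior[of n k]
  have "(real k / 2) ^ 3 = measure_pmf.expectation ?P (\<lambda>_. (real k / 2) ^ 3)" by simp
  also have "\<dots> \<le> measure_pmf.expectation ?P (\<lambda>x. \<Sum>j\<in>tensor_idx n. (x j)\<^sup>2)"
    using sq_norm_prior(1)[OF assms] by (intro expectation_mono_finite P) auto
  finally have "(real k / 2) ^ 3 \<le> measure_pmf.expectation ?P (\<lambda>x. \<Sum>j\<in>tensor_idx n. (x j)\<^sup>2)" .
  moreover have "(\<Sum>j\<in>tensor_idx n. (measure_pmf.expectation ?P (\<lambda>x. x j))\<^sup>2) \<le> overlap_moment n k 1"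
  proof -
    have "(\<Sum>j\<in>tensor_idx n. (measure_pmf.expectation ?P (\<lambda>x. x j))\<^sup>2) =
        measure_pmf.expectation ?P (\<lambda>x. measure_pmf.expectation ?P (\<lambda>x'. tensor_inner n x x'))"
      unfolding tensor_inner_def expectation_sum_finite[OF P] by (simp add: power2_eq_square)
    also have "\<dots> \<le> overlap_moment n k 1"
      unfolding overlap_moment_def by (intro expectation_mono_finite P) auto
    finally show ?thesis .
  qed
  ultimately show ?thesis unfolding trivial_mmse_def by linarith
qed

section \<open>The annealed potential\<close>

definition overlap_prob :: "nat \<Rightarrow> nat \<Rightarrow> nat \<Rightarrow> real" where
  "overlap_prob n k s = measure_pmf.expectation (entry_vec n k) (\<lambda>u. measure_pmf.expectation (entry_vec n k)
     (\<lambda>u'. of_bool (overlap n (truncate_vec n k u) (truncate_vec n k u') = real s)))"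

lemma overlap_prob_nonneg: "0 \<le> overlap_prob n k s"
  unfolding overlap_prob_def by (intro integral_nonneg_AE AE_I2) auto

lemma cube_eq_of_nat_iff:
  fixes x :: real
  shows "x ^ 3 = real (s ^ 3) \<longleftrightarrow> x = real s"
proof (cases "x < 0")
  case True
  then have "x ^ 3 < 0" by (simp add: power_less_zero_eq)
  then show ?thesis using True by (metis not_less of_nat_0_le_iff)
next
  case False
  then show ?thesis using power_eq_imp_eq_base[of x 3 "real s"] by auto
qed

text \<open>The exponential weight is constant on the event, and cubing is injective, so the event
  concerns the overlap of the vectors.\<close>

lemma fp_potential_eq:
  "fp_potential n k lam (real (s ^ 3)) =
    (if overlap_prob n k s = 0 then \<infinity> else ereal (- lam * real (s ^ 3) - ln (overlap_prob n k s)))"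
proof -
  note P = finite_support_prior[of n k]
  define w where "w = measure_pmf.expectation (pair_pmf (truncated_prior n k) (truncated_prior n k))
                (\<lambda>(x, x'). indicat_real {real (s ^ 3)} (tensor_inner n x x') * exp (lam * tensor_inner n x x'))"
  have "w = measure_pmf.expectation (entry_vec n k) (\<lambda>u. measure_pmf.expectation (entry_vec n k)
     (\<lambda>u'. exp (lam * real (s ^ 3)) * of_bool (overlap n (truncate_vec n k u) (truncate_vec n k u') = real s)))"
    unfolding w_def expectation_pair_finite[OF P P] prod.case expectation_truncated_prior tensor_inner_cube
    by (intro arg_cong[where f = "measure_pmf.expectation _"] ext)
       (auto simp: indicator_def cube_eq_of_nat_iff simp del: of_nat_power)
  also have "\<dots> = exp (lam * real (s ^ 3)) * overlap_prob n k s"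
    unfolding overlap_prob_def expectation_cmult ..
  finally have w: "w = exp (lam * real (s ^ 3)) * overlap_prob n k s" .
  have "ln w = lam * real (s ^ 3) + ln (overlap_prob n k s)" if "overlap_prob n k s \<noteq> 0"
    using that overlap_prob_nonneg[of n k s] unfolding w by (subst ln_mult) auto
  then show ?thesis
    unfolding fp_potential_def w_def[symmetric] Let_def using w by (auto simp: algebra_simps)
qed

text \<open>The gain is kept inside the logarithm, so that the sign is decided by comparing the
  probability at \<open>s\<close> with the weighted one at \<open>s + 2\<close>.\<close>

lemma fp_discrete_deriv_eq:
  assumes "0 < overlap_prob n k s" and "0 < overlap_prob n k (s + 2)"
  shows "fp_discrete_deriv n k lam s =
    ereal ((ln (overlap_prob n k s) - ln (overlap_prob n k (s + 2) * exp (lam * (real ((s + 2) ^ 3) - real (s ^ 3)))))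
      / (real ((s + 2) ^ 3) - real (s ^ 3)))"
proof -
  have "ln (overlap_prob n k (s + 2) * exp (lam * (real ((s + 2) ^ 3) - real (s ^ 3)))) =
      ln (overlap_prob n k (s + 2)) + lam * (real ((s + 2) ^ 3) - real (s ^ 3))"
    using assms by (subst ln_mult) auto
  moreover have "real ((s + 2) ^ 3) - real (s ^ 3) \<noteq> 0"
    by (metis add_cancel_right_right cube_eq_of_nat_iff eq_iff_diff_eq_0 of_nat_eq_iff of_nat_power zero_neq_numeral)
  ultimately show ?thesis
    using assms unfolding fp_discrete_deriv_def fp_potential_eq
    by (simp add: algebra_simps del: of_nat_power)
qed

text \<open>The increment is 6 s^2 + 12 s + 8, smallest at s = 0.\<close>

lemma cube_step_ge: "8 \<le> real ((s + 2) ^ 3) - real (s ^ 3)"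
  by (simp add: power3_eq_cube algebra_simps)

lemma fp_discrete_deriv_pos:
  assumes "0 < overlap_prob n k (s + 2)"
    and "overlap_prob n k (s + 2) * exp (lam * (real ((s + 2) ^ 3) - real (s ^ 3))) < overlap_prob n k s"
  shows "fp_potential n k lam (real (s ^ 3)) < \<infinity> \<and> 0 < fp_discrete_deriv n k lam s"
proof -
  have pos: "0 < overlap_prob n k (s + 2) * exp (lam * (real ((s + 2) ^ 3) - real (s ^ 3)))" using assms(1) by simp
  then have ps: "0 < overlap_prob n k s" using assms(2) by linarith
  have "0 < (ln (overlap_prob n k s) - ln (overlap_prob n k (s + 2) * exp (lam * (real ((s + 2) ^ 3) - real (s ^ 3)))))
      / (real ((s + 2) ^ 3) - real (s ^ 3))"
    using cube_step_ge[of s] assms pos ps by (intro divide_pos_pos) auto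
  then show ?thesis unfolding fp_discrete_deriv_eq[OF ps assms(1)] fp_potential_eq using ps
    by (simp del: of_nat_power)
qed

lemma fp_discrete_deriv_neg:
  assumes "0 < overlap_prob n k s"
    and "overlap_prob n k s < overlap_prob n k (s + 2) * exp (lam * (real ((s + 2) ^ 3) - real (s ^ 3)))"
  shows "fp_potential n k lam (real (s ^ 3)) < \<infinity> \<and> fp_discrete_deriv n k lam s < 0"
proof -
  have pos: "0 < overlap_prob n k (s + 2) * exp (lam * (real ((s + 2) ^ 3) - real (s ^ 3)))" using assms by linarith
  then have ps: "0 < overlap_prob n k (s + 2)" by (simp add: zero_less_mult_iff)
  have "(ln (overlap_prob n k s) - ln (overlap_prob n k (s + 2) * exp (lam * (real ((s + 2) ^ 3) - real (s ^ 3)))))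
      / (real ((s + 2) ^ 3) - real (s ^ 3)) < 0"
    using cube_step_ge[of s] assms pos by (intro divide_neg_pos) auto
  then show ?thesis unfolding fp_discrete_deriv_eq[OF assms(1) ps] fp_potential_eq using assms(1)
    by (simp del: of_nat_power)
qed

section \<open>Two-sided bounds for overlap probabilities\<close>

definition raw_overlap_prob :: "nat \<Rightarrow> nat \<Rightarrow> nat \<Rightarrow> real" where
  "raw_overlap_prob n k s = measure_pmf.expectation (entry_vec n k) (\<lambda>u. measure_pmf.expectation (entry_vec n k)
     (\<lambda>u'. of_bool (overlap n u u' = real s)))"

text \<open>A coupling: the two events agree unless one of the two vectors is truncated.\<close>

lemma overlap_prob_truncation:
  "\<bar>overlap_prob n k s - raw_overlap_prob n k s\<bar> \<le> 2 * truncation_prob n k"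
proof -
  note R = finite_support_entry_vec[of n k]
  have 1: "overlap_prob n k s \<le> raw_overlap_prob n k s + 2 * truncation_prob n k"
  proof -
    have "overlap_prob n k s \<le> measure_pmf.expectation (entry_vec n k) (\<lambda>u. measure_pmf.expectation (entry_vec n k)
       (\<lambda>u'. of_bool (overlap n u u' = real s) + (of_bool (truncated n k u) + of_bool (truncated n k u'))))"
      unfolding overlap_prob_def
      by (intro expectation_mono_finite R) (auto simp: of_bool_def truncate_vec_eq)
    also have "\<dots> = raw_overlap_prob n k s + 2 * truncation_prob n k"
      unfolding raw_overlap_prob_def truncation_prob_pair[symmetric]
      by (simp add: integrable_measure_pmf_finite[OF R] del: of_bool_eq)
    finally show ?thesis .
  qed
  have 2: "raw_overlap_prob n k s \<le> overlap_prob n k s + 2 * truncation_prob n k"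
  proof -
    have "raw_overlap_prob n k s \<le> measure_pmf.expectation (entry_vec n k) (\<lambda>u. measure_pmf.expectation (entry_vec n k)
       (\<lambda>u'. of_bool (overlap n (truncate_vec n k u) (truncate_vec n k u') = real s) + (of_bool (truncated n k u) + of_bool (truncated n k u'))))"
      unfolding raw_overlap_prob_def
      by (intro expectation_mono_finite R) (auto simp: of_bool_def truncate_vec_eq)
    also have "\<dots> = overlap_prob n k s + 2 * truncation_prob n k"
      unfolding overlap_prob_def truncation_prob_pair[symmetric]
      by (simp add: integrable_measure_pmf_finite[OF R] del: of_bool_eq)
    finally show ?thesis .
  qed
  show ?thesis using 1 2 by linarith
qed

text \<open>The parameter \<open>a\<close> weighs coordinates outside \<open>A\<close> with nonzero
  product: \<open>a = 1\<close> imposes nothing there and serves the upper bound,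
  \<open>a = 0\<close> forbids them and serves the lower bound.\<close>

lemma expectation_support_pattern:
  fixes a b :: real
  assumes "k \<le> n" and "A \<subseteq> {..<n}" and "0 \<le> a" and "a \<le> 1"
  shows "measure_pmf.expectation (entry_vec n k) (\<lambda>u. measure_pmf.expectation (entry_vec n k)
      (\<lambda>u'. \<Prod>i<n. if i \<in> A then of_bool (u i * u' i = 1) else if u i * u' i = 0 then 1 else a)) =
    agree_prob n k ^ card A * (1 - 2 * agree_prob n k * (1 - a)) ^ (n - card A)"
proof -
  have "measure_pmf.expectation (entry_vec n k) (\<lambda>u. measure_pmf.expectation (entry_vec n k)
      (\<lambda>u'. \<Prod>i<n. if i \<in> A then of_bool (u i * u' i = 1) else if u i * u' i = 0 then 1 else a)) =
     (\<Prod>i<n. if i \<in> A then agree_prob n k else 1 - 2 * agree_prob n k * (1 - a))"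
    using assms
    by (subst expectation_entry_vec_pair_prod[where
          f = "\<lambda>i x. if i \<in> A then of_bool (x = 1) else if x = 0 then 1 else a"])
       (auto intro!: prod.cong simp: algebra_simps)
  also have "\<dots> = agree_prob n k ^ card A * (1 - 2 * agree_prob n k * (1 - a)) ^ (n - card A)"
  proof -
    have "{..<n} \<inter> {i. i \<in> A} = A" "{..<n} \<inter> - {i. i \<in> A} = {..<n} - A" using assms by auto
    moreover have "card ({..<n} - A) = n - card A"
      using assms by (simp add: card_Diff_subset finite_subset)
    ultimately show ?thesis by (simp add: prod.If_cases)
  qed
  finally show ?thesis .
qed

lemma sum_patterns:
  fixes a :: real
  assumes "k \<le> n" and "0 \<le> a" and "a \<le> 1"
  shows "measure_pmf.expectation (entry_vec n k) (\<lambda>u. measure_pmf.expectation (entry_vec n k)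
      (\<lambda>u'. \<Sum>A | A \<subseteq> {..<n} \<and> card A = s.
        \<Prod>i<n. if i \<in> A then of_bool (u i * u' i = 1) else if u i * u' i = 0 then 1 else a)) =
    real (n choose s) * (agree_prob n k ^ s * (1 - 2 * agree_prob n k * (1 - a)) ^ (n - s))"
proof -
  note R = finite_support_entry_vec[of n k]
  show ?thesis
    unfolding expectation_sum_finite[OF R]
    using n_subsets[of "{..<n}" s] by (simp add: expectation_support_pattern[OF assms(1) _ assms(2,3)])
qed

lemma product_values:
  assumes "u \<in> set_pmf (entry_vec n k)" and "u' \<in> set_pmf (entry_vec n k)"
  shows "u i * u' i \<in> {- 1, 0, 1}"
  using entry_vec_values[OF assms(1), of i] entry_vec_values[OF assms(2), of i] by auto

text \<open>An overlap of \<open>s\<close> forces at least \<open>s\<close> coordinates with product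
  1; a union bound over sets of \<open>s\<close> coordinates follows.\<close>

lemma raw_overlap_prob_upper:
  assumes "k \<le> n"
  shows "raw_overlap_prob n k s \<le> real (n choose s) * agree_prob n k ^ s"
proof -
  note R = finite_support_entry_vec[of n k]
  have "of_bool (overlap n u u' = real s) \<le> (\<Sum>A | A \<subseteq> {..<n} \<and> card A = s.
        \<Prod>i<n. if i \<in> A then of_bool (u i * u' i = 1) else if u i * u' i = 0 then 1 else 1 :: real)"
    (is "_ \<le> sum ?g ?S")
    if u: "u \<in> set_pmf (entry_vec n k)" "u' \<in> set_pmf (entry_vec n k)" for u u'
  proof (cases "overlap n u u' = real s")
    case True
    let ?B = "{i \<in> {..<n}. u i * u' i = 1}"
    have "real s = (\<Sum>i<n. u i * u' i)" using True by (simp add: overlap_def)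
    also have "\<dots> \<le> (\<Sum>i\<in>{..<n}. if u i * u' i = 1 then 1 else 0)"
    proof (intro sum_mono)
      fix i show "u i * u' i \<le> (if u i * u' i = 1 then 1 else 0)" using product_values[OF u, of i] by auto
    qed
    also have "\<dots> = (\<Sum>i\<in>?B. 1)" by (rule sum.inter_filter[symmetric]) simp
    finally have "s \<le> card ?B" by simp
    then obtain A where A: "A \<subseteq> ?B" "card A = s" "finite A"
      by (rule obtain_subset_with_card_n)
    have finS: "finite ?S" by (rule finite_subset[of _ "Pow {..<n}"]) auto
    have "?g A = 1" using A(1) by (intro prod.neutral) auto
    moreover have "?g A \<le> sum ?g ?S"
    proof (rule member_le_sum[OF _ _ finS])
      show "A \<in> ?S" using A by auto
      show "0 \<le> ?g B" for B by (intro prod_nonneg) auto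
    qed
    ultimately have "1 \<le> sum ?g ?S" by (simp only:)
    then show ?thesis using True by simp
  qed (auto intro!: sum_nonneg prod_nonneg)
  then have "raw_overlap_prob n k s \<le> measure_pmf.expectation (entry_vec n k) (\<lambda>u. measure_pmf.expectation (entry_vec n k)
      (\<lambda>u'. \<Sum>A | A \<subseteq> {..<n} \<and> card A = s.
        \<Prod>i<n. if i \<in> A then of_bool (u i * u' i = 1) else if u i * u' i = 0 then 1 else 1))"
    unfolding raw_overlap_prob_def by (intro expectation_mono_finite R)
  also have "\<dots> = real (n choose s) * agree_prob n k ^ s"
    using sum_patterns[OF assms, of 1] by simp
  finally show ?thesis .
qed

text \<open>Only pairs with exactly \<open>s\<close> products equal to 1 and none equal to -1 are
  counted. For a given pair the pattern can occur for one set \<open>A\<close> only, so the sum over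
  \<open>A\<close> does not overcount.\<close>

lemma raw_overlap_prob_lower:
  assumes "k \<le> n"
  shows "real (n choose s) * (agree_prob n k ^ s * (1 - 2 * agree_prob n k) ^ (n - s)) \<le> raw_overlap_prob n k s"
proof -
  note R = finite_support_entry_vec[of n k]
  have "(\<Sum>A | A \<subseteq> {..<n} \<and> card A = s.
        \<Prod>i<n. if i \<in> A then of_bool (u i * u' i = 1) else if u i * u' i = 0 then 1 else 0 :: real) \<le>
      of_bool (overlap n u u' = real s)" (is "sum ?g ?S \<le> _") for u u'
  proof -
    let ?B = "{i \<in> {..<n}. u i * u' i = 1}"
    have g: "A = ?B \<and> (\<forall>i<n. i \<notin> A \<longrightarrow> u i * u' i = 0)" if "?g A \<noteq> 0" "A \<in> ?S" for A
    proof -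
      have nz: "\<forall>i\<in>{..<n}. (if i \<in> A then of_bool (u i * u' i = 1) else if u i * u' i = 0 then 1 else 0 :: real) \<noteq> 0"
        using that(1) unfolding prod_zero_iff[OF finite_lessThan] by blast
      have "(i \<in> A \<longrightarrow> u i * u' i = 1) \<and> (i \<notin> A \<longrightarrow> u i * u' i = 0)" if "i < n" for i
      proof -
        have "(if i \<in> A then of_bool (u i * u' i = 1) else if u i * u' i = 0 then 1 else 0 :: real) \<noteq> 0"
          using nz that by blast
        then show ?thesis by (cases "i \<in> A"; cases "u i * u' i = 1"; cases "u i * u' i = 0") simp_all
      qed
      then show ?thesis using that(2) by fastforce
    qed
    have "sum ?g ?S \<le> (\<Sum>A\<in>?S. if A = ?B then of_bool (overlap n u u' = real s) else 0)"
    proof (intro sum_mono)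
      fix A assume A: "A \<in> ?S"
      show "?g A \<le> (if A = ?B then of_bool (overlap n u u' = real s) else 0)"
      proof (cases "?g A = 0")
        case False
        note gA = g[OF False A]
        have "overlap n u u' = (\<Sum>i\<in>{..<n}. if i \<in> A then 1 else 0)"
          unfolding overlap_def using gA by (intro sum.cong) auto
        also have "\<dots> = (\<Sum>i\<in>{i \<in> {..<n}. i \<in> A}. 1)" by (rule sum.inter_filter[symmetric]) simp
        also have "{i \<in> {..<n}. i \<in> A} = A" using A by auto
        finally have "overlap n u u' = real s" using A by simp
        moreover have "?g A \<le> 1" by (intro prod_le_1) auto
        ultimately show ?thesis using gA by simp
      next
        case True
        show ?thesis unfolding True by simp
      qed
    qed
    also have "\<dots> \<le> of_bool (overlap n u u' = real s)" by (subst sum.delta) auto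
    finally show ?thesis .
  qed
  then have "measure_pmf.expectation (entry_vec n k) (\<lambda>u. measure_pmf.expectation (entry_vec n k)
      (\<lambda>u'. \<Sum>A | A \<subseteq> {..<n} \<and> card A = s.
        \<Prod>i<n. if i \<in> A then of_bool (u i * u' i = 1) else if u i * u' i = 0 then 1 else 0)) \<le> raw_overlap_prob n k s"
    unfolding raw_overlap_prob_def by (intro expectation_mono_finite R)
  then show ?thesis using sum_patterns[OF assms, of 0] by simp
qed

text \<open>Bernoulli's inequality with 2 r n = k^2 / n bounds the probability of no further nonzero
  product below by 1/2. Truncation shifts the value by at most a quarter of the main term, which
  leaves the constants 1/4 and 2.\<close>

lemma overlap_prob_bounds:
  assumes n: "0 < n" "k \<le> n" "4 * (real k)\<^sup>2 \<le> real n" and s: "s \<le> n"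
    and trunc: "8 * truncation_prob n k \<le> agree_prob n k ^ s"
  shows "real (n choose s) * agree_prob n k ^ s / 4 \<le> overlap_prob n k s"
    and "overlap_prob n k s \<le> 2 * (real (n choose s) * agree_prob n k ^ s)"
proof -
  define r where "r = agree_prob n k"
  define N where "N = real (n choose s) * r ^ s"
  have r: "0 \<le> r" "2 * r * real n = (real k)\<^sup>2 / real n"
    using n by (auto simp: r_def agree_prob_def power2_eq_square)
  have rn: "2 * r * real n \<le> 1 / 2" using n r by (simp add: divide_le_eq)
  have "r \<le> r * real n" using n r mult_left_mono[of 1 "real n" r] by simp
  then have r1: "2 * r \<le> 1" using rn by linarith
  have "1 \<le> real (n choose s)" using s by (simp add: Suc_leI)
  then have "r ^ s \<le> N" unfolding N_def using r mult_right_mono[of 1 "real (n choose s)" "r ^ s"] by simp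
  then have t: "2 * truncation_prob n k \<le> N / 4" using trunc by (simp add: r_def)
  have "1 + real n * (- 2 * r) \<le> (1 + (- 2 * r)) ^ n" using r1 by (intro Bernoulli_inequality) auto
  then have "1 / 2 \<le> (1 - 2 * r) ^ n" using rn by (simp add: algebra_simps)
  also have "\<dots> \<le> (1 - 2 * r) ^ (n - s)" using r r1 by (intro power_decreasing) auto
  finally have half: "1 / 2 \<le> (1 - 2 * r) ^ (n - s)" .
  have N0: "0 \<le> N" using r by (simp add: N_def)
  have "N * (1 / 2) \<le> N * (1 - 2 * r) ^ (n - s)" using half N0 by (intro mult_left_mono) auto
  also have "\<dots> \<le> raw_overlap_prob n k s"
    using raw_overlap_prob_lower[OF n(2), of s] by (simp add: N_def r_def mult.assoc)
  finally have lower: "N / 2 \<le> raw_overlap_prob n k s" by simp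
  have upper: "raw_overlap_prob n k s \<le> N"
    using raw_overlap_prob_upper[OF n(2), of s] by (simp add: N_def r_def)
  have diff: "\<bar>overlap_prob n k s - raw_overlap_prob n k s\<bar> \<le> N / 4"
    using overlap_prob_truncation[of n k s] t by linarith
  have "N / 4 \<le> overlap_prob n k s" "overlap_prob n k s \<le> 2 * N"
    using diff lower upper N0 by linarith+
  then show "real (n choose s) * agree_prob n k ^ s / 4 \<le> overlap_prob n k s"
    and "overlap_prob n k s \<le> 2 * (real (n choose s) * agree_prob n k ^ s)"
    by (simp_all add: N_def r_def)
qed

section \<open>The sign of the discrete derivative\<close>

lemma binomial_Suc_le: "n choose Suc s \<le> n * (n choose s)"
proof -
  have "n choose Suc s \<le> Suc s * (n choose Suc s)" by simp
  also have "\<dots> = n * ((n - 1) choose s)" by (rule binomial_absorption)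
  also have "\<dots> \<le> n * (n choose s)" by (intro mult_le_mono2 binomial_right_mono) simp
  finally show ?thesis .
qed

text \<open>Two further agreements multiply the main term by at most (r n)^2 \<le> 1/64. With the
  constant 2 and the gain at most 2 this gives N/16, still below the lower bound N/4 at
  \<open>s\<close>.\<close>

lemma fp_increasing_step:
  assumes n: "0 < n" "0 < k" "k \<le> n" "4 * (real k)\<^sup>2 \<le> real n" and s: "s + 2 \<le> n"
    and trunc: "8 * truncation_prob n k \<le> agree_prob n k ^ (s + 2)"
    and lam: "exp (lam * (real ((s + 2) ^ 3) - real (s ^ 3))) \<le> 2"
  shows "fp_potential n k lam (real (s ^ 3)) < \<infinity> \<and> 0 < fp_discrete_deriv n k lam s"
proof -
  define r where "r = agree_prob n k"
  have r: "0 < r" "r * real n = (real k)\<^sup>2 / real n / 2"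
    using n by (auto simp: r_def agree_prob_def power2_eq_square)
  have rn: "r * real n \<le> 1 / 8" using n r by (simp add: divide_le_eq)
  have "r \<le> r * real n" using n r mult_left_mono[of 1 "real n" r] by simp
  then have r1: "r \<le> 1" using rn by linarith
  have "r ^ (s + 2) \<le> r ^ s" using r r1 by (intro power_decreasing) auto
  then have trunc_s: "8 * truncation_prob n k \<le> agree_prob n k ^ s" using trunc by (simp add: r_def)
  define N where "N = real (n choose s) * r ^ s"
  have N0: "0 < N" using r s by (simp add: N_def)
  note lo = overlap_prob_bounds[OF n(1,3,4) _ trunc_s] and hi = overlap_prob_bounds[OF n(1,3,4) s trunc]
  have "real (n choose (s + 2)) * r ^ (s + 2) \<le> (real n * (real n * real (n choose s))) * r ^ (s + 2)"
  proof (intro mult_right_mono)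
    have "n choose (s + 2) \<le> n * (n choose Suc s)" using binomial_Suc_le[of n "Suc s"] by simp
    also have "\<dots> \<le> n * (n * (n choose s))" by (intro mult_le_mono2 binomial_Suc_le)
    finally show "real (n choose (s + 2)) \<le> real n * (real n * real (n choose s))"
      by (metis of_nat_le_iff of_nat_mult)
  qed (use r in auto)
  also have "\<dots> = N * (r * real n)\<^sup>2" by (simp add: N_def power_add power2_eq_square mult_ac)
  also have "\<dots> \<le> N * (1 / 8)\<^sup>2" using rn r N0 by (intro mult_left_mono power_mono) auto
  finally have N2: "real (n choose (s + 2)) * r ^ (s + 2) \<le> N / 64" by (simp add: power2_eq_square)
  have "0 < real (n choose (s + 2)) * r ^ (s + 2)" using r s by simp
  then have pos: "0 < overlap_prob n k (s + 2)" using hi(1) unfolding r_def by linarith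
  have "overlap_prob n k (s + 2) * exp (lam * (real ((s + 2) ^ 3) - real (s ^ 3))) \<le> (2 * (N / 64)) * 2"
    using hi(2) N2 lam N0 pos unfolding r_def by (intro mult_mono) auto
  also have "\<dots> < N / 4" using N0 by simp
  also have "\<dots> \<le> overlap_prob n k s" using lo(1) s by (simp add: N_def r_def)
  finally show ?thesis using pos by (intro fp_discrete_deriv_pos)
qed

text \<open>Two further agreements cost \<open>r ^ 2\<close> only, since binomials increase up to
  the middle. The threshold 8 is the quotient of the constants 2 and 1/4 in
  \<open>overlap_prob_bounds\<close>; the 8 in the exponent is the least cube increment.\<close>

lemma fp_decreasing_step:
  assumes n: "0 < n" "0 < k" "k \<le> n" "4 * (real k)\<^sup>2 \<le> real n" and s: "2 * (s + 2) \<le> n"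
    and trunc: "8 * truncation_prob n k \<le> agree_prob n k ^ (s + 2)"
    and lam: "0 \<le> lam" "8 < exp (8 * lam) * (agree_prob n k)\<^sup>2"
  shows "fp_potential n k lam (real (s ^ 3)) < \<infinity> \<and> fp_discrete_deriv n k lam s < 0"
proof -
  define r where "r = agree_prob n k"
  have r: "0 < r" "r * real n = (real k)\<^sup>2 / real n / 2"
    using n by (auto simp: r_def agree_prob_def power2_eq_square)
  have rn: "r * real n \<le> 1 / 8" using n r by (simp add: divide_le_eq)
  have "r \<le> r * real n" using n r mult_left_mono[of 1 "real n" r] by simp
  then have r1: "r \<le> 1" using rn by linarith
  have "r ^ (s + 2) \<le> r ^ s" using r r1 by (intro power_decreasing) auto
  then have trunc_s: "8 * truncation_prob n k \<le> agree_prob n k ^ s" using trunc by (simp add: r_def)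
  define N where "N = real (n choose s) * r ^ s"
  have N0: "0 < N" using r s by (simp add: N_def)
  note lo = overlap_prob_bounds[OF n(1,3,4) _ trunc_s] and hi = overlap_prob_bounds[OF n(1,3,4) _ trunc]
  have "N * r\<^sup>2 = real (n choose s) * r ^ (s + 2)" by (simp add: N_def power_add power2_eq_square)
  also have "\<dots> \<le> real (n choose (s + 2)) * r ^ (s + 2)"
    using r s by (intro mult_right_mono of_nat_mono binomial_mono) auto
  finally have N2: "N * r\<^sup>2 / 4 \<le> overlap_prob n k (s + 2)" using hi(1) s by (simp add: r_def)
  have "s \<le> n" using s by simp
  from lo(1)[OF this] have pos: "0 < overlap_prob n k s" using N0 unfolding N_def r_def by linarith
  have "overlap_prob n k s \<le> 2 * N" using lo(2) s by (simp add: N_def r_def)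
  also have "\<dots> < N * (exp (8 * lam) * r\<^sup>2) / 4" using lam(2) N0 by (simp add: r_def)
  also have "\<dots> = (N * r\<^sup>2 / 4) * exp (8 * lam)" by simp
  also have "\<dots> \<le> overlap_prob n k (s + 2) * exp (lam * (real ((s + 2) ^ 3) - real (s ^ 3)))"
  proof (rule mult_mono[OF N2])
    have "8 * lam \<le> lam * (real ((s + 2) ^ 3) - real (s ^ 3))"
      using mult_left_mono[OF cube_step_ge[of s] lam(1)] by (simp only: mult.commute)
    then show "exp (8 * lam) \<le> exp (lam * (real ((s + 2) ^ 3) - real (s ^ 3)))"
      by (rule iffD2[OF exp_le_cancel_iff])
  qed (auto intro: overlap_prob_nonneg)
  finally show ?thesis using pos by (intro fp_discrete_deriv_neg)
qed

section \<open>The entrywise power estimator\<close>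

lemma gauss_component:
  fixes \<phi> :: "real \<Rightarrow> real"
  assumes J: "finite J" "i \<in> J" and \<phi>: "has_bochner_integral std_normal_distribution \<phi> c"
  shows "has_bochner_integral (gauss J) (\<lambda>z. \<phi> (z i)) c"
proof -
  interpret prob_space std_normal_distribution by (rule std_normal_prob_space)
  have one: "has_bochner_integral std_normal_distribution (\<lambda>_. 1::real) 1"
    by (simp add: has_bochner_integral_iff prob_space del: space_density)
  have "has_bochner_integral (gauss J) (\<lambda>z. \<Prod>j\<in>J. (if j = i then \<phi> else (\<lambda>_. 1)) (z j))
      (\<Prod>j\<in>J. if j = i then c else 1)"
    using \<phi> one by (intro gauss_prod J) auto
  moreover have "(\<Prod>j\<in>J. (if j = i then \<phi> else (\<lambda>_. 1)) (z j)) = (\<Prod>j\<in>J. if j = i then \<phi> (z j) else 1)" for z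
    by (intro prod.cong) auto
  ultimately show ?thesis using J by simp
qed

text \<open>The moment is (2d)! / (2^d d!), and (2d)! / d! is at most (2d)^d.\<close>

lemma std_normal_even_moment_le:
  assumes "0 < lam"
  shows "\<exists>c. has_bochner_integral std_normal_distribution (\<lambda>z. z ^ (2 * d) / lam ^ d) c \<and> c \<le> (real d / lam) ^ d"
proof (intro exI conjI)
  have "has_bochner_integral std_normal_distribution (\<lambda>z. z ^ (2 * d)) (fact (2 * d) / (2 ^ d * fact d))"
    by (subst integral_std_normal) (auto intro: std_normal_moment_even)
  then show "has_bochner_integral std_normal_distribution (\<lambda>z. z ^ (2 * d) / lam ^ d)
      (fact (2 * d) / (2 ^ d * fact d) / lam ^ d)"
    by (rule has_bochner_integral_divide_zero)
  have "fact (2 * d) div fact (2 * d - d) \<le> (2 * d) ^ d" by (rule fact_div_fact_le_pow) simp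
  then have "real (fact (2 * d) div fact d) \<le> real ((2 * d) ^ d)" by (simp only: of_nat_le_iff) simp
  moreover have "real (fact (2 * d) div fact d) = fact (2 * d) / fact d"
    by (subst real_of_nat_div) (auto intro: fact_dvd)
  ultimately have "fact (2 * d) / fact d \<le> (2 * real d) ^ d" by simp
  then have "fact (2 * d) / (2 ^ d * fact d) \<le> real d ^ d"
    by (simp add: field_simps power_mult_distrib)
  then show "fact (2 * d) / (2 ^ d * fact d) / lam ^ d \<le> (real d / lam) ^ d"
    unfolding power_divide using assms by (intro divide_right_mono) auto
qed

text \<open>\<open>exp \<bar>z\<bar>\<close> is at most exp z + exp (-z), that is, up to a constant,
  a sum of two tilts of a square.\<close>

lemma integrable_sq_exp_abs: "integrable std_normal_distribution (\<lambda>z. z\<^sup>2 * exp \<bar>z\<bar>)"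
proof (rule Bochner_Integration.integrable_bound)
  have "integrable std_normal_distribution (\<lambda>z. z\<^sup>2 * exp (m * z - m\<^sup>2 / 2))" for m
    using std_normal_shift[OF _ has_bochner_integral_integrable[OF integrable_std_normal_power[of m 2]]]
    by (auto simp: has_bochner_integral_iff)
  from this[of 1] this[of "- 1"]
  show "integrable std_normal_distribution (\<lambda>z. exp (1 / 2) * (z\<^sup>2 * exp (1 * z - 1\<^sup>2 / 2)) + exp (1 / 2) * (z\<^sup>2 * exp ((- 1) * z - (- 1)\<^sup>2 / 2)))"
    by (intro Bochner_Integration.integrable_add integrable_mult_right)
  have "norm (z\<^sup>2 * exp \<bar>z\<bar>) \<le> norm (exp (1 / 2) * (z\<^sup>2 * exp (1 * z - 1\<^sup>2 / 2)) + exp (1 / 2) * (z\<^sup>2 * exp ((- 1) * z - (- 1)\<^sup>2 / 2)))" for z :: real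
  proof -
    have "exp (1 / 2) * exp (m * z - m\<^sup>2 / 2) = exp (m * z)" if "m\<^sup>2 = 1" for m
      using that by (simp flip: exp_add)
    from this[of 1] this[of "- 1"]
    have "exp (1 / 2) * (z\<^sup>2 * exp (1 * z - 1\<^sup>2 / 2)) + exp (1 / 2) * (z\<^sup>2 * exp ((- 1) * z - (- 1)\<^sup>2 / 2)) =
        z\<^sup>2 * (exp z + exp (- z))"
      by (simp add: distrib_left mult.left_commute[of "exp (1 / 2)"])
    moreover have "exp \<bar>z\<bar> \<le> exp z + exp (- z)" by (cases "0 \<le> z") auto
    ultimately show ?thesis by (simp add: mult_left_mono)
  qed
  then show "AE z in std_normal_distribution. norm (z\<^sup>2 * exp \<bar>z\<bar>) \<le>
     norm (exp (1 / 2) * (z\<^sup>2 * exp (1 * z - 1\<^sup>2 / 2)) + exp (1 / 2) * (z\<^sup>2 * exp ((- 1) * z - (- 1)\<^sup>2 / 2)))"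
    by (rule AE_I2)
qed measurable

lemma power_perturbation:
  fixes x w :: real
  assumes "\<bar>x\<bar> = 1"
  shows "\<bar>(x + w) ^ d - x ^ d\<bar> \<le> real d * \<bar>w\<bar> * (1 + \<bar>w\<bar>) ^ d"
proof (induction d)
  case (Suc d)
  have "(x + w) ^ Suc d - x ^ Suc d = (x + w) * ((x + w) ^ d - x ^ d) + w * x ^ d"
    by (simp add: algebra_simps)
  then have "\<bar>(x + w) ^ Suc d - x ^ Suc d\<bar> \<le> \<bar>x + w\<bar> * \<bar>(x + w) ^ d - x ^ d\<bar> + \<bar>w\<bar> * \<bar>x\<bar> ^ d"
    by (metis abs_mult abs_triangle_ineq power_abs)
  also have "\<dots> \<le> (1 + \<bar>w\<bar>) * (real d * \<bar>w\<bar> * (1 + \<bar>w\<bar>) ^ d) + \<bar>w\<bar> * (1 + \<bar>w\<bar>) ^ Suc d"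
  proof (intro add_mono mult_mono Suc)
    show "\<bar>x + w\<bar> \<le> 1 + \<bar>w\<bar>" using assms by linarith
    show "\<bar>x\<bar> ^ d \<le> (1 + \<bar>w\<bar>) ^ Suc d" unfolding assms by (simp only: power_one) (intro one_le_power, simp)
  qed auto
  also have "\<dots> = real (Suc d) * \<bar>w\<bar> * (1 + \<bar>w\<bar>) ^ Suc d" by (simp add: algebra_simps)
  finally show ?case .
qed simp

text \<open>If \<open>x = 0\<close>, the estimator is a pure noise power. Otherwise
  \<open>x ^ d = x\<close> because \<open>d\<close> is odd, and the error is a perturbation of size
  \<open>z / sqrt lam\<close> raised to the power \<open>d\<close>. The condition
  \<open>2 * real d \<le> sqrt lam\<close> bounds its growth by \<open>exp \<bar>z\<bar>\<close>, so
  \<open>K\<close> depends on neither \<open>d\<close> nor \<open>lam\<close>.\<close>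

lemma power_estimator_error:
  fixes x lam :: real
  assumes x: "x \<in> {- 1, 0, 1}" and d: "odd d" and lam: "0 < lam" "2 * real d \<le> sqrt lam"
    and J: "finite J" "i \<in> J" and K: "K = (\<integral>z. z\<^sup>2 * exp \<bar>z\<bar> \<partial>std_normal_distribution)"
  shows "(\<integral>z. (1 / sqrt lam ^ d * (sqrt lam * x + z i) ^ d - x)\<^sup>2 \<partial>gauss J) \<le>
    (real d / lam) ^ d + x\<^sup>2 * (K * (real d)\<^sup>2 / lam)"
proof (cases "x = 0")
  case True
  obtain c where c: "has_bochner_integral std_normal_distribution (\<lambda>z. z ^ (2 * d) / lam ^ d) c" "c \<le> (real d / lam) ^ d"
    using std_normal_even_moment_le[OF lam(1)] by blast
  have "(1 / sqrt lam ^ d * (sqrt lam * x + y) ^ d - x)\<^sup>2 = y ^ (2 * d) / lam ^ d" for y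
  proof -
    have "(sqrt lam ^ d)\<^sup>2 = lam ^ d"
      using lam by (simp flip: power_mult add: mult.commute[of d]) (simp add: power_mult)
    then show ?thesis using True by (simp add: power_divide power_mult mult.commute[of 2])
  qed
  then show ?thesis
    using gauss_component[OF J c(1)] c(2) True by (simp add: has_bochner_integral_iff)
next
  case False
  then have x1: "\<bar>x\<bar> = 1" "x\<^sup>2 = 1" using x by auto
  have xd: "x ^ d = x" using x d False by auto
  have int: "has_bochner_integral (gauss J) (\<lambda>z. (real d)\<^sup>2 / lam * ((z i)\<^sup>2 * exp \<bar>z i\<bar>)) ((real d)\<^sup>2 / lam * K)"
    unfolding K by (intro has_bochner_integral_mult_right gauss_component[OF J, where \<phi> = "\<lambda>z. z\<^sup>2 * exp \<bar>z\<bar>"]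
        has_bochner_integral_integrable integrable_sq_exp_abs)
  have "(1 / sqrt lam ^ d * (sqrt lam * x + y) ^ d - x)\<^sup>2 \<le> (real d)\<^sup>2 / lam * (y\<^sup>2 * exp \<bar>y\<bar>)" for y
  proof -
    define w where "w = y / sqrt lam"
    have "1 / sqrt lam ^ d * (sqrt lam * x + y) ^ d = (x + w) ^ d"
      using lam by (simp add: w_def power_divide[symmetric] add_divide_distrib)
    then have "(1 / sqrt lam ^ d * (sqrt lam * x + y) ^ d - x)\<^sup>2 = \<bar>(x + w) ^ d - x ^ d\<bar>\<^sup>2"
      by (simp add: xd)
    also have "\<dots> \<le> (real d * \<bar>w\<bar> * (1 + \<bar>w\<bar>) ^ d)\<^sup>2"
      by (intro power_mono power_perturbation x1) simp
    also have "\<dots> \<le> (real d * \<bar>w\<bar> * exp \<bar>w\<bar> ^ d)\<^sup>2"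
      by (intro power_mono mult_left_mono exp_ge_add_one_self) auto
    also have "\<dots> = (real d)\<^sup>2 / lam * (y\<^sup>2 * exp (2 * real d * \<bar>w\<bar>))"
      using lam by (simp add: power_mult_distrib w_def power_divide exp_double flip: exp_of_nat_mult)
    also have "\<dots> \<le> (real d)\<^sup>2 / lam * (y\<^sup>2 * exp \<bar>y\<bar>)"
    proof (intro mult_left_mono iffD2[OF exp_le_cancel_iff])
      have "2 * real d * \<bar>w\<bar> \<le> sqrt lam * \<bar>w\<bar>" using lam by (intro mult_right_mono) auto
      also have "\<dots> = \<bar>y\<bar>" using lam by (simp add: w_def)
      finally show "2 * real d * \<bar>w\<bar> \<le> \<bar>y\<bar>" .
    qed (use lam in auto)
    finally show ?thesis .
  qed
  then have "(\<integral>z. (1 / sqrt lam ^ d * (sqrt lam * x + z i) ^ d - x)\<^sup>2 \<partial>gauss J) \<le>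
      (\<integral>z. (real d)\<^sup>2 / lam * ((z i)\<^sup>2 * exp \<bar>z i\<bar>) \<partial>gauss J)"
    using int lam by (intro integral_mono_AE' AE_I2) (auto simp: has_bochner_integral_iff intro!: divide_nonneg_pos)
  also have "\<dots> = x\<^sup>2 * (K * (real d)\<^sup>2 / lam)"
    using int x1 by (simp add: has_bochner_integral_iff)
  also have "\<dots> \<le> (real d / lam) ^ d + x\<^sup>2 * (K * (real d)\<^sup>2 / lam)"
    using lam by simp
  finally show ?thesis .
qed

lemma low_deg_mmse_power_estimator:
  assumes "k \<le> n" and d: "odd d" "d \<le> D" and lam: "0 < lam" "2 * real d \<le> sqrt lam"
    and K: "K = (\<integral>z. z\<^sup>2 * exp \<bar>z\<bar> \<partial>std_normal_distribution)"
  shows "low_deg_mmse D n k lam \<le> real n ^ 3 * (real d / lam) ^ d + 8 * real k ^ 3 * (K * (real d)\<^sup>2 / lam)"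
proof -
  let ?J = "tensor_idx n" and ?P = "truncated_prior n k"
  note P = finite_support_prior[of n k]
  have K0: "0 \<le> K" unfolding K by (intro integral_nonneg_AE AE_I2) auto
  have "low_deg_mmse D n k lam \<le> (\<Sum>j\<in>?J. measure_pmf.expectation ?P
      (\<lambda>x. \<integral>z. (1 / sqrt lam ^ d * (sqrt lam * x j + z j) ^ d - x j)\<^sup>2 \<partial>gauss ?J))"
    by (rule low_deg_mmse_upper[of "\<lambda>j y. 1 / sqrt lam ^ d * y j ^ d"])
       (intro Pi_I power_in_polys_upto finite_tensor_idx d, assumption)
  also have "\<dots> \<le> (\<Sum>j\<in>?J. measure_pmf.expectation ?P (\<lambda>x. (real d / lam) ^ d + (x j)\<^sup>2 * (K * (real d)\<^sup>2 / lam)))"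
    using sq_norm_prior(2)[OF assms(1)]
    by (intro sum_mono expectation_mono_finite P power_estimator_error d lam K finite_tensor_idx) auto
  also have "\<dots> = real (card ?J) * (real d / lam) ^ d +
      measure_pmf.expectation ?P (\<lambda>x. \<Sum>j\<in>?J. (x j)\<^sup>2) * (K * (real d)\<^sup>2 / lam)"
    unfolding expectation_sum_finite[OF P]
    by (simp add: integrable_measure_pmf_finite[OF P] sum.distrib sum_distrib_right sum_divide_distrib)
  also have "\<dots> \<le> real n ^ 3 * (real d / lam) ^ d + (2 * real k) ^ 3 * (K * (real d)\<^sup>2 / lam)"
  proof (intro add_mono mult_right_mono)
    have "measure_pmf.expectation ?P (\<lambda>x. \<Sum>j\<in>?J. (x j)\<^sup>2) \<le> measure_pmf.expectation ?P (\<lambda>x. (2 * real k) ^ 3)"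
      using sq_norm_prior(1)[OF assms(1)] by (intro expectation_mono_finite P) auto
    then show "measure_pmf.expectation ?P (\<lambda>x. \<Sum>j\<in>?J. (x j)\<^sup>2) \<le> (2 * real k) ^ 3" by simp
  qed (use lam K0 in \<open>auto simp: tensor_idx_def power3_eq_cube mult.assoc\<close>)
  finally show ?thesis by (simp add: power_mult_distrib)
qed

section \<open>Asymptotics\<close>

lemma power_n_o1_bounds:
  assumes "power_n_o1 b f" and "0 < \<delta>"
  shows "\<forall>\<^sub>F n in sequentially. real n powr (b - \<delta>) \<le> f n \<and> f n \<le> real n powr (b + \<delta>)"
proof -
  obtain \<epsilon> where \<epsilon>: "\<epsilon> \<longlonglongrightarrow> 0" "\<forall>\<^sub>F n in sequentially. f n = real n powr (b + \<epsilon> n)"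
    using assms(1) by (auto simp: power_n_o1_def)
  have "\<forall>\<^sub>F n in sequentially. dist (\<epsilon> n) 0 < \<delta>" using \<epsilon>(1) assms(2) by (rule tendstoD)
  then show ?thesis using \<epsilon>(2) eventually_ge_at_top[of 1]
  proof eventually_elim
    case (elim n)
    then have "\<bar>\<epsilon> n\<bar> < \<delta>" by (simp add: dist_real_def)
    then show ?case using elim by (auto intro!: powr_mono)
  qed
qed

text \<open>Two polynomial bounds replace k = n^(\<beta> + o(1)). The upper one makes k^2 / n
  polynomially small, the lower one makes truncation exponentially unlikely. With
  \<open>b1 < 1 / 4\<close>, \<open>n powr (b1 / 2)\<close> is of lower order than n.\<close>

locale sparse_regime =
  fixes b1 b2 :: real and k :: "nat \<Rightarrow> nat"
  assumes b: "0 < b1" "b1 < 1 / 4" "0 < b2" "b2 < 1 / 2"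
    and k_bounds: "\<forall>\<^sub>F n in sequentially. real n powr b1 \<le> real (k n) \<and> real (k n) \<le> real n powr b2"
begin

lemma k_sq: "\<forall>\<^sub>F n in sequentially. (real (k n))\<^sup>2 / real n \<le> real n powr (2 * b2 - 1)"
  using k_bounds eventually_ge_at_top[of 1]
proof eventually_elim
  case (elim n)
  have "(real (k n))\<^sup>2 \<le> (real n powr b2)\<^sup>2" using elim by (intro power_mono) auto
  also have "\<dots> = real n powr (2 * b2)"
    by (simp add: power2_eq_square flip: powr_add)
  finally have "(real (k n))\<^sup>2 / real n \<le> real n powr (2 * b2) / real n"
    by (intro divide_right_mono) auto
  also have "\<dots> = real n powr (2 * b2 - 1)" using elim by (simp add: powr_diff)
  finally show ?case .
qed

lemma k_basic: "\<forall>\<^sub>F n in sequentially. 0 < n \<and> 0 < k n \<and> k n \<le> n \<and> 4 * (real (k n))\<^sup>2 \<le> real n"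
proof -
  have "((\<lambda>n. real n powr (2 * b2 - 1)) \<longlongrightarrow> 0) sequentially"
    using b by real_asymp
  then have "\<forall>\<^sub>F n in sequentially. real n powr (2 * b2 - 1) < 1 / 4"
    by (rule order_tendstoD) simp
  then show ?thesis using k_sq k_bounds eventually_gt_at_top[of 0]
  proof eventually_elim
    case (elim n)
    have "(real (k n))\<^sup>2 / real n \<le> 1 / 4" using elim by linarith
    then have 4: "4 * (real (k n))\<^sup>2 \<le> real n" using elim by (simp add: field_simps)
    have "0 < real n powr b1" using elim by simp
    then have k0: "0 < k n" using elim by (metis of_nat_0_less_iff order_less_le_trans)
    have "real (k n) \<le> (real (k n))\<^sup>2" using k0 by (simp add: power2_eq_square)
    then have "real (k n) \<le> real n" using 4 by linarith
    then show ?case using 4 k0 elim by simp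
  qed
qed

lemma agree_prob_lower: "\<forall>\<^sub>F n in sequentially. 1 / real n ^ 3 \<le> agree_prob n (k n)"
  using k_basic eventually_ge_at_top[of 2]
proof eventually_elim
  case (elim n)
  have "1 / real n ^ 3 = 1 / (real n * (real n)\<^sup>2)" by (simp add: power3_eq_cube power2_eq_square)
  also have "\<dots> \<le> 1 / (2 * (real n)\<^sup>2)" using elim by (intro divide_left_mono mult_right_mono) auto
  also have "\<dots> \<le> (real (k n))\<^sup>2 / (2 * (real n)\<^sup>2)"
    using elim by (intro divide_right_mono) (auto simp: Suc_leI)
  also have "\<dots> = agree_prob n (k n)" by (simp add: agree_prob_def power_divide)
  finally show ?case .
qed

lemma truncation_small:
  "\<forall>\<^sub>F n in sequentially. truncation_prob n (k n) \<le> 2 * exp (- (real n powr b1) / 10)"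
  using k_basic k_bounds
proof eventually_elim
  case (elim n)
  have "truncation_prob n (k n) \<le> 2 * exp (- real (k n) / 10)"
    using elim by (intro truncation_prob_bound) auto
  also have "\<dots> \<le> 2 * exp (- (real n powr b1) / 10)" using elim by simp
  finally show ?case .
qed

text \<open>\<open>agree_prob\<close> is at least n^(-3), so its m-th power is at least exp (-3 m ln
  n); for m up to \<open>n powr (b1 / 2)\<close> this beats the truncation bound exp (-n^b1 /
  10).\<close>

lemma truncation_negligible:
  "\<forall>\<^sub>F n in sequentially. \<forall>m. real m \<le> real n powr (b1 / 2) \<longrightarrow> 8 * truncation_prob n (k n) \<le> agree_prob n (k n) ^ m"
proof -
  have "\<forall>\<^sub>F n in sequentially. 16 * exp (- (real n powr b1) / 10) \<le> exp (- (real n powr (b1 / 2) * (3 * ln (real n))))"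
    using b by real_asymp
  then show ?thesis using agree_prob_lower truncation_small eventually_ge_at_top[of 1]
  proof eventually_elim
    case (elim n)
    show ?case
    proof (intro allI impI)
      fix m assume m: "real m \<le> real n powr (b1 / 2)"
      have "8 * truncation_prob n (k n) \<le> 16 * exp (- (real n powr b1) / 10)" using elim by linarith
      also have "\<dots> \<le> exp (- (real n powr (b1 / 2) * (3 * ln (real n))))" by (rule elim)
      also have "\<dots> \<le> exp (- (real m * (3 * ln (real n))))"
        using m elim by (auto intro!: mult_right_mono)
      also have "\<dots> = (1 / real n ^ 3) ^ m"
      proof -
        have "exp (3 * ln (real n)) = real n ^ 3"
          using elim exp_of_nat_mult[of 3 "ln (real n)"] by simp
        then have "1 / real n ^ 3 = exp (- (3 * ln (real n)))" by (simp add: exp_minus inverse_eq_divide)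
        then show ?thesis by (simp flip: exp_of_nat_mult)
      qed
      also have "\<dots> \<le> agree_prob n (k n) ^ m" using elim by (intro power_mono) auto
      finally show "8 * truncation_prob n (k n) \<le> agree_prob n (k n) ^ m" .
    qed
  qed
qed

section \<open>The potential below and above the thresholds\<close>

text \<open>The bound \<open>Q\<close> controls both \<open>s + 2\<close> and the cube increment by
  a multiple of (ln n)^3, so \<open>lam n\<close> times the increment is eventually at most ln
  2.\<close>

lemma fp_increasing_below:
  fixes lam Q :: "nat \<Rightarrow> real"
  assumes lam: "\<forall>\<^sub>F n in sequentially. lam n \<le> 1 / ln (real n) ^ 6"
    and Q: "Q \<in> \<Theta>(\<lambda>n. ln (real n) ^ 3)"
  shows "\<forall>\<^sub>F n in sequentially. fp_increasing_upto n (k n) (lam n) (Q n)"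
proof -
  obtain c where c: "c > 0" "\<forall>\<^sub>F n in sequentially. norm (Q n) \<le> c * norm (ln (real n) ^ 3)"
    using bigthetaD1[OF Q] by (elim landau_o.bigE)
  have "\<forall>\<^sub>F n in sequentially. c * ln (real n) ^ 3 \<le> real n powr (b1 / 2)"
    "\<forall>\<^sub>F n in sequentially. c * ln (real n) ^ 3 \<le> real n"
    "\<forall>\<^sub>F n in sequentially. 1 / ln (real n) ^ 6 * (c * ln (real n) ^ 3) \<le> ln 2"
    "\<forall>\<^sub>F n in sequentially. 0 < ln (real n)"
    using b c(1) by real_asymp+
  then show ?thesis using c(2) lam k_basic truncation_negligible
  proof eventually_elim
    case (elim n)
    show ?case unfolding fp_increasing_upto_def
    proof (intro allI impI fp_increasing_step)
      fix s assume s: "real ((s + 2) ^ 3) \<le> Q n"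
      have Qc: "Q n \<le> c * ln (real n) ^ 3" using elim by auto
      have "(s + 2) ^ 1 \<le> (s + 2) ^ 3" by (intro power_increasing) auto
      then have "real (s + 2) \<le> real ((s + 2) ^ 3)" by (simp only: power_one_right of_nat_le_iff)
      then have s2: "real (s + 2) \<le> c * ln (real n) ^ 3" using s Qc by linarith
      then have "real (s + 2) \<le> real n" using elim by linarith
      then show "s + 2 \<le> n" by (simp only: of_nat_le_iff)
      have "real (s + 2) \<le> real n powr (b1 / 2)" using s2 elim by linarith
      then show "8 * truncation_prob n (k n) \<le> agree_prob n (k n) ^ (s + 2)" using elim by blast
      have "lam n * (real ((s + 2) ^ 3) - real (s ^ 3)) \<le> 1 / ln (real n) ^ 6 * (real ((s + 2) ^ 3) - real (s ^ 3))"
        using elim cube_step_ge[of s] by (intro mult_right_mono) linarith+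
      also have "\<dots> \<le> 1 / ln (real n) ^ 6 * (c * ln (real n) ^ 3)"
      proof (intro mult_left_mono)
        have "0 \<le> real (s ^ 3)" by simp
        then show "real ((s + 2) ^ 3) - real (s ^ 3) \<le> c * ln (real n) ^ 3" using s Qc by linarith
      qed (use elim in auto)
      also have "\<dots> \<le> ln 2" by (rule elim)
      finally have "exp (lam n * (real ((s + 2) ^ 3) - real (s ^ 3))) \<le> exp (ln 2)"
        by (rule iffD2[OF exp_le_cancel_iff])
      then show "exp (lam n * (real ((s + 2) ^ 3) - real (s ^ 3))) \<le> 2" by simp
    qed (use elim in auto)
  qed
qed

text \<open>The squared cost is at least n^(-6), which exp (8 (ln n)^6) outweighs; overlaps up to
  n^o(1) stay within the range of \<open>truncation_negligible\<close>.\<close>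

lemma fp_decreasing_above:
  fixes lam Q :: "nat \<Rightarrow> real"
  assumes lam: "\<forall>\<^sub>F n in sequentially. ln (real n) ^ 6 \<le> lam n" and Q: "power_n_o1 0 Q"
  shows "\<forall>\<^sub>F n in sequentially. fp_decreasing_upto n (k n) (lam n) (Q n)"
proof -
  have "\<forall>\<^sub>F n in sequentially. real n powr (0 - b1 / 2) \<le> Q n \<and> Q n \<le> real n powr (0 + b1 / 2)"
    using b by (intro power_n_o1_bounds Q) auto
  moreover have "\<forall>\<^sub>F n in sequentially. 2 * real n powr (b1 / 2) \<le> real n"
    "\<forall>\<^sub>F n in sequentially. 8 < exp (8 * ln (real n) ^ 6) * (1 / real n ^ 3)\<^sup>2"
    "\<forall>\<^sub>F n in sequentially. 0 < ln (real n)"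
    using b by real_asymp+
  ultimately show ?thesis using lam k_basic truncation_negligible agree_prob_lower
  proof eventually_elim
    case (elim n)
    show ?case unfolding fp_decreasing_upto_def
    proof (intro allI impI fp_decreasing_step)
      fix s assume s: "real ((s + 2) ^ 3) \<le> Q n"
      have "(s + 2) ^ 1 \<le> (s + 2) ^ 3" by (intro power_increasing) auto
      then have "real (s + 2) \<le> real ((s + 2) ^ 3)" by (simp only: power_one_right of_nat_le_iff)
      then have s2: "real (s + 2) \<le> real n powr (b1 / 2)" using s elim by auto
      then have "real (2 * (s + 2)) \<le> real n" using elim by simp
      then show "2 * (s + 2) \<le> n" by (simp only: of_nat_le_iff)
      show "8 * truncation_prob n (k n) \<le> agree_prob n (k n) ^ (s + 2)" using s2 elim by blast
      have "0 < ln (real n) ^ 6" using elim by simp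
      then show "0 \<le> lam n" using elim by linarith
      have "8 < exp (8 * ln (real n) ^ 6) * (1 / real n ^ 3)\<^sup>2" by (rule elim)
      also have "\<dots> \<le> exp (8 * lam n) * (agree_prob n (k n))\<^sup>2"
        using elim by (intro mult_mono power_mono) auto
      finally show "8 < exp (8 * lam n) * (agree_prob n (k n))\<^sup>2" .
    qed (use elim in auto)
  qed
qed

section \<open>The low-degree MMSE below and above the thresholds\<close>

text \<open>For p of order ln n the factor n^(3p) is exp (O((ln n)^2)), which the truncation
  probability absorbs. The constant 5 is 4 from the main term plus 1 from truncation.\<close>

lemma overlap_moment_small:
  assumes "0 < c"
  shows "\<forall>\<^sub>F n in sequentially. \<forall>p. 0 < p \<and> real p \<le> c * ln (real n) \<longrightarrow>
    overlap_moment n (k n) p \<le> real (3 * p) ^ (3 * p) * (5 * real n powr (2 * b2 - 1))"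
proof -
  have "\<forall>\<^sub>F n in sequentially. 4 * exp (3 * (c * ln (real n)) * ln (real n)) * exp (- (real n powr b1) / 10) \<le> real n powr (2 * b2 - 1)"
    using b assms by real_asymp
  then show ?thesis using k_basic k_sq truncation_small
  proof eventually_elim
    case (elim n)
    define \<nu> where "\<nu> = real n powr (2 * b2 - 1)"
    show ?case unfolding \<nu>_def[symmetric]
    proof (intro allI impI)
      fix p assume p: "0 < p \<and> real p \<le> c * ln (real n)"
      have ln0: "0 \<le> ln (real n)" using elim by simp
      have "real n ^ (3 * p) = exp (real (3 * p) * ln (real n))"
        using elim by (simp only: exp_of_nat_mult) simp
      also have "\<dots> \<le> exp (3 * (c * ln (real n)) * ln (real n))"
        using p ln0 by (intro iffD2[OF exp_le_cancel_iff] mult_right_mono) auto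
      finally have pow: "real n ^ (3 * p) \<le> exp (3 * (c * ln (real n)) * ln (real n))" .
      have "2 * real n ^ (3 * p) * truncation_prob n (k n) \<le>
          2 * exp (3 * (c * ln (real n)) * ln (real n)) * (2 * exp (- (real n powr b1) / 10))"
        using pow elim by (intro mult_mono) (auto simp: truncation_prob_def)
      also have "\<dots> \<le> \<nu>" unfolding \<nu>_def using elim by simp
      finally have 1: "2 * real n ^ (3 * p) * truncation_prob n (k n) \<le> \<nu>" .
      have \<nu>0: "0 \<le> \<nu>" by (simp add: \<nu>_def)
      have "1 * \<nu> \<le> real (3 * p) ^ (3 * p) * \<nu>"
        using p \<nu>0 by (intro mult_right_mono one_le_power) auto
      then have \<nu>_le: "\<nu> \<le> real (3 * p) ^ (3 * p) * \<nu>" by (simp only: mult_1)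
      have fact: "fact (3 * p) \<le> real (3 * p) ^ (3 * p)"
        by (metis fact_le_power le_refl of_nat_fact of_nat_le_iff of_nat_power)
      have "overlap_moment n (k n) p \<le> fact (3 * p) * (4 * ((real (k n))\<^sup>2 / real n)) + 2 * real n ^ (3 * p) * truncation_prob n (k n)"
        using overlap_moment_bound[of n "k n" p] elim p by simp
      also have "\<dots> \<le> real (3 * p) ^ (3 * p) * (4 * \<nu>) + \<nu>"
        using fact elim by (intro add_mono mult_mono 1) (auto simp: \<nu>_def)
      also have "\<dots> \<le> real (3 * p) ^ (3 * p) * (4 * \<nu>) + real (3 * p) ^ (3 * p) * \<nu>"
        using \<nu>_le by (rule add_left_mono)
      finally show "overlap_moment n (k n) p \<le> real (3 * p) ^ (3 * p) * (5 * \<nu>)" by (simp add: algebra_simps)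
    qed
  qed
qed

text \<open>The first overlap moment uses up at most half of (k/2)^3 = k^3 / 8; the factor 27 below
  is \<open>(3 * p) ^ (3 * p)\<close> at p = 1.\<close>

lemma trivial_mmse_large:
  "\<forall>\<^sub>F n in sequentially. real (k n) ^ 3 / 16 \<le> trivial_mmse n (k n)"
proof -
  have "\<forall>\<^sub>F n in sequentially. 27 * (5 * real n powr (2 * b2 - 1)) \<le> (real n powr b1) ^ 3 / 16"
    "\<forall>\<^sub>F n in sequentially. 1 \<le> 1 * ln (real n)"
    using b by real_asymp+
  then show ?thesis using overlap_moment_small[OF zero_less_one] k_bounds k_basic
  proof eventually_elim
    case (elim n)
    have "overlap_moment n (k n) 1 \<le> real (3 * 1) ^ (3 * 1) * (5 * real n powr (2 * b2 - 1))"
      using elim(3)[rule_format, of 1] elim(2) by simp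
    also have "\<dots> \<le> (real n powr b1) ^ 3 / 16" using elim by simp
    also have "\<dots> \<le> real (k n) ^ 3 / 16" using elim by (intro divide_right_mono power_mono) auto
    finally have "overlap_moment n (k n) 1 \<le> real (k n) ^ 3 / 16" .
    moreover have "(real (k n) / 2) ^ 3 - overlap_moment n (k n) 1 \<le> trivial_mmse n (k n)"
      using elim by (intro trivial_mmse_lower) auto
    moreover have "(real (k n) / 2) ^ 3 = real (k n) ^ 3 / 8" by (simp add: power_divide)
    ultimately show ?case by linarith
  qed
qed

lemma k_cube_bigo: "(\<lambda>n. real (k n) ^ 3) \<in> O(\<lambda>n. trivial_mmse n (k n))"
proof (rule landau_o.bigI[of 16])
  show "\<forall>\<^sub>F n in sequentially. norm (real (k n) ^ 3) \<le> 16 * norm (trivial_mmse n (k n))"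
    using trivial_mmse_large by eventually_elim auto
qed simp

lemma one_smallo_trivial: "(\<lambda>n. 1) \<in> o(\<lambda>n. trivial_mmse n (k n))"
proof -
  have "(\<lambda>n. 1) \<in> o(\<lambda>n. (real n powr b1) ^ 3)" using b by real_asymp
  also have "(\<lambda>n. (real n powr b1) ^ 3) \<in> O(\<lambda>n. real (k n) ^ 3)"
  proof (rule landau_o.bigI[of 1])
    show "\<forall>\<^sub>F n in sequentially. norm ((real n powr b1) ^ 3) \<le> 1 * norm (real (k n) ^ 3)"
      using k_bounds by eventually_elim (auto intro!: power_mono)
  qed simp
  also note k_cube_bigo
  finally show ?thesis .
qed

text \<open>With \<open>L\<close> of order ln n, each further degree multiplies the bound by at most
  108 lam L^5, eventually at most 1. All terms are thus at most 540 L^7 n^(2 b2 - 1), and their sum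
  is at most 1, whereas the trivial error tends to infinity.\<close>

lemma low_deg_mmse_trivial_below:
  fixes lam :: "nat \<Rightarrow> real" and D :: "nat \<Rightarrow> nat"
  assumes lam: "\<forall>\<^sub>F n in sequentially. 0 \<le> lam n \<and> lam n \<le> 1 / ln (real n) ^ 6"
    and D: "(\<lambda>n. real (D n)) \<in> \<Theta>(\<lambda>n. ln (real n))"
  shows "(\<lambda>n. low_deg_mmse (D n) n (k n) (lam n)) \<sim>[sequentially] (\<lambda>n. trivial_mmse n (k n))"
proof -
  obtain c where c: "c > 0" "\<forall>\<^sub>F n in sequentially. norm (real (D n)) \<le> c * norm (ln (real n))"
    using bigthetaD1[OF D] by (elim landau_o.bigE)
  \<comment> \<open>Absorbs the shift from \<open>D n\<close> to \<open>D n + 1\<close>, once ln n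
    is at least 1.\<close>
  define c' where "c' = c + 1"
  have c': "c' > 0" using c by (simp add: c'_def)
  have "\<forall>\<^sub>F n in sequentially. 108 * (1 / ln (real n) ^ 6) * (c' * ln (real n)) ^ 5 \<le> 1"
    "\<forall>\<^sub>F n in sequentially. 540 * (c' * ln (real n)) ^ 8 * real n powr (2 * b2 - 1) \<le> 1"
    "\<forall>\<^sub>F n in sequentially. 1 \<le> ln (real n)"
    using b c' by real_asymp+
  then have "\<forall>\<^sub>F n in sequentially. norm (low_deg_mmse (D n) n (k n) (lam n) - trivial_mmse n (k n)) \<le> 1 * norm (1::real)"
    using c(2) lam overlap_moment_small[OF c']
  proof eventually_elim
    case (elim n)
    define L where "L = c' * ln (real n)"
    define \<nu> where "\<nu> = real n powr (2 * b2 - 1)"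
    define l where "l = lam n"
    have \<nu>0: "0 \<le> \<nu>" by (simp add: \<nu>_def)
    have l: "0 \<le> l" "l \<le> 1 / ln (real n) ^ 6" using elim by (auto simp: l_def)
    have DL: "real (D n) + 1 \<le> L" using elim by (simp add: L_def c'_def algebra_simps)
    have L1: "1 \<le> L" using DL by linarith
    have small: "108 * l * L ^ 5 \<le> 1"
    proof -
      have "108 * l * L ^ 5 \<le> 108 * (1 / ln (real n) ^ 6) * L ^ 5"
        using l L1 by (intro mult_right_mono mult_left_mono) auto
      also have "\<dots> \<le> 1" unfolding L_def by (rule elim)
      finally show ?thesis .
    qed
    have "(\<Sum>d\<le>D n. 4 ^ (d + 1) * l ^ d * real (d + 1) ^ (2 * d + 4) * overlap_moment n (k n) (d + 1)) \<le>
        (\<Sum>d\<le>D n. 540 * L ^ 7 * \<nu>)"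
    proof (rule sum_mono)
      fix d assume "d \<in> {..D n}"
      then have d: "real (d + 1) \<le> L" using DL by simp
      have "overlap_moment n (k n) (d + 1) \<le> real (3 * (d + 1)) ^ (3 * (d + 1)) * (5 * \<nu>)"
      proof -
        have "0 < d + 1 \<and> real (d + 1) \<le> c' * ln (real n)" using d by (simp add: L_def)
        from elim(6)[rule_format, OF this] show ?thesis unfolding \<nu>_def .
      qed
      also have "\<dots> \<le> (3 * L) ^ (3 * (d + 1)) * (5 * \<nu>)"
        using d \<nu>0 by (intro mult_right_mono power_mono) auto
      finally have om: "overlap_moment n (k n) (d + 1) \<le> (3 * L) ^ (3 * (d + 1)) * (5 * \<nu>)" .
      have om0: "0 \<le> overlap_moment n (k n) (d + 1)"
        unfolding overlap_moment_def by (intro integral_nonneg_AE AE_I2) auto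
      have "4 ^ (d + 1) * l ^ d * real (d + 1) ^ (2 * d + 4) * overlap_moment n (k n) (d + 1) \<le>
          4 ^ (d + 1) * l ^ d * L ^ (2 * d + 4) * ((3 * L) ^ (3 * (d + 1)) * (5 * \<nu>))"
        using d l om om0 L1 by (intro mult_mono power_mono) auto
      also have "\<dots> = (108 * l * L ^ 5) ^ d * (540 * L ^ 7 * \<nu>)"
      proof -
        have gen: "4 ^ (d + 1) * l ^ d * (A ^ d * M) * (B ^ d * X * Y) = (4 * l * A * B) ^ d * (4 * M * X * Y)"
          for A B M X Y :: real by (simp add: power_mult_distrib)
        have e: "L ^ (2 * d + 4) = (L\<^sup>2) ^ d * L ^ 4" "(3 * L) ^ (3 * (d + 1)) = ((3 * L) ^ 3) ^ d * (3 * L) ^ 3"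
          by (simp_all add: power_add power_mult)
        have "4 ^ (d + 1) * l ^ d * L ^ (2 * d + 4) * ((3 * L) ^ (3 * (d + 1)) * (5 * \<nu>)) =
            (4 * l * L\<^sup>2 * (3 * L) ^ 3) ^ d * (4 * L ^ 4 * (3 * L) ^ 3 * (5 * \<nu>))"
          unfolding e by (rule gen)
        also have "4 * l * L\<^sup>2 * (3 * L) ^ 3 = 108 * l * L ^ 5" by (simp add: eval_nat_numeral)
        also have "4 * L ^ 4 * (3 * L) ^ 3 * (5 * \<nu>) = 540 * L ^ 7 * \<nu>" by (simp add: eval_nat_numeral)
        finally show ?thesis .
      qed
      also have "\<dots> \<le> 1 * (540 * L ^ 7 * \<nu>)"
        using small l L1 \<nu>0 by (intro mult_right_mono power_le_one) auto
      finally show "4 ^ (d + 1) * l ^ d * real (d + 1) ^ (2 * d + 4) * overlap_moment n (k n) (d + 1) \<le> 540 * L ^ 7 * \<nu>"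
        by simp
    qed
    also have "\<dots> = (real (D n) + 1) * (540 * L ^ 7 * \<nu>)" by simp
    also have "\<dots> \<le> L * (540 * L ^ 7 * \<nu>)" using DL L1 \<nu>0 by (intro mult_right_mono) auto
    also have "\<dots> = 540 * L ^ 8 * \<nu>" by (simp add: eval_nat_numeral)
    also have "\<dots> \<le> 1" using elim by (simp add: L_def \<nu>_def)
    finally have "(\<Sum>d\<le>D n. 4 ^ (d + 1) * l ^ d * real (d + 1) ^ (2 * d + 4) * overlap_moment n (k n) (d + 1)) \<le> 1" .
    then show ?case
      using low_deg_mmse_lower[OF l(1), of n "k n" "D n"] low_deg_mmse_le_trivial[of "D n" n "k n" l]
      by (simp add: l_def)
  qed
  then have "(\<lambda>n. low_deg_mmse (D n) n (k n) (lam n) - trivial_mmse n (k n)) \<in> O(\<lambda>n. 1)"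
    by (rule landau_o.bigI[rotated]) simp
  then have "(\<lambda>n. low_deg_mmse (D n) n (k n) (lam n) - trivial_mmse n (k n)) \<in> o(\<lambda>n. trivial_mmse n (k n))"
    using one_smallo_trivial by (rule landau_o.big_small_trans)
  then show ?thesis by (simp add: asymp_equiv_altdef)
qed

text \<open>With t = ln n, the degree d is at least c1 t - 1 and d / lam at most 1 / t, so the noise
  part is n^3 exp (-(c1 t - 1) ln t), bounded because ln t tends to infinity. The signal part is of
  order k^3 / t^4.\<close>

lemma low_deg_mmse_smallo_above:
  fixes lam :: "nat \<Rightarrow> real" and D :: "nat \<Rightarrow> nat"
  assumes lam: "\<forall>\<^sub>F n in sequentially. ln (real n) ^ 6 \<le> lam n"
    and D: "(\<lambda>n. real (D n)) \<in> \<Theta>(\<lambda>n. ln (real n))"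
  shows "(\<lambda>n. low_deg_mmse (D n) n (k n) (lam n)) \<in> o(\<lambda>n. trivial_mmse n (k n))"
proof -
  obtain c2 where c2: "c2 > 0" "\<forall>\<^sub>F n in sequentially. norm (real (D n)) \<le> c2 * norm (ln (real n))"
    using bigthetaD1[OF D] by (elim landau_o.bigE)
  obtain c1 where c1: "c1 > 0" "\<forall>\<^sub>F n in sequentially. norm (real (D n)) \<ge> c1 * norm (ln (real n))"
    using bigthetaD2[OF D] by (elim landau_omega.bigE)
  define K where "K = (\<integral>z. z\<^sup>2 * exp \<bar>z\<bar> \<partial>std_normal_distribution)"
  have K0: "0 \<le> K" unfolding K_def by (intro integral_nonneg_AE AE_I2) auto
  have ev: "\<forall>\<^sub>F n in sequentially. 1 \<le> c1 * ln (real n)"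
    "\<forall>\<^sub>F n in sequentially. 2 * (c2 * ln (real n)) \<le> ln (real n) ^ 3"
    "\<forall>\<^sub>F n in sequentially. c2 * ln (real n) / ln (real n) ^ 6 \<le> 1 / ln (real n)"
    "\<forall>\<^sub>F n in sequentially. real n ^ 3 * exp (- ((c1 * ln (real n) - 1) * ln (ln (real n)))) \<le> 1"
    "\<forall>\<^sub>F n in sequentially. 1 < ln (real n)"
    using c1(1) c2(1) by real_asymp+
  have "\<forall>\<^sub>F n in sequentially. norm (low_deg_mmse (D n) n (k n) (lam n)) \<le>
      1 * norm (1 + 8 * K * c2\<^sup>2 * (real (k n) ^ 3 * (1 / ln (real n) ^ 4)))"
    using ev c1(2) c2(2) lam k_basic
  proof eventually_elim
    case (elim n)
    define t where "t = ln (real n)"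
    define l where "l = lam n"
    have t1: "1 < t" using elim by (simp add: t_def)
    have l: "t ^ 6 \<le> l" using elim by (simp add: t_def l_def)
    have "0 < t ^ 6" using t1 by simp
    then have l0: "0 < l" using l by linarith
    have D: "c1 * t \<le> real (D n)" "real (D n) \<le> c2 * t" "1 \<le> D n"
      using elim t1 by (auto simp: t_def)
    \<comment> \<open>The largest odd degree allowed; it is at least \<open>D n - 1\<close>.\<close>
    define d where "d = (if odd (D n) then D n else D n - 1)"
    have d: "odd d" "d \<le> D n" "real (D n) - 1 \<le> real d"
      using D(3) by (auto simp: d_def)
    have d2: "real d \<le> c2 * t" using d(2) D(2) by (meson le_trans of_nat_mono order_trans)
    have sqrt: "2 * real d \<le> sqrt l"
    proof -
      have "2 * real d \<le> t ^ 3" using d2 elim by (simp add: t_def)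
      then have "(2 * real d)\<^sup>2 \<le> (t ^ 3)\<^sup>2" by (intro power_mono) auto
      also have "(t ^ 3)\<^sup>2 = t ^ 6" by (simp flip: power_mult)
      finally show ?thesis using l by (intro real_le_rsqrt) linarith
    qed
    have "real d / l \<le> c2 * t / t ^ 6"
      using d2 l l0 t1 c2(1) by (intro frac_le) auto
    also have "\<dots> \<le> 1 / t" using elim by (simp add: t_def)
    finally have "real d / l \<le> 1 / t" .
    then have "(real d / l) ^ d \<le> (1 / t) ^ d" using l0 by (intro power_mono) auto
    also have "\<dots> = exp (- (real d * ln t))"
    proof -
      have "1 / t = exp (- ln t)" using t1 by (simp add: exp_minus inverse_eq_divide)
      then show ?thesis by (simp flip: exp_of_nat_mult)
    qed
    also have "\<dots> \<le> exp (- ((c1 * t - 1) * ln t))"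
      using d(3) D(1) t1 by (auto intro!: mult_right_mono)
    finally have "real n ^ 3 * (real d / l) ^ d \<le> real n ^ 3 * exp (- ((c1 * t - 1) * ln t))"
      by (intro mult_left_mono) auto
    also have "\<dots> \<le> 1" using elim by (simp add: t_def)
    finally have 1: "real n ^ 3 * (real d / l) ^ d \<le> 1" .
    have "(real d)\<^sup>2 / l \<le> (c2 * t)\<^sup>2 / t ^ 6"
      using d2 l t1 by (intro frac_le power_mono) auto
    also have "\<dots> = c2\<^sup>2 * (1 / t ^ 4)" using t1 by (simp add: power_mult_distrib divide_simps eval_nat_numeral)
    finally have "8 * real (k n) ^ 3 * (K * ((real d)\<^sup>2 / l)) \<le> 8 * real (k n) ^ 3 * (K * (c2\<^sup>2 * (1 / t ^ 4)))"
      using K0 by (intro mult_left_mono) auto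
    then have "low_deg_mmse (D n) n (k n) l \<le> 1 + 8 * real (k n) ^ 3 * (K * (c2\<^sup>2 * (1 / t ^ 4)))"
      using low_deg_mmse_power_estimator[OF _ d(1,2) l0 sqrt K_def, of "k n" n] 1 elim by simp
    then have "low_deg_mmse (D n) n (k n) l \<le> 1 + 8 * K * c2\<^sup>2 * (real (k n) ^ 3 * (1 / t ^ 4))"
      by (simp add: mult_ac)
    then show ?case using low_deg_mmse_nonneg[of "D n" n "k n" l] unfolding l_def t_def by simp
  qed
  then have "(\<lambda>n. low_deg_mmse (D n) n (k n) (lam n)) \<in>
      O(\<lambda>n. 1 + 8 * K * c2\<^sup>2 * (real (k n) ^ 3 * (1 / ln (real n) ^ 4)))"
    by (rule landau_o.bigI[rotated]) simp
  also have "(\<lambda>n. 1 + 8 * K * c2\<^sup>2 * (real (k n) ^ 3 * (1 / ln (real n) ^ 4))) \<in> o(\<lambda>n. trivial_mmse n (k n))"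
  proof (intro sum_in_smallo one_smallo_trivial)
    have "(\<lambda>n. 1 / ln (real n) ^ 4) \<in> o(\<lambda>n. 1)" by real_asymp
    then have "(\<lambda>n. real (k n) ^ 3 * (1 / ln (real n) ^ 4)) \<in> o(\<lambda>n. trivial_mmse n (k n) * 1)"
      by (rule landau_o.big_small_mult[OF k_cube_bigo])
    then have "(\<lambda>n. real (k n) ^ 3 * (1 / ln (real n) ^ 4)) \<in> o(\<lambda>n. trivial_mmse n (k n))" by simp
    from landau_o.big_small_mult[OF _ this, of "\<lambda>_. 8 * K * c2\<^sup>2" "\<lambda>_. 1"]
    show "(\<lambda>n. 8 * K * c2\<^sup>2 * (real (k n) ^ 3 * (1 / ln (real n) ^ 4))) \<in> o(\<lambda>n. trivial_mmse n (k n))"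
      by (simp only: mult_1 bigo_const simp_thms) 
  qed
  finally show ?thesis .
qed

end

section \<open>Choice of the thresholds\<close>

theorem theoremA7:
  fixes \<beta> C :: real and k :: "nat \<Rightarrow> nat"
  assumes "0 < \<beta>" and "\<beta> < 1 / 2"
    and "power_n_o1 \<beta> (\<lambda>n. real (k n))"
    and "C > 0"
  shows "\<exists>lam1 lam2 :: nat \<Rightarrow> real.
    polylog_order_one lam1 \<and> polylog_order_one lam2 \<and> (\<forall>n. lam1 n < lam2 n) \<and>
    (\<forall>lam :: nat \<Rightarrow> real.
      (\<forall>\<^sub>F n in sequentially. real n powr (- C) \<le> lam n \<and> lam n \<le> real n powr C) \<longrightarrow>
      ((\<forall>\<^sub>F n in sequentially. lam n \<le> lam1 n) \<longrightarrow>
         (\<forall>Q :: nat \<Rightarrow> real. Q \<in> \<Theta>(\<lambda>n. ln (real n) ^ 3) \<longrightarrow>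
            (\<forall>\<^sub>F n in sequentially. fp_increasing_upto n (k n) (lam n) (Q n))) \<and>
         (\<forall>D :: nat \<Rightarrow> nat. (\<lambda>n. real (D n)) \<in> \<Theta>(\<lambda>n. ln (real n)) \<longrightarrow>
            (\<lambda>n. low_deg_mmse (D n) n (k n) (lam n)) \<sim>[sequentially]
              (\<lambda>n. trivial_mmse n (k n)))) \<and>
      ((\<forall>\<^sub>F n in sequentially. lam2 n \<le> lam n) \<longrightarrow>
         (\<forall>Q :: nat \<Rightarrow> real. power_n_o1 0 Q \<longrightarrow>
            (\<forall>\<^sub>F n in sequentially. fp_decreasing_upto n (k n) (lam n) (Q n))) \<and>
         (\<forall>D :: nat \<Rightarrow> nat. (\<lambda>n. real (D n)) \<in> \<Theta>(\<lambda>n. ln (real n)) \<longrightarrow>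
            (\<lambda>n. low_deg_mmse (D n) n (k n) (lam n)) \<in> o(\<lambda>n. trivial_mmse n (k n)))))"
proof -
  \<comment> \<open>The sixth power suffices throughout: below, lam (ln n)^5 must vanish; above,
    sqrt lam must exceed twice a degree of order ln n. The values 1 and 2 for \<open>n < 4\<close>
    keep the inequality strict at every n, as \<open>ln n > 1\<close> is used from 4 on.\<close>
  define lam1 :: "nat \<Rightarrow> real" where "lam1 n = (if 4 \<le> n then 1 / ln (real n) ^ 6 else 1)" for n
  define lam2 :: "nat \<Rightarrow> real" where "lam2 n = (if 4 \<le> n then ln (real n) ^ 6 else 2)" for n
  \<comment> \<open>Leaves \<open>\<beta> - \<delta>\<close> at least \<beta>/2, hence positive, and
    \<open>\<beta> + \<delta>\<close> at most 1/4 + \<beta>/2, hence below 1/2.\<close>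
  define \<delta> where "\<delta> = min (\<beta> / 2) (1 / 4 - \<beta> / 2)"
  have \<delta>: "0 < \<delta>" "\<delta> \<le> \<beta> / 2" "\<delta> \<le> 1 / 4 - \<beta> / 2"
    using assms unfolding \<delta>_def by linarith+
  \<comment> \<open>Lowering the exponent to at most 1/5 only weakens the lower bound on
    \<open>k\<close> and meets \<open>b1 < 1 / 4\<close>.\<close>
  define b1 where "b1 = min (\<beta> - \<delta>) (1 / 5)"
  interpret sparse_regime b1 "\<beta> + \<delta>" k
  proof
    show "\<forall>\<^sub>F n in sequentially. real n powr b1 \<le> real (k n) \<and> real (k n) \<le> real n powr (\<beta> + \<delta>)"
      using power_n_o1_bounds[OF assms(3) \<delta>(1)] eventually_ge_at_top[of 1]
    proof eventually_elim
      case (elim n)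
      have "real n powr b1 \<le> real n powr (\<beta> - \<delta>)" using elim by (intro powr_mono) (auto simp: b1_def)
      then show ?case using elim by linarith
    qed
  qed (use assms \<delta> in \<open>auto simp: b1_def min_def\<close>)
  have ln4: "1 < ln (real n)" if "4 \<le> n" for n
  proof -
    have "exp 1 < real n" using exp_le that by linarith
    then have "ln (exp 1) < ln (real n)" using that by (subst ln_less_cancel_iff) auto
    then show ?thesis by simp
  qed
  have ev4: "\<forall>\<^sub>F n in sequentially. 4 \<le> (n::nat)" by (rule eventually_ge_at_top)
  have polylog: "polylog_order_one lam1 \<and> polylog_order_one lam2"
    unfolding polylog_order_one_def
  proof (intro conjI exI[of _ "6::real"])
    have pw: "ln (real n) powr 6 = ln (real n) ^ 6" "ln (real n) powr - 6 = 1 / ln (real n) ^ 6"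
      "1 / ln (real n) ^ 6 \<le> 1" "1 \<le> ln (real n) ^ 6" if "4 \<le> n" for n
    proof -
      have "1 \<le> ln (real n) ^ 6" using ln4[OF that] by (intro one_le_power) simp
      then show "1 / ln (real n) ^ 6 \<le> 1" "1 \<le> ln (real n) ^ 6" by (auto simp: divide_le_eq_1)
    qed (use ln4[OF that] in \<open>simp_all add: powr_minus_divide\<close>)
    show "\<forall>\<^sub>F n in sequentially. ln (real n) powr - 6 \<le> lam1 n \<and> lam1 n \<le> ln (real n) powr 6"
      using ev4
    proof eventually_elim
      case (elim n)
      then have "lam1 n = 1 / ln (real n) ^ 6" by (simp add: lam1_def)
      then show ?case using pw[OF elim] by linarith
    qed
    show "\<forall>\<^sub>F n in sequentially. ln (real n) powr - 6 \<le> lam2 n \<and> lam2 n \<le> ln (real n) powr 6"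
      using ev4
    proof eventually_elim
      case (elim n)
      then have "lam2 n = ln (real n) ^ 6" by (simp add: lam2_def)
      then show ?case using pw[OF elim] by linarith
    qed
  qed auto
  have less: "lam1 n < lam2 n" for n
  proof (cases "4 \<le> n")
    case True
    then have "1 < ln (real n) ^ 6" using ln4[of n] by (intro one_less_power) auto
    then have "1 / ln (real n) ^ 6 < 1" by (simp add: divide_less_eq_1)
    also note \<open>1 < ln (real n) ^ 6\<close>
    finally show ?thesis using True by (simp add: lam1_def lam2_def)
  qed (simp add: lam1_def lam2_def)
  have below: "\<forall>\<^sub>F n in sequentially. 0 \<le> lam n \<and> lam n \<le> 1 / ln (real n) ^ 6"
    if "\<forall>\<^sub>F n in sequentially. real n powr (- C) \<le> lam n \<and> lam n \<le> real n powr C"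
      "\<forall>\<^sub>F n in sequentially. lam n \<le> lam1 n" for lam
    using that ev4
  proof eventually_elim
    case (elim n)
    \<comment> \<open>The polynomial lower bound on \<open>lam n\<close> supplies its
      nonnegativity.\<close>
    have "0 \<le> real n powr (- C)" by simp
    then have "0 \<le> lam n" using elim by linarith
    then show ?case using elim by (simp add: lam1_def)
  qed
  have above: "\<forall>\<^sub>F n in sequentially. ln (real n) ^ 6 \<le> lam n"
    if "\<forall>\<^sub>F n in sequentially. lam2 n \<le> lam n" for lam
    using that ev4 by eventually_elim (auto simp: lam2_def)
  have below': "\<forall>\<^sub>F n in sequentially. lam n \<le> 1 / ln (real n) ^ 6"
    if "\<forall>\<^sub>F n in sequentially. lam n \<le> lam1 n" for lam
    using that ev4 by eventually_elim (auto simp: lam1_def)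
  show ?thesis
    by (rule exI[of _ lam1], rule exI[of _ lam2], intro conjI allI impI less
        fp_increasing_below[OF below'] low_deg_mmse_trivial_below[OF below]
        fp_decreasing_above[OF above] low_deg_mmse_smallo_above[OF above])
       (use polylog in blast)+
qed

end
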